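(* Assume (A1) and (A2), and let $f_0:\Theta\to\mathbb{R}$ be measurable with $\eta'(f_0)\in L^\infty(\tau)$. Assume that there exists $\mu^*\in\mathcal{M}(\Theta)$ such that $\bar F(\mu^* )=\inf_{f\in L^1(\tau)}F(f)$. In case $(\mathrm{A2})_+$ (i.e. $\operatorname{dom}\eta=[0,+\infty[$), assume moreover that $\mu^*\in\mathcal{M}_+(\Theta)$. For $\alpha> 0$ define $$\psi(\alpha)=\inf_{f\in L^1(\tau)}\Big\{F(f)-\inf F+\alpha\, D_{\bar\eta}(f,f_0)\Big\}.$$ Then $$\psi(\alpha)\lesssim \inf_{\epsilon>0}\Big\{\epsilon^q+\alpha\,\epsilon^d\,\eta(\epsilon^{-d})\Big\},$$ i.e. there exist $C>0$ and $\alpha_0>0$ such that $\psi(\alpha)\le C\inf_{\epsilon>0}\{\epsilon^q+\alpha\epsilon^d\eta(\epsilon^{-d})\}$ for all $\alpha\in\,]0,\alpha_0]$, where the bound holds: - with $q=1$ if $\Phi$ is Lipschitz continuous; - with $q=2$ if $\Phi$ is Lipschitz continuous and $\bar G'[\mu^*]=0$, or if $\nabla_\theta\Phi$ is Lipschitz continuous; - with $q=4$ if $\nabla_\theta\Phi$ is Lipschitz continuous and $\bar G'[\mu^*]=0$.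
   Context: $\Theta$ is a compact $d$-dimensional Riemannian manifold without boundary, with geodesic distance $\mathrm{dist}$, and $\tau$ is the probability measure on $\Theta$ proportional to the volume measure. $\mathcal{M}(\Theta)$ (resp. $\mathcal{M}_+(\Theta)$, $\mathcal{P}(\Theta)$) is the set of finite signed (resp. finite nonnegative, probability) Borel measures on $\Theta$, and $\|\mu\|$ is the total variation norm. $\iota_C$ is the convex indicator of $C$ ($0$ on $C$, $+\infty$ elsewhere). $\operatorname{dom}$ of a function is the set where it is $<+\infty$. Objective: $\bar F=\bar G+\bar H:\mathcal{M}(\Theta)\to\mathbb{R}\cup\{+\infty\}$ with $\bar G(\mu)=R\big(\int\Phi\,\mathrm{d}\mu\big)$, under (A1): $\Phi\in\mathcal{C}^0(\Theta;\mathcal{F})$ where $\mathcal{F}$ is a Hilbert space; $R:\mathcal{F}\to\mathbb{R}$ is convex and differentiable with Lipschitz gradient $\nabla R$; $\bar H$ is a sum of functions from the list $\iota_{\mathcal{P}(\Theta)}$, $\iota_{\mathcal{M}_+(\Theta)}$, $\mu\mapsto\lambda\|\mu\|$, $\iota_{\{\mu:\lambda\|\mu\|\le1\}}$ (with $\lambda\ge0$), and $\bar H$ is not identically $+\infty$. For $f\in L^1(\tau)$: $F(f)=\bar F(f\tau)$, $G(f)=\bar G(f\tau)$, $H(f)=\bar H(f\tau)$, and $\inf F=\inf_{L^1(\tau)}F$. The differential of $\bar G$ at $\mu$ is represented by the function $\bar G'[\mu](\theta)=\langle\nabla R(\int\Phi\,\mathrm{d}\mu),\Phi(\theta)\rangle_{\mathcal{F}}$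 on $\Theta$. "$\nabla_\theta\Phi$ Lipschitz" means that $\Phi$ is continuously differentiable with Lipschitz derivative. (A2): $\eta:\mathbb{R}\to[0,\infty]$ is strictly convex (on its domain), lower semicontinuous, continuously differentiable in $\operatorname{int}(\operatorname{dom}\eta)$, with $\eta'(\operatorname{int}(\operatorname{dom}\eta))=\mathbb{R}$, and for any $c>0$, $\eta(cx)\asymp\eta(x)$ as $x\to+\infty$ (each side is bounded by a constant times the other for $x$ large). Moreover either $(\mathrm{A2})_+$: $\operatorname{dom}\eta=[0,+\infty[$ and $\eta(1)=\eta'(1)=0$; or $(\mathrm{A2})_\pm$: $\operatorname{dom}\eta=\mathbb{R}$, $\eta$ is even and $\eta(0)=\eta'(0)=0$. Divergences: $D_\eta(a,b)=\eta(a)-\eta(b)-\eta'(b)(a-b)$ and $D_{\bar\eta}(f,g)=\int_\Theta D_\eta(f(\theta),g(\theta))\,\mathrm{d}\tau(\theta)\in[0,+\infty]$. The condition $\eta'(f_0)\in L^\infty(\tau)$ includes that $f_0\in\operatorname{int}(\operatorname{dom}\eta)$ almost everywhere. *)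

theory Defs
  imports "HOL-Analysis.Analysis"
begin

section \<open>Compact Riemannian manifolds\<close>

text \<open>C^k and smooth maps on an open set of a Euclidean space, by iterated directional
  derivatives.\<close>

primrec Ck_on :: "nat \<Rightarrow> ('a::euclidean_space \<Rightarrow> 'b::real_normed_vector) \<Rightarrow> 'a set \<Rightarrow> bool" where
  "Ck_on 0 f S \<longleftrightarrow> continuous_on S f"
| "Ck_on (Suc k) f S \<longleftrightarrow>
     (\<forall>x\<in>S. f differentiable (at x)) \<and>
     (\<forall>v. Ck_on k (\<lambda>x. frechet_derivative f (at x) v) S)"

definition smooth_on :: "('a::euclidean_space \<Rightarrow> 'b::real_normed_vector) \<Rightarrow> 'a set \<Rightarrow> bool" where
  "smooth_on f S \<longleftrightarrow> (\<forall>k. Ck_on k f S)"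

text \<open>A chart together with the coordinate expression of the metric tensor:
  \<open>chart_metric c x u v\<close> is the inner product of the tangent vectors with coordinates \<open>u\<close>, \<open>v\<close>
  at the point with coordinates \<open>x\<close>.\<close>

record ('m, 'n) metric_chart =
  chart_dom :: "'m set"
  chart_map :: "'m \<Rightarrow> real ^ 'n"
  chart_metric :: "real ^ 'n \<Rightarrow> real ^ 'n \<Rightarrow> real ^ 'n \<Rightarrow> real"

definition chart_image :: "('m, 'n::finite) metric_chart \<Rightarrow> (real ^ 'n) set" where
  "chart_image c = chart_map c ` chart_dom c"

definition chart_inv :: "('m, 'n::finite) metric_chart \<Rightarrow> real ^ 'n \<Rightarrow> 'm" where
  "chart_inv c = inv_into (chart_dom c) (chart_map c)"

definition metric_chart_ok ::
    "('m::topological_space, 'n::finite) metric_chart \<Rightarrow> bool" where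
  "metric_chart_ok c \<longleftrightarrow>
     open (chart_dom c) \<and> open (chart_image c) \<and>
     homeomorphism (chart_dom c) (chart_image c) (chart_map c) (chart_inv c) \<and>
     (\<forall>x\<in>chart_image c.
        bilinear (chart_metric c x) \<and>
        (\<forall>u v. chart_metric c x u v = chart_metric c x v u) \<and>
        (\<forall>u. u \<noteq> 0 \<longrightarrow> chart_metric c x u u > 0)) \<and>
     (\<forall>u v. smooth_on (\<lambda>x. chart_metric c x u v) (chart_image c))"

definition charts_compatible ::
    "('m::topological_space, 'n::finite) metric_chart \<Rightarrow> ('m, 'n) metric_chart \<Rightarrow> bool" where
  "charts_compatible c c' \<longleftrightarrow>
     (let W = chart_map c ` (chart_dom c \<inter> chart_dom c');
          T = chart_map c' \<circ> chart_inv c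
      in smooth_on T W \<and>
         (\<forall>x\<in>W. \<forall>u v. chart_metric c x u v =
            chart_metric c' (T x) (frechet_derivative T (at x) u) (frechet_derivative T (at x) v)))"

definition riemannian_atlas ::
    "('m::topological_space, 'n::finite) metric_chart set \<Rightarrow> bool" where
  "riemannian_atlas \<A> \<longleftrightarrow>
     (\<Union>c\<in>\<A>. chart_dom c) = UNIV \<and>
     (\<forall>c\<in>\<A>. metric_chart_ok c) \<and>
     (\<forall>c\<in>\<A>. \<forall>c'\<in>\<A>. charts_compatible c c')"

text \<open>Curves are parametrised by [0,1]; locally in each chart they are piecewise C^1.\<close>

definition pw_C1_curve ::
    "('m::topological_space, 'n::finite) metric_chart set \<Rightarrow> (real \<Rightarrow> 'm) \<Rightarrow> bool" where
  "pw_C1_curve \<A> \<gamma> \<longleftrightarrow>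
     continuous_on {0..1} \<gamma> \<and>
     (\<forall>t\<in>{0..1}. \<forall>c\<in>\<A>. \<gamma> t \<in> chart_dom c \<longrightarrow>
        (\<exists>\<delta>>0. \<gamma> ` ({t-\<delta>..t+\<delta>} \<inter> {0..1}) \<subseteq> chart_dom c \<and>
           (chart_map c \<circ> \<gamma>) piecewise_C1_differentiable_on ({t-\<delta>..t+\<delta>} \<inter> {0..1})))"

text \<open>By compatibility of the charts, the speed does not depend on the chart that is selected.\<close>

definition curve_speed ::
    "('m::topological_space, 'n::finite) metric_chart set \<Rightarrow> (real \<Rightarrow> 'm) \<Rightarrow> real \<Rightarrow> real" where
  "curve_speed \<A> \<gamma> t =
     (let c = (SOME c. c \<in> \<A> \<and> \<gamma> t \<in> chart_dom c);
          v = vector_derivative (chart_map c \<circ> \<gamma>) (at t)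
      in sqrt (chart_metric c (chart_map c (\<gamma> t)) v v))"

definition curve_length ::
    "('m::topological_space, 'n::finite) metric_chart set \<Rightarrow> (real \<Rightarrow> 'm) \<Rightarrow> ennreal" where
  "curve_length \<A> \<gamma> = (\<integral>\<^sup>+ t\<in>{0..1}. ennreal (curve_speed \<A> \<gamma> t) \<partial>lborel)"

text \<open>The distance between points of different connected components is \<open>\<infinity>\<close>; connectedness is
  not required anywhere.\<close>

definition geodesic_dist ::
    "('m::topological_space, 'n::finite) metric_chart set \<Rightarrow> 'm \<Rightarrow> 'm \<Rightarrow> ennreal" where
  "geodesic_dist \<A> x y =
     (INF \<gamma>\<in>{\<gamma>. pw_C1_curve \<A> \<gamma> \<and> \<gamma> 0 = x \<and> \<gamma> 1 = y}. curve_length \<A> \<gamma>)"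

definition volume_density :: "('m, 'n::finite) metric_chart \<Rightarrow> real ^ 'n \<Rightarrow> real" where
  "volume_density c x =
     sqrt (det (\<chi> i j. chart_metric c x (axis i 1) (axis j 1)))"

text \<open>The charts cover the manifold, so the local formula determines the Borel measure \<open>vol\<close>.\<close>

definition riemannian_volume ::
    "('m::topological_space, 'n::finite) metric_chart set \<Rightarrow> 'm measure \<Rightarrow> bool" where
  "riemannian_volume \<A> vol \<longleftrightarrow>
     sets vol = sets borel \<and>
     (\<forall>c\<in>\<A>. \<forall>B\<in>sets borel. B \<subseteq> chart_dom c \<longrightarrow>
        emeasure vol B = (\<integral>\<^sup>+ x\<in>chart_map c ` B. ennreal (volume_density c x) \<partial>lborel))"

definition lipschitz_geodesic ::
    "('m::topological_space, 'n::finite) metric_chart set \<Rightarrow> ('m \<Rightarrow> 'h::real_normed_vector) \<Rightarrow> bool" where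
  "lipschitz_geodesic \<A> \<Phi> \<longleftrightarrow>
     (\<exists>L::real. L \<ge> 0 \<and>
        (\<forall>x y. ennreal (norm (\<Phi> x - \<Phi> y)) \<le> ennreal L * geodesic_dist \<A> x y))"

text \<open>Continuously differentiable with Lipschitz derivative.  Derivatives at different points live
  on different tangent spaces, so they are compared in charts; since a chart need not extend to
  the closure of its domain, the Lipschitz bound in a chart is local.  On a compact
  manifold this is the class of maps whose derivative is (globally) Lipschitz.\<close>

definition lipschitz_derivative ::
    "('m::topological_space, 'n::finite) metric_chart set \<Rightarrow> ('m \<Rightarrow> 'h::real_normed_vector) \<Rightarrow> bool" where
  "lipschitz_derivative \<A> \<Phi> \<longleftrightarrow>
     (\<forall>c\<in>\<A>. \<exists>D :: real ^ 'n \<Rightarrow> ((real ^ 'n) \<Rightarrow>\<^sub>L 'h).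
        (\<forall>x\<in>chart_image c. ((\<Phi> \<circ> chart_inv c) has_derivative blinfun_apply (D x)) (at x)) \<and>
        (\<forall>x\<in>chart_image c. \<exists>r>0. \<exists>L. L-lipschitz_on (ball x r \<inter> chart_image c) D))"


section \<open>Finite signed Borel measures\<close>

text \<open>A signed measure is a real set function; only its values on Borel sets matter.\<close>

definition signed_borel_measure :: "('m::topological_space set \<Rightarrow> real) \<Rightarrow> bool" where
  "signed_borel_measure \<mu> \<longleftrightarrow>
     \<mu> {} = 0 \<and>
     (\<forall>A :: nat \<Rightarrow> 'm set. range A \<subseteq> sets borel \<longrightarrow> disjoint_family A \<longrightarrow>
        (\<lambda>n. \<mu> (A n)) sums \<mu> (\<Union>n. A n))"

definition nonneg_on_borel :: "('m::topological_space set \<Rightarrow> real) \<Rightarrow> bool" where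
  "nonneg_on_borel \<mu> \<longleftrightarrow> (\<forall>A\<in>sets borel. 0 \<le> \<mu> A)"

definition total_variation :: "('m::topological_space set \<Rightarrow> real) \<Rightarrow> ereal" where
  "total_variation \<mu> =
     (SUP P\<in>{P. finite P \<and> disjoint P \<and> P \<subseteq> sets borel \<and> \<Union>P = UNIV}. ereal (\<Sum>A\<in>P. \<bar>\<mu> A\<bar>))"

text \<open>Positive part of the Jordan decomposition; the negative part of \<open>\<mu>\<close> is the positive part
  of \<open>-\<mu>\<close>.  Here \<open>ennreal\<close> maps negative numbers to \<open>0\<close>.\<close>

definition positive_part :: "('m::topological_space set \<Rightarrow> real) \<Rightarrow> 'm measure" where
  "positive_part \<mu> =
     measure_of UNIV (sets borel) (\<lambda>A. SUP B\<in>{B\<in>sets borel. B \<subseteq> A}. ennreal (\<mu> B))"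

definition signed_integral ::
    "('m::topological_space set \<Rightarrow> real) \<Rightarrow> ('m \<Rightarrow> real) \<Rightarrow> real" where
  "signed_integral \<mu> f =
     integral\<^sup>L (positive_part \<mu>) f - integral\<^sup>L (positive_part (\<lambda>A. - \<mu> A)) f"

text \<open>The Hilbert-space-valued integral is taken in the weak sense, because the Bochner integral of
  the library is only available for separable spaces.\<close>

definition hilbert_integral ::
    "('m::topological_space set \<Rightarrow> real) \<Rightarrow> ('m \<Rightarrow> 'h::real_inner) \<Rightarrow> 'h" where
  "hilbert_integral \<mu> \<Phi> =
     (THE v. \<forall>u. v \<bullet> u = signed_integral \<mu> (\<lambda>\<theta>. \<Phi> \<theta> \<bullet> u))"

definition density_measure :: "'m::topological_space measure \<Rightarrow> ('m \<Rightarrow> real) \<Rightarrow> 'm set \<Rightarrow> real" where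
  "density_measure \<tau> f A = set_lebesgue_integral \<tau> A f"


section \<open>The objective\<close>

definition convex_indicator :: "('x \<Rightarrow> bool) \<Rightarrow> 'x \<Rightarrow> ereal" where
  "convex_indicator P x = (if P x then 0 else \<infinity>)"

definition elementary_regularizers :: "(('m::topological_space set \<Rightarrow> real) \<Rightarrow> ereal) set" where
  "elementary_regularizers =
     {convex_indicator (\<lambda>\<mu>. nonneg_on_borel \<mu> \<and> \<mu> UNIV = 1),
      convex_indicator nonneg_on_borel}
     \<union> {(\<lambda>\<mu>. ereal l * total_variation \<mu>) | l. 0 \<le> l}
     \<union> {convex_indicator (\<lambda>\<mu>. ereal l * total_variation \<mu> \<le> 1) | l. 0 \<le> l}"

definition H_bar ::
    "(('m set \<Rightarrow> real) \<Rightarrow> ereal) list \<Rightarrow> ('m set \<Rightarrow> real) \<Rightarrow> ereal" where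
  "H_bar hs \<mu> = (\<Sum>h\<leftarrow>hs. h \<mu>)"

definition F_bar ::
    "('h::real_inner \<Rightarrow> real) \<Rightarrow> ('m::topological_space \<Rightarrow> 'h) \<Rightarrow>
     (('m set \<Rightarrow> real) \<Rightarrow> ereal) list \<Rightarrow> ('m set \<Rightarrow> real) \<Rightarrow> ereal" where
  "F_bar R \<Phi> hs \<mu> = ereal (R (hilbert_integral \<mu> \<Phi>)) + H_bar hs \<mu>"

definition G_bar_deriv ::
    "('h::real_inner \<Rightarrow> 'h) \<Rightarrow> ('m::topological_space \<Rightarrow> 'h) \<Rightarrow> ('m set \<Rightarrow> real) \<Rightarrow> 'm \<Rightarrow> real" where
  "G_bar_deriv gradR \<Phi> \<mu> \<theta> = gradR (hilbert_integral \<mu> \<Phi>) \<bullet> \<Phi> \<theta>"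

definition assumption_A1 ::
    "('h::{real_inner,complete_space} \<Rightarrow> real) \<Rightarrow> ('h \<Rightarrow> 'h) \<Rightarrow> ('m::topological_space \<Rightarrow> 'h) \<Rightarrow>
     (('m set \<Rightarrow> real) \<Rightarrow> ereal) list \<Rightarrow> bool" where
  "assumption_A1 R gradR \<Phi> hs \<longleftrightarrow>
     continuous_on UNIV \<Phi> \<and>
     convex_on UNIV R \<and> (\<forall>x. GDERIV R x :> gradR x) \<and> (\<exists>L. L-lipschitz_on UNIV gradR) \<and>
     set hs \<subseteq> elementary_regularizers \<and>
     (\<exists>\<mu>. signed_borel_measure \<mu> \<and> H_bar hs \<mu> \<noteq> \<infinity>)"

definition F_density ::
    "('h::real_inner \<Rightarrow> real) \<Rightarrow> ('m::topological_space \<Rightarrow> 'h) \<Rightarrow>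
     (('m set \<Rightarrow> real) \<Rightarrow> ereal) list \<Rightarrow> 'm measure \<Rightarrow> ('m \<Rightarrow> real) \<Rightarrow> ereal" where
  "F_density R \<Phi> hs \<tau> f = F_bar R \<Phi> hs (density_measure \<tau> f)"

definition inf_F ::
    "('h::real_inner \<Rightarrow> real) \<Rightarrow> ('m::topological_space \<Rightarrow> 'h) \<Rightarrow>
     (('m set \<Rightarrow> real) \<Rightarrow> ereal) list \<Rightarrow> 'm measure \<Rightarrow> ereal" where
  "inf_F R \<Phi> hs \<tau> = (INF f\<in>{f. integrable \<tau> f}. F_density R \<Phi> hs \<tau> f)"


section \<open>The entropy and its divergence\<close>

definition edom :: "(real \<Rightarrow> ereal) \<Rightarrow> real set" where
  "edom \<eta> = {x. \<eta> x < \<infinity>}"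

definition ederiv :: "(real \<Rightarrow> ereal) \<Rightarrow> real \<Rightarrow> real" where
  "ederiv \<eta> = deriv (\<lambda>x. real_of_ereal (\<eta> x))"

definition assumption_A2_plus :: "(real \<Rightarrow> ereal) \<Rightarrow> bool" where
  "assumption_A2_plus \<eta> \<longleftrightarrow> edom \<eta> = {0..} \<and> \<eta> 1 = 0 \<and> ederiv \<eta> 1 = 0"

definition assumption_A2_pm :: "(real \<Rightarrow> ereal) \<Rightarrow> bool" where
  "assumption_A2_pm \<eta> \<longleftrightarrow>
     edom \<eta> = UNIV \<and> (\<forall>x. \<eta> (- x) = \<eta> x) \<and> \<eta> 0 = 0 \<and> ederiv \<eta> 0 = 0"

definition assumption_A2 :: "(real \<Rightarrow> ereal) \<Rightarrow> bool" where
  "assumption_A2 \<eta> \<longleftrightarrow>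
     (\<forall>x. 0 \<le> \<eta> x) \<and>
     (\<forall>x\<in>edom \<eta>. \<forall>y\<in>edom \<eta>. \<forall>t\<in>{0<..<1}. x \<noteq> y \<longrightarrow>
        \<eta> ((1 - t) * x + t * y) < ereal (1 - t) * \<eta> x + ereal t * \<eta> y) \<and>
     (\<forall>x. \<eta> x \<le> Liminf (at x) \<eta>) \<and>
     (\<forall>x\<in>interior (edom \<eta>). (\<lambda>y. real_of_ereal (\<eta> y)) differentiable (at x)) \<and>
     continuous_on (interior (edom \<eta>)) (ederiv \<eta>) \<and>
     ederiv \<eta> ` interior (edom \<eta>) = UNIV \<and>
     (\<forall>c>0. \<exists>K>0. \<forall>\<^sub>F x in at_top. \<eta> (c * x) \<le> ereal K * \<eta> x \<and> \<eta> x \<le> ereal K * \<eta> (c * x)) \<and>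
     (assumption_A2_plus \<eta> \<or> assumption_A2_pm \<eta>)"

text \<open>Used only with \<open>b\<close> in the interior of the domain, where \<open>\<eta> b\<close> is finite; the value is then
  nonnegative by convexity, so that \<open>e2ennreal\<close> below does not truncate.\<close>

definition D_eta :: "(real \<Rightarrow> ereal) \<Rightarrow> real \<Rightarrow> real \<Rightarrow> ereal" where
  "D_eta \<eta> a b = \<eta> a - \<eta> b - ereal (ederiv \<eta> b * (a - b))"

definition D_bar ::
    "(real \<Rightarrow> ereal) \<Rightarrow> 'm measure \<Rightarrow> ('m \<Rightarrow> real) \<Rightarrow> ('m \<Rightarrow> real) \<Rightarrow> ereal" where
  "D_bar \<eta> \<tau> f g = enn2ereal (\<integral>\<^sup>+ \<theta>. e2ennreal (D_eta \<eta> (f \<theta>) (g \<theta>)) \<partial>\<tau>)"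

definition psi ::
    "('h::real_inner \<Rightarrow> real) \<Rightarrow> ('m::topological_space \<Rightarrow> 'h) \<Rightarrow>
     (('m set \<Rightarrow> real) \<Rightarrow> ereal) list \<Rightarrow> 'm measure \<Rightarrow>
     (real \<Rightarrow> ereal) \<Rightarrow> ('m \<Rightarrow> real) \<Rightarrow> real \<Rightarrow> ereal" where
  "psi R \<Phi> hs \<tau> \<eta> f0 \<alpha> =
     (INF f\<in>{f. integrable \<tau> f}.
        F_density R \<Phi> hs \<tau> f - inf_F R \<Phi> hs \<tau> + ereal \<alpha> * D_bar \<eta> \<tau> f f0)"

definition rate_bound :: "(real \<Rightarrow> ereal) \<Rightarrow> nat \<Rightarrow> (real \<Rightarrow> ereal) \<Rightarrow> nat \<Rightarrow> bool" where
  "rate_bound \<eta> d \<psi> q \<longleftrightarrow>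
     (\<exists>C>0. \<exists>\<alpha>0>0. \<forall>\<alpha>\<in>{0<..\<alpha>0}.
        \<psi> \<alpha> \<le> ereal C * (INF \<epsilon>\<in>{0<..}. ereal (\<epsilon> ^ q) + ereal (\<alpha> * \<epsilon> ^ d) * \<eta> (1 / \<epsilon> ^ d)))"

end

theory Submission
  imports Defs
begin

text \<open>
  Replace \<open>\<mu>s\<close> by the density \<open>f \<theta> = \<integral> k \<theta> \<theta>' d\<mu>s(\<theta>')\<close>, where \<open>k \<cdot> \<theta>'\<close> is the density with respect to
  \<open>\<tau>\<close> of the normalised Lebesgue measure on a coordinate ball of radius \<open>\<epsilon>\<close> around \<open>\<theta>'\<close>, in a chart chosen
  measurably among finitely many.  Smoothing preserves the total mass and the sign and does not increase the total variation,
  so \<open>H\<close> does not increase.  The mean of \<open>\<Phi>\<close> over the ball differs from \<open>\<Phi> \<theta>'\<close> by \<open>O(\<epsilon>)\<close> if \<open>\<Phi>\<close> is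
  Lipschitz, and by \<open>O(\<epsilon>^2)\<close> if its derivative is Lipschitz, because the linear term of the
  Taylor expansion is odd.  Hence \<open>\<integral> \<Phi> d(f\<tau>) - \<integral> \<Phi> d\<mu>s\<close> has this order, and so does
  the increase of \<open>G\<close>; if the differential of \<open>G\<close> at \<open>\<mu>s\<close> vanishes, only the quadratic remainder
  is left and the exponent doubles.  Finally \<open>\<bar>f\<bar> \<le> S = K \<epsilon>^(-d)\<close> and
  \<open>\<integral> \<bar>f\<bar> d\<tau>\<close> is bounded, so that \<open>\<eta>(f) \<le> \<eta>(0) + \<bar>f\<bar> \<eta>(S) / S\<close> gives an entropy of
  order \<open>\<epsilon>^d \<eta>(\<epsilon>^(-d))\<close>; the constants are absorbed because \<open>\<eta>\<close> grows superlinearly.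
\<close>

section \<open>Jordan decomposition of signed measures\<close>

text \<open>The balls are coordinate balls because the second-order gain needs an exact symmetry:
  Lebesgue measure on such a ball is invariant under reflection through the centre, so every linear
  term averages to exactly zero. The price is a kernel that divides by the density of \<tau> in the
  chart; that density is bounded below only on compact parts of the chart image, hence the closed
  balls of twice the radius kept inside it. The kernel is normalised in \<theta> for each fixed
  \<theta>', so the chart may jump as \<theta>' varies without disturbing mass or error. Since
  \<Phi> takes values in a general Hilbert space, estimates are made on scalar integrals tested
  against a vector u, with a bound proportional to \<open>norm u\<close>; taking the error itself
  for u turns them into norm bounds. Local constants depend on the chart and the ball; a finite
  cover makes them uniform before the measure enters. Smoothing is used a second time, on a measure
  where \<open>H_bar\<close> is finite, to show that \<open>inf_F\<close> is finite, so that the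
  difference in \<open>psi\<close> is one of real numbers.\<close>

lemma signed_borel_measure_finite_Un:
  assumes "signed_borel_measure \<mu>" "A \<in> sets borel" "B \<in> sets borel" "A \<inter> B = {}"
  shows "\<mu> (A \<union> B) = \<mu> A + \<mu> B"
proof -
  have e: "\<mu> {} = 0" using assms(1) by (simp add: signed_borel_measure_def)
  have "range (binaryset A B) \<subseteq> sets borel"
    using assms(2,3) unfolding range_binaryset_eq by auto
  moreover have "disjoint_family (binaryset A B)"
    using assms(4) unfolding disjoint_family_on_def binaryset_def by auto
  ultimately have "(\<lambda>n. \<mu> (binaryset A B n)) sums \<mu> (\<Union>n. binaryset A B n)"
    using assms(1) unfolding signed_borel_measure_def by blast
  then have "(\<lambda>n. \<mu> (binaryset A B n)) sums \<mu> (A \<union> B)"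
    unfolding UN_binaryset_eq .
  moreover have "(\<lambda>n. \<mu> (binaryset A B n)) sums (\<mu> A + \<mu> B)"
    by (rule binaryset_sums[of \<mu>, OF e])
  ultimately show ?thesis by (rule sums_unique2)
qed

lemma signed_borel_measure_uminus:
  "signed_borel_measure \<mu> \<Longrightarrow> signed_borel_measure (\<lambda>A. - \<mu> A)"
  unfolding signed_borel_measure_def by (auto intro: sums_minus)

text \<open>\<open>measure_of\<close> silently yields the zero measure if its set function is not
  countably additive, so the supremum is named and its additivity proved before
  \<open>positive_part\<close> is evaluated.\<close>

definition positive_variation :: "('m::topological_space set \<Rightarrow> real) \<Rightarrow> 'm set \<Rightarrow> ennreal" where
  "positive_variation \<mu> A = (SUP B\<in>{B\<in>sets borel. B \<subseteq> A}. ennreal (\<mu> B))"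

lemma positive_variation_ge:
  "B \<in> sets borel \<Longrightarrow> B \<subseteq> A \<Longrightarrow> ennreal (\<mu> B) \<le> positive_variation \<mu> A"
  unfolding positive_variation_def by (rule SUP_upper) auto

lemma positive_variation_mono: "A \<subseteq> B \<Longrightarrow> positive_variation \<mu> A \<le> positive_variation \<mu> B"
  unfolding positive_variation_def by (rule SUP_subset_mono) auto

text \<open>The union of a witness for \<open>A\<close> and a witness for \<open>B\<close> is a
  witness for \<open>A \<union> B\<close>. If one of them has negative measure,
  \<open>ennreal\<close> has truncated it to 0 and the other is used alone.\<close>

lemma positive_variation_superadditive:
  assumes s: "signed_borel_measure \<mu>" and "A \<inter> B = {}"
  shows "positive_variation \<mu> A + positive_variation \<mu> B \<le> positive_variation \<mu> (A \<union> B)"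
proof -
  have *: "ennreal (\<mu> C) + ennreal (\<mu> D) \<le> positive_variation \<mu> (A \<union> B)"
    if C: "C \<in> sets borel" "C \<subseteq> A" and D: "D \<in> sets borel" "D \<subseteq> B" for C D
  proof (cases "0 \<le> \<mu> C \<and> 0 \<le> \<mu> D")
    case True
    have "\<mu> (C \<union> D) = \<mu> C + \<mu> D"
      using signed_borel_measure_finite_Un[OF s] C D assms(2) by blast
    moreover have "ennreal (\<mu> (C \<union> D)) \<le> positive_variation \<mu> (A \<union> B)"
      by (rule positive_variation_ge) (use C D in auto)
    ultimately show ?thesis using True by (simp add: ennreal_plus)
  next
    case False
    then have "ennreal (\<mu> C) = 0 \<or> ennreal (\<mu> D) = 0"
      by (auto simp: ennreal_neg)
    moreover have "ennreal (\<mu> C) \<le> positive_variation \<mu> (A \<union> B)"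
      "ennreal (\<mu> D) \<le> positive_variation \<mu> (A \<union> B)"
      by (rule positive_variation_ge; use C D in blast)+
    ultimately show ?thesis by auto
  qed
  have ne: "{C \<in> sets borel. C \<subseteq> A} \<noteq> {}" "{C \<in> sets borel. C \<subseteq> B} \<noteq> {}" by auto
  show ?thesis
    unfolding positive_variation_def[of \<mu> A] positive_variation_def[of \<mu> B]
    apply (subst ennreal_SUP_add_left[symmetric, OF ne(1)])
    apply (rule SUP_least)
    apply (subst ennreal_SUP_add_right[OF ne(2)])
    apply (rule SUP_least)
    using * by (auto simp: positive_variation_def[of \<mu> "A \<union> B"])
qed

text \<open>Superadditivity on finite unions gives one inequality. For the other, a witness
  \<open>B\<close> is cut into the pieces \<open>B \<inter> A i\<close>, and the partial sums of
  their measures are bounded after dropping the negative terms.\<close>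

lemma positive_variation_countably_additive:
  assumes s: "signed_borel_measure \<mu>"
  shows "countably_additive (sets borel) (positive_variation \<mu>)"
proof (rule countably_additiveI)
  fix A :: "nat \<Rightarrow> 'a set"
  assume A: "range A \<subseteq> sets borel" "disjoint_family A" "(\<Union>i. A i) \<in> sets borel"
  have fin: "(\<Sum>i<n. positive_variation \<mu> (A i)) \<le> positive_variation \<mu> (\<Union>i<n. A i)" for n
  proof (induction n)
    case 0
    then show ?case by simp
  next
    case (Suc n)
    have "A i \<inter> A n = {}" if "i < n" for i
      using disjoint_family_onD[OF A(2), of i n] that by auto
    then have "(\<Union>i<n. A i) \<inter> A n = {}" by blast
    note positive_variation_superadditive[OF s this]
    moreover have "(\<Union>i<n. A i) \<union> A n = (\<Union>i<Suc n. A i)" by (auto simp: less_Suc_eq)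
    ultimately show ?case using Suc by (auto intro: order_trans add_right_mono)
  qed
  show "(\<Sum>i. positive_variation \<mu> (A i)) = positive_variation \<mu> (\<Union>i. A i)"
  proof (rule antisym)
    have "(\<Sum>i<n. positive_variation \<mu> (A i)) \<le> positive_variation \<mu> (\<Union>i. A i)" for n
      by (rule order_trans[OF fin positive_variation_mono]) auto
    then show "(\<Sum>i. positive_variation \<mu> (A i)) \<le> positive_variation \<mu> (\<Union>i. A i)"
      by (intro suminf_le_const) auto
  next
    show "positive_variation \<mu> (\<Union>i. A i) \<le> (\<Sum>i. positive_variation \<mu> (A i))"
      unfolding positive_variation_def[of \<mu> "\<Union>i. A i"]
    proof (rule SUP_least)
      fix B assume "B \<in> {B \<in> sets borel. B \<subseteq> (\<Union>i. A i)}"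
      then have B: "B \<in> sets borel" "B \<subseteq> (\<Union>i. A i)" by auto
      have "range (\<lambda>n. B \<inter> A n) \<subseteq> sets borel" using A(1) B(1) by blast
      moreover have "disjoint_family (\<lambda>n. B \<inter> A n)"
        using A(2) unfolding disjoint_family_on_def by blast
      ultimately have "(\<lambda>n. \<mu> (B \<inter> A n)) sums \<mu> (\<Union>n. B \<inter> A n)"
        using s unfolding signed_borel_measure_def by blast
      moreover have "(\<Union>n. B \<inter> A n) = B" using B by auto
      ultimately have "(\<lambda>n. \<Sum>i<n. \<mu> (B \<inter> A i)) \<longlonglongrightarrow> \<mu> B" by (simp add: sums_def)
      then have "(\<lambda>n. ennreal (\<Sum>i<n. \<mu> (B \<inter> A i))) \<longlonglongrightarrow> ennreal (\<mu> B)"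
        by (rule tendsto_ennrealI)
      moreover have "ennreal (\<Sum>i<n. \<mu> (B \<inter> A i)) \<le> (\<Sum>i. positive_variation \<mu> (A i))" for n
      proof -
        have "ennreal (\<Sum>i<n. \<mu> (B \<inter> A i)) \<le> ennreal (\<Sum>i<n. max 0 (\<mu> (B \<inter> A i)))"
          by (intro ennreal_leI sum_mono) auto
        also have "\<dots> = (\<Sum>i<n. ennreal (max 0 (\<mu> (B \<inter> A i))))"
          by (rule sum_ennreal[symmetric]) auto
        also have "\<dots> \<le> (\<Sum>i<n. positive_variation \<mu> (A i))"
        proof (rule sum_mono)
          fix i
          have "ennreal (max 0 (\<mu> (B \<inter> A i))) = ennreal (\<mu> (B \<inter> A i))"
            by (auto simp: max_def ennreal_neg)
          also have "\<dots> \<le> positive_variation \<mu> (A i)"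
            by (rule positive_variation_ge) (use A B in auto)
          finally show "ennreal (max 0 (\<mu> (B \<inter> A i))) \<le> positive_variation \<mu> (A i)" .
        qed
        also have "\<dots> \<le> (\<Sum>i. positive_variation \<mu> (A i))"
          by (rule sum_le_suminf) auto
        finally show ?thesis .
      qed
      ultimately show "ennreal (\<mu> B) \<le> (\<Sum>i. positive_variation \<mu> (A i))"
        by (intro LIMSEQ_le_const2) auto
    qed
  qed
qed

lemma sets_positive_part [simp]: "sets (positive_part \<mu>) = sets borel"
  unfolding positive_part_def using sets.sigma_sets_eq[of borel] by simp

lemma space_positive_part [simp]: "space (positive_part \<mu>) = UNIV"
  using sets_eq_imp_space_eq[OF sets_positive_part, of \<mu>] by simp

lemma measurable_positive_part [simp]: "measurable (positive_part \<mu>) N = measurable borel N"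
  by (rule measurable_cong_sets) simp_all

lemma emeasure_positive_part:
  assumes s: "signed_borel_measure \<mu>" and A: "A \<in> sets borel"
  shows "emeasure (positive_part \<mu>) A = positive_variation \<mu> A"
proof (rule emeasure_measure_of)
  show "positive_part \<mu> = measure_of UNIV (sets borel) (positive_variation \<mu>)"
    unfolding positive_part_def positive_variation_def by simp
  have "\<mu> {} = 0" using s by (simp add: signed_borel_measure_def)
  then show "positive (sets (positive_part \<mu>)) (positive_variation \<mu>)"
    by (auto simp: positive_def positive_variation_def)
  show "countably_additive (sets (positive_part \<mu>)) (positive_variation \<mu>)"
    using positive_variation_countably_additive[OF s] by simp
qed (use A in auto)

lemma positive_variation_Un:
  assumes s: "signed_borel_measure \<mu>" and "A \<in> sets borel" "B \<in> sets borel" "A \<inter> B = {}"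
  shows "positive_variation \<mu> (A \<union> B) = positive_variation \<mu> A + positive_variation \<mu> B"
  using plus_emeasure[of A "positive_part \<mu>" B] assms by (simp add: emeasure_positive_part)

text \<open>A set of infinite variation would contain a decreasing sequence of such sets whose
  successive differences have measure larger than 1 in absolute value, contradicting the
  convergence of the series of their measures.\<close>

lemma infinite_variation_split:
  fixes \<mu> :: "'m::topological_space set \<Rightarrow> real"
  assumes s: "signed_borel_measure \<mu>"
    and E: "E \<in> sets borel" "positive_variation \<mu> E + positive_variation (\<lambda>A. - \<mu> A) E = \<infinity>"
  shows "\<exists>B\<in>sets borel. B \<subseteq> E \<and> \<bar>\<mu> (E - B)\<bar> > 1 \<and>
           positive_variation \<mu> B + positive_variation (\<lambda>A. - \<mu> A) B = \<infinity>"
proof -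
  let ?V = "\<lambda>E. positive_variation \<mu> E + positive_variation (\<lambda>A. - \<mu> A) E"
  have n: "signed_borel_measure (\<lambda>A. - \<mu> A)" by (rule signed_borel_measure_uminus[OF s])
  \<comment> \<open>The margin \<open>1 + \<bar>\<mu> E\<bar>\<close> forces both \<open>B\<close>
    and \<open>E - B\<close> to have measure above 1 in absolute value. It is not known which of the
    two keeps infinite variation, so either must be admissible as the successor.\<close>
  have pick: "\<exists>B\<in>sets borel. B \<subseteq> E \<and> \<nu> B > 1 + \<bar>\<mu> E\<bar>"
    if "positive_variation \<nu> E = \<infinity>" for \<nu>
  proof -
    have "ennreal (1 + \<bar>\<mu> E\<bar>) < positive_variation \<nu> E" using that by simp
    then obtain B where "B \<in> sets borel" "B \<subseteq> E" "ennreal (1 + \<bar>\<mu> E\<bar>) < ennreal (\<nu> B)"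
      unfolding positive_variation_def less_SUP_iff by auto
    then show ?thesis by (subst (asm) ennreal_less_iff) auto
  qed
  have "positive_variation \<mu> E = \<infinity> \<or> positive_variation (\<lambda>A. - \<mu> A) E = \<infinity>"
    using E(2) by (simp add: ennreal_add_eq_top)
  then obtain B where B: "B \<in> sets borel" "B \<subseteq> E" "\<bar>\<mu> B\<bar> > 1 + \<bar>\<mu> E\<bar>"
    using pick[of \<mu>] pick[of "\<lambda>A. - \<mu> A"] by (smt (verit, best))
  have D: "E - B \<in> sets borel" using B E by auto
  have EB: "B \<union> (E - B) = E" "B \<inter> (E - B) = {}" "E - (E - B) = B" using B by auto
  have "\<mu> E = \<mu> B + \<mu> (E - B)"
    using signed_borel_measure_finite_Un[OF s B(1) D] EB by simp
  then have 1: "\<bar>\<mu> (E - B)\<bar> > 1" "\<bar>\<mu> B\<bar> > 1" using B(3) by linarith+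
  have "?V E = ?V B + ?V (E - B)"
    using positive_variation_Un[OF s B(1) D] positive_variation_Un[OF n B(1) D] EB
    by (simp add: ac_simps)
  then have "?V B + ?V (E - B) = \<infinity>" using E(2) by simp
  then have "?V B = \<infinity> \<or> ?V (E - B) = \<infinity>" by (simp only: ennreal_add_eq_top infinity_ennreal_def)
  then show ?thesis
  proof
    assume "?V B = \<infinity>"
    then show ?thesis using B 1 by blast
  next
    assume "?V (E - B) = \<infinity>"
    then show ?thesis using D 1 EB by (intro bexI[of _ "E - B"]) auto
  qed
qed

lemma finite_variation:
  fixes \<mu> :: "'m::topological_space set \<Rightarrow> real"
  assumes s: "signed_borel_measure \<mu>"
  shows "positive_variation \<mu> UNIV < \<infinity>"
proof (rule ccontr)
  assume "\<not> ?thesis"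
  let ?P = "\<lambda>E. E \<in> sets borel \<and>
    positive_variation \<mu> E + positive_variation (\<lambda>A. - \<mu> A) E = \<infinity>"
  have 0: "?P UNIV" using \<open>\<not> positive_variation \<mu> UNIV < \<infinity>\<close> by (simp add: less_top[symmetric])
  have "\<exists>E. \<forall>n. ?P (E n) \<and> E (Suc n) \<subseteq> E n \<and> \<bar>\<mu> (E n - E (Suc n))\<bar> > 1"
  proof (rule dependent_nat_choice)
    show "\<exists>E. ?P E" using 0 by blast
    show "\<exists>B. ?P B \<and> B \<subseteq> E \<and> \<bar>\<mu> (E - B)\<bar> > 1" if "?P E" for E and n :: nat
      using infinite_variation_split[OF s, of E] that by blast
  qed
  then obtain E where E: "\<And>n. E n \<in> sets borel" "\<And>n. E (Suc n) \<subseteq> E n"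
    "\<And>n. \<bar>\<mu> (E n - E (Suc n))\<bar> > 1" by blast
  have dec: "decseq E" using E(2) by (rule decseq_SucI)
  have "disjoint_family (\<lambda>n. E n - E (Suc n))"
    unfolding disjoint_family_on_def
  proof (intro ballI impI)
    fix m n :: nat assume "m \<noteq> n"
    then consider "Suc m \<le> n" | "Suc n \<le> m" by linarith
    then show "(E m - E (Suc m)) \<inter> (E n - E (Suc n)) = {}"
      using decseqD[OF dec, of "Suc m" n] decseqD[OF dec, of "Suc n" m] by cases blast+
  qed
  moreover have "range (\<lambda>n. E n - E (Suc n)) \<subseteq> sets borel" using E(1) by blast
  ultimately have "(\<lambda>n. \<mu> (E n - E (Suc n))) sums \<mu> (\<Union>n. E n - E (Suc n))"
    using s unfolding signed_borel_measure_def by blast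
  then have "(\<lambda>n. \<mu> (E n - E (Suc n))) \<longlonglongrightarrow> 0"
    by (intro summable_LIMSEQ_zero) (auto simp: summable_def)
  then have "eventually (\<lambda>n. \<bar>\<mu> (E n - E (Suc n))\<bar> < 1) sequentially"
    by (auto simp: tendsto_iff dist_real_def)
  then obtain n where "\<bar>\<mu> (E n - E (Suc n))\<bar> < 1" by (auto simp: eventually_sequentially)
  then show False using E(3)[of n] by simp
qed

lemma finite_measure_positive_part:
  "signed_borel_measure \<mu> \<Longrightarrow> finite_measure (positive_part \<mu>)"
  using finite_variation[of \<mu>] emeasure_positive_part[of \<mu> UNIV]
  by (intro finite_measureI) (auto simp: less_top)

lemma measure_positive_part_ge:
  assumes s: "signed_borel_measure \<mu>" and "B \<in> sets borel" "B \<subseteq> A" "A \<in> sets borel"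
  shows "\<mu> B \<le> measure (positive_part \<mu>) A"
proof -
  interpret finite_measure "positive_part \<mu>" by (rule finite_measure_positive_part[OF s])
  have "ennreal (\<mu> B) \<le> emeasure (positive_part \<mu>) A"
    using positive_variation_ge[of B A \<mu>] assms by (simp add: emeasure_positive_part)
  then show ?thesis by (simp add: emeasure_eq_measure ennreal_le_iff)
qed

lemma measure_positive_part_le:
  assumes s: "signed_borel_measure \<mu>" and A: "A \<in> sets borel"
    and c: "\<And>B. B \<in> sets borel \<Longrightarrow> B \<subseteq> A \<Longrightarrow> \<mu> B \<le> c"
  shows "measure (positive_part \<mu>) A \<le> c"
proof -
  interpret finite_measure "positive_part \<mu>" by (rule finite_measure_positive_part[OF s])
  have "0 \<le> c" using c[of "{}"] s by (auto simp: signed_borel_measure_def)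
  have "emeasure (positive_part \<mu>) A \<le> ennreal c"
    unfolding emeasure_positive_part[OF s A] positive_variation_def
    by (rule SUP_least) (auto intro!: ennreal_leI c)
  then show ?thesis using \<open>0 \<le> c\<close> by (simp add: emeasure_eq_measure ennreal_le_iff)
qed

text \<open>For \<open>B\<close> inside \<open>A\<close>,
  \<open>\<nu> B = \<nu> A - \<nu> (A - B)\<close>, and \<open>- \<nu> (A - B)\<close> is at most
  the negative part of \<open>A\<close>. The supremum over \<open>B\<close> gives one inequality,
  and the same argument for the negated measure gives the other.\<close>

lemma jordan_decomposition:
  assumes s: "signed_borel_measure \<mu>" and A: "A \<in> sets borel"
  shows "\<mu> A = measure (positive_part \<mu>) A - measure (positive_part (\<lambda>A. - \<mu> A)) A"
proof -
  have le: "measure (positive_part \<nu>) A \<le> \<nu> A + measure (positive_part (\<lambda>A. - \<nu> A)) A"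
    if s: "signed_borel_measure \<nu>" for \<nu>
  proof (rule measure_positive_part_le[OF s A])
    fix B assume B: "B \<in> sets borel" "B \<subseteq> A"
    have D: "A - B \<in> sets borel" using A B by auto
    have "\<nu> A = \<nu> B + \<nu> (A - B)"
      using signed_borel_measure_finite_Un[OF s B(1) D] B by (simp add: Un_absorb1)
    moreover have "- \<nu> (A - B) \<le> measure (positive_part (\<lambda>A. - \<nu> A)) A"
      using measure_positive_part_ge[OF signed_borel_measure_uminus[OF s] D _ A] by auto
    ultimately show "\<nu> B \<le> \<nu> A + measure (positive_part (\<lambda>A. - \<nu> A)) A" by simp
  qed
  from le[OF s] le[OF signed_borel_measure_uminus[OF s]] show ?thesis by simp
qed

text \<open>Two-set partitions suffice: \<open>\<bar>\<mu> B\<bar> + \<bar>\<mu> (- B)\<bar>\<close>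
  is at least \<open>2 * \<mu> B - \<mu> UNIV\<close>, whose supremum over \<open>B\<close> is the
  sum of the masses of the two Jordan parts.\<close>

lemma measure_variation_le_total_variation:
  fixes \<mu> :: "'m::topological_space set \<Rightarrow> real"
  assumes s: "signed_borel_measure \<mu>"
  shows "ereal (measure (positive_part \<mu>) UNIV + measure (positive_part (\<lambda>A. - \<mu> A)) UNIV)
    \<le> total_variation \<mu>"
proof (cases "total_variation \<mu>")
  case (real t)
  have *: "2 * \<mu> B - \<mu> UNIV \<le> t" if B: "B \<in> sets borel" for B
  proof -
    have D: "- B \<in> sets borel" using B by auto
    \<comment> \<open>The sum ranges over a set, so it has two terms only because a set differs from
      its complement.\<close>
    have ne: "B \<noteq> - B" by auto
    have "ereal (\<Sum>A\<in>{B, - B}. \<bar>\<mu> A\<bar>) \<le> total_variation \<mu>"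
      unfolding total_variation_def
      by (rule SUP_upper) (use B D in \<open>auto simp: disjoint_def\<close>)
    then have "\<bar>\<mu> B\<bar> + \<bar>\<mu> (- B)\<bar> \<le> t" using ne real by simp
    moreover have "\<mu> UNIV = \<mu> B + \<mu> (- B)"
      using signed_borel_measure_finite_Un[OF s B D] by simp
    ultimately show ?thesis by linarith
  qed
  have "measure (positive_part \<mu>) UNIV \<le> (t + \<mu> UNIV) / 2"
    by (rule measure_positive_part_le[OF s]) (use * in \<open>force simp: field_simps\<close>)+
  then show ?thesis using jordan_decomposition[OF s, of UNIV] real by simp
next
  case MInf
  have "ereal (\<Sum>A\<in>{UNIV}. \<bar>\<mu> A\<bar>) \<le> total_variation \<mu>"
      unfolding total_variation_def by (rule SUP_upper) auto
  then show ?thesis using MInf by simp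
qed simp

lemma nonneg_negative_part_zero:
  assumes s: "signed_borel_measure \<mu>" and "nonneg_on_borel \<mu>"
  shows "measure (positive_part (\<lambda>A. - \<mu> A)) UNIV = 0"
proof (rule antisym)
  show "measure (positive_part (\<lambda>A. - \<mu> A)) UNIV \<le> 0"
    by (rule measure_positive_part_le[OF signed_borel_measure_uminus[OF s]])
      (use assms in \<open>auto simp: nonneg_on_borel_def\<close>)
qed simp

section \<open>Signed measures with an integrable density\<close>

text \<open>Among the Borel subsets of \<open>A\<close>, the part where \<open>f\<close> is
  nonnegative carries the largest mass, and \<open>ennreal (f x)\<close> vanishes on the rest of
  \<open>A\<close>.\<close>

lemma positive_part_density:
  fixes \<tau> :: "'m::topological_space measure"
  assumes st: "sets \<tau> = sets borel" and f: "integrable \<tau> f"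
  shows "positive_part (density_measure \<tau> f) = density \<tau> (\<lambda>x. ennreal (f x))"
proof -
  have fm [measurable]: "f \<in> borel_measurable \<tau>" using f by auto
  have sp: "space \<tau> = UNIV" using sets_eq_imp_space_eq[OF st] by simp
  have ind: "integrable \<tau> (\<lambda>x. indicator B x * g x)"
    if "integrable \<tau> g" "B \<in> sets \<tau>" for g :: "'m \<Rightarrow> real" and B
    using integrable_mult_indicator[OF that(2,1)] by simp
  have f0: "integrable \<tau> (\<lambda>x. max 0 (f x))" using f by auto
  have key: "positive_variation (density_measure \<tau> f) A = emeasure (density \<tau> (\<lambda>x. ennreal (f x))) A"
    if A: "A \<in> sets borel" for A
  proof (rule antisym)
    show "positive_variation (density_measure \<tau> f) A \<le> emeasure (density \<tau> (\<lambda>x. ennreal (f x))) A"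
      unfolding positive_variation_def
    proof (rule SUP_least)
      fix B assume "B \<in> {B \<in> sets borel. B \<subseteq> A}"
      then have B: "B \<in> sets \<tau>" "B \<subseteq> A" using st by auto
      have "ennreal (density_measure \<tau> f B) \<le> ennreal (\<integral>x. indicator B x * max 0 (f x) \<partial>\<tau>)"
        unfolding density_measure_def set_lebesgue_integral_def
        using ind[OF f B(1)] ind[OF f0 B(1)]
        by (intro ennreal_leI integral_mono) (auto simp: indicator_def)
      also have "\<dots> = (\<integral>\<^sup>+x. ennreal (indicator B x * max 0 (f x)) \<partial>\<tau>)"
        by (rule nn_integral_eq_integral[symmetric, OF ind[OF f0 B(1)]]) auto
      also have "\<dots> \<le> (\<integral>\<^sup>+x. ennreal (f x) * indicator A x \<partial>\<tau>)"
        by (rule nn_integral_mono) (use B in \<open>auto simp: indicator_def max_def ennreal_neg\<close>)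
      also have "\<dots> = emeasure (density \<tau> (\<lambda>x. ennreal (f x))) A"
        by (rule emeasure_density[symmetric]) (use A st in auto)
      finally show "ennreal (density_measure \<tau> f B) \<le> emeasure (density \<tau> (\<lambda>x. ennreal (f x))) A" .
    qed
  next
    define B where "B = A \<inter> {x. 0 \<le> f x}"
    have "{x\<in>space \<tau>. 0 \<le> f x} \<in> sets \<tau>" by measurable
    then have B: "B \<in> sets \<tau>" using A st sp by (auto simp: B_def)
    have "emeasure (density \<tau> (\<lambda>x. ennreal (f x))) A = (\<integral>\<^sup>+x. ennreal (f x) * indicator A x \<partial>\<tau>)"
      by (rule emeasure_density) (use A st in auto)
    also have "\<dots> = (\<integral>\<^sup>+x. ennreal (indicator B x * f x) \<partial>\<tau>)"
      by (rule nn_integral_cong) (auto simp: B_def indicator_def ennreal_neg)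
    also have "\<dots> = ennreal (\<integral>x. indicator B x * f x \<partial>\<tau>)"
      by (rule nn_integral_eq_integral[OF ind[OF f B]]) (auto simp: B_def indicator_def)
    also have "\<dots> = ennreal (density_measure \<tau> f B)"
      unfolding density_measure_def set_lebesgue_integral_def by simp
    also have "\<dots> \<le> positive_variation (density_measure \<tau> f) A"
      by (rule positive_variation_ge) (use B st in \<open>auto simp: B_def\<close>)
    finally show "emeasure (density \<tau> (\<lambda>x. ennreal (f x))) A \<le> positive_variation (density_measure \<tau> f) A" .
  qed
  have "positive_part (density_measure \<tau> f) = measure_of UNIV (sets borel) (positive_variation (density_measure \<tau> f))"
    unfolding positive_part_def positive_variation_def by simp
  also have "\<dots> = measure_of UNIV (sets borel) (emeasure (density \<tau> (\<lambda>x. ennreal (f x))))"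
    by (rule measure_of_eq) (auto simp: key sets.sigma_sets_eq[of borel, simplified])
  also have "\<dots> = density \<tau> (\<lambda>x. ennreal (f x))"
    using measure_of_of_measure[of "density \<tau> (\<lambda>x. ennreal (f x))"] st sp by simp
  finally show ?thesis .
qed

lemma signed_integral_density:
  fixes \<tau> :: "'m::topological_space measure" and \<phi> :: "'m \<Rightarrow> real"
  assumes st: "sets \<tau> = sets borel" and f: "integrable \<tau> f"
    and \<phi>: "\<phi> \<in> borel_measurable borel" "\<And>x. \<bar>\<phi> x\<bar> \<le> b"
  shows "signed_integral (density_measure \<tau> f) \<phi> = (\<integral>x. f x * \<phi> x \<partial>\<tau>)"
proof -
  have \<phi>m [measurable]: "\<phi> \<in> borel_measurable \<tau>"
    using \<phi>(1) measurable_cong_sets[OF st refl] by blast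
  have d: "integral\<^sup>L (density \<tau> (\<lambda>x. ennreal (g x))) \<phi> = (\<integral>x. max 0 (g x) * \<phi> x \<partial>\<tau>)"
    if g: "integrable \<tau> g" for g :: "'m \<Rightarrow> real"
  proof -
    have [measurable]: "g \<in> borel_measurable \<tau>" using g by auto
    \<comment> \<open>\<open>integral_density\<close> works with a nonnegative real density, so the
      truncation hidden in \<open>ennreal\<close> is written out.\<close>
    have "density \<tau> (\<lambda>x. ennreal (g x)) = density \<tau> (\<lambda>x. ennreal (max 0 (g x)))"
      by (rule arg_cong2[where f=density]) (auto simp: max_def ennreal_neg fun_eq_iff)
    then show ?thesis by (simp add: integral_density)
  qed
  have i: "integrable \<tau> (\<lambda>x. max 0 (g x) * \<phi> x)" if g: "integrable \<tau> g" for g :: "'m \<Rightarrow> real"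
  proof (rule Bochner_Integration.integrable_bound[where f="\<lambda>x. b * g x"])
    show "integrable \<tau> (\<lambda>x. b * g x)" using g by simp
    show "(\<lambda>x. max 0 (g x) * \<phi> x) \<in> borel_measurable \<tau>"
      using borel_measurable_integrable[OF g] by measurable
    have "max 0 (g x) * \<bar>\<phi> x\<bar> \<le> \<bar>g x\<bar> * \<bar>b\<bar>" for x
      using \<phi>(2)[of x] by (intro mult_mono) auto
    then show "AE x in \<tau>. norm (max 0 (g x) * \<phi> x) \<le> norm (b * g x)"
      by (auto simp: abs_mult mult.commute)
  qed
  have "(\<lambda>A. - density_measure \<tau> f A) = density_measure \<tau> (\<lambda>x. - f x)"
    by (auto simp: fun_eq_iff density_measure_def set_lebesgue_integral_def)
  then have "signed_integral (density_measure \<tau> f) \<phi>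
    = (\<integral>x. max 0 (f x) * \<phi> x \<partial>\<tau>) - (\<integral>x. max 0 (- f x) * \<phi> x \<partial>\<tau>)"
    unfolding signed_integral_def using f
    by (simp add: positive_part_density[OF st] d)
  also have "\<dots> = (\<integral>x. max 0 (f x) * \<phi> x - max 0 (- f x) * \<phi> x \<partial>\<tau>)"
    using f by (intro Bochner_Integration.integral_diff[symmetric] i) auto
  also have "\<dots> = (\<integral>x. f x * \<phi> x \<partial>\<tau>)"
    by (rule Bochner_Integration.integral_cong) (auto simp: max_def)
  finally show ?thesis .
qed

text \<open>Both parts are densities by \<open>positive_part_density\<close>, so finiteness comes
  straight from the integrability of \<open>f\<close>, without passing through
  \<open>signed_borel_measure\<close>.\<close>

lemma finite_measure_positive_part_density:
  fixes \<tau> :: "'m::topological_space measure"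
  assumes st: "sets \<tau> = sets borel" and f: "integrable \<tau> f"
  shows "finite_measure (positive_part (density_measure \<tau> f))"
    "finite_measure (positive_part (\<lambda>A. - density_measure \<tau> f A))"
proof -
  have d: "finite_measure (density \<tau> (\<lambda>x. ennreal (g x)))"
    if g: "integrable \<tau> g" for g :: "'m \<Rightarrow> real"
  proof (rule finite_measureI)
    have [measurable]: "g \<in> borel_measurable \<tau>" using g by auto
    have "(\<integral>\<^sup>+x. ennreal (g x) * indicator (space \<tau>) x \<partial>\<tau>) = (\<integral>\<^sup>+x. ennreal (g x) \<partial>\<tau>)"
      by (rule nn_integral_cong) auto
    also have "\<dots> < \<infinity>"
      using integrableD(2)[OF g] order.strict_trans1[OF nn_integral_mono[of \<tau> "\<lambda>x. ennreal (g x)" "\<lambda>x. ennreal (norm (g x))"]]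
      by (auto intro: ennreal_leI simp: less_top)
    finally show "emeasure (density \<tau> (\<lambda>x. ennreal (g x))) (space (density \<tau> (\<lambda>x. ennreal (g x)))) \<noteq> \<infinity>"
      by (subst emeasure_density) auto
  qed
  have "(\<lambda>A. - density_measure \<tau> f A) = density_measure \<tau> (\<lambda>x. - f x)"
    by (auto simp: fun_eq_iff density_measure_def set_lebesgue_integral_def)
  then show "finite_measure (positive_part (density_measure \<tau> f))"
    "finite_measure (positive_part (\<lambda>A. - density_measure \<tau> f A))"
    using f by (auto simp: positive_part_density[OF st] intro!: d)
qed

section \<open>Hilbert-valued integrals\<close>

text \<open>The representing vector minimises \<open>u \<bullet> u - 2 * l u\<close>.\<close>

lemma riesz_representation:
  fixes l :: "'h::{real_inner,complete_space} \<Rightarrow> real"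
  assumes l: "bounded_linear l"
  shows "\<exists>v. \<forall>u. v \<bullet> u = l u"
proof -
  interpret l: bounded_linear l by fact
  obtain K where K: "\<And>u. norm (l u) \<le> norm u * K" using l.bounded by blast
  define J where "J u = u \<bullet> u - 2 * l u" for u
  have lower: "- K\<^sup>2 \<le> J u" for u
  proof -
    have "l u \<le> norm u * K" using K[of u] by simp
    moreover have "0 \<le> (norm u - K)\<^sup>2" by simp
    ultimately show ?thesis
      unfolding J_def power2_diff power2_norm_eq_inner by (simp add: algebra_simps)
  qed
  then have bdd: "bdd_below (range J)" unfolding bdd_below_def by blast
  define m where "m = Inf (range J)"
  have m: "m \<le> J u" for u unfolding m_def by (rule cInf_lower[OF _ bdd]) simp
  have "\<exists>u. J u < m + 1 / (real n + 1)" for n :: nat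
  proof -
    have "Inf (range J) < m + 1 / (real n + 1)" unfolding m_def by simp
    then show ?thesis by (subst (asm) cInf_less_iff[OF _ bdd]) auto
  qed
  then obtain X where X: "\<And>n::nat. J (X n) < m + 1 / (real n + 1)" by metis
  \<comment> \<open>Parallelogram identity: the linear functional cancels, so two near-minimisers
    are as close as their excesses over the infimum allow.\<close>
  have par: "(norm (a - b))\<^sup>2 = 2 * J a + 2 * J b - 4 * J ((1/2) *\<^sub>R (a + b))" for a b
    unfolding J_def power2_norm_eq_inner
    by (simp add: l.scaleR l.add inner_simps inner_commute algebra_simps)
  have dist: "(norm (X i - X j))\<^sup>2 < 2 / (real i + 1) + 2 / (real j + 1)" for i j
    using par[of "X i" "X j"] X[of i] X[of j] m[of "(1/2) *\<^sub>R (X i + X j)"] by simp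
  have "Cauchy X"
  proof (rule CauchyI)
    fix e :: real assume e: "0 < e"
    obtain N :: nat where N: "4 / e\<^sup>2 < real N" using reals_Archimedean2 by blast
    have "norm (X i - X j) < e" if "N \<le> i" "N \<le> j" for i j
    proof -
      have b: "2 / (real k + 1) \<le> e\<^sup>2 / 2" if "N \<le> k" for k
      proof -
        have "4 / e\<^sup>2 < real k + 1" using N that by simp
        then show ?thesis using e by (simp add: field_simps)
      qed
      have "(norm (X i - X j))\<^sup>2 < e\<^sup>2" using dist[of i j] b[OF that(1)] b[OF that(2)] by simp
      then show ?thesis by (rule power2_less_imp_less) (use e in simp)
    qed
    then show "\<exists>N. \<forall>i\<ge>N. \<forall>j\<ge>N. norm (X i - X j) < e" by blast
  qed
  then obtain v where v: "X \<longlonglongrightarrow> v" using Cauchy_convergent_iff convergent_def by blast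
  have "(\<lambda>n. J (X n)) \<longlonglongrightarrow> J v"
    unfolding J_def by (intro tendsto_intros v l.tendsto)
  moreover have "(\<lambda>n. m + 1 / (real n + 1)) \<longlonglongrightarrow> m + 0"
    by (intro tendsto_add tendsto_const) (use LIMSEQ_inverse_real_of_nat in \<open>simp add: field_simps\<close>)
  ultimately have Jv: "J v \<le> m"
    using X by (intro LIMSEQ_le[of "\<lambda>n. J (X n)" "J v" "\<lambda>n. m + 1 / (real n + 1)"])
      (auto intro: less_imp_le)
  have "v \<bullet> u = l u" for u
  proof -
    define c where "c = v \<bullet> u - l u"
    \<comment> \<open>The step \<open>- c / q\<close> minimises the quadratic expansion except for
      the added 1, which keeps it defined for \<open>u = 0\<close>. With this step \<open>J\<close>
      would fall below its minimum unless \<open>c = 0\<close>.\<close>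
    define q where "q = u \<bullet> u + 1"
    have q: "q > 0" unfolding q_def by (simp add: add_nonneg_pos)
    have expand: "J (v + t *\<^sub>R u) - J v = 2 * t * c + t\<^sup>2 * (q - 1)" for t
      unfolding J_def c_def q_def power2_eq_square
      by (simp add: l.add l.scaleR inner_simps inner_commute algebra_simps)
    have "0 \<le> J (v + (- c / q) *\<^sub>R u) - J v"
      using m[of "v + (- c / q) *\<^sub>R u"] Jv by simp
    also have "\<dots> = 2 * (- c / q) * c + (- c / q)\<^sup>2 * (q - 1)" by (rule expand)
    also have "\<dots> = - (c\<^sup>2) / q - (c / q)\<^sup>2"
      using q by (simp add: field_simps power2_eq_square)
    finally have "(c / q)\<^sup>2 + c\<^sup>2 / q \<le> 0" by simp
    then have "(c / q)\<^sup>2 \<le> 0" using q by (smt (verit) divide_nonneg_pos zero_le_power2)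
    then show ?thesis using q by (simp add: c_def)
  qed
  then show ?thesis by blast
qed

lemma finite_measure_positive_part_integrable:
  fixes \<phi> :: "'m::topological_space \<Rightarrow> real"
  assumes "finite_measure (positive_part \<mu>)" "\<phi> \<in> borel_measurable borel" "\<And>\<theta>. \<bar>\<phi> \<theta>\<bar> \<le> b"
  shows "integrable (positive_part \<mu>) \<phi>"
  by (rule finite_measure.integrable_const_bound[OF assms(1), of _ b]) (use assms in auto)

text \<open>A definite description says nothing until existence and uniqueness are known. Finite
  Jordan parts and a bounded \<Phi> make the tested integral a bounded linear functional of
  \<open>u\<close>, which has a representing vector; assuming finiteness of the parts covers general
  signed measures and densities alike.\<close>

lemma hilbert_integral_inner:
  fixes \<Phi> :: "'m::topological_space \<Rightarrow> 'h::{real_inner,complete_space}"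
  assumes fin: "finite_measure (positive_part \<mu>)" "finite_measure (positive_part (\<lambda>A. - \<mu> A))"
    and cont: "continuous_on UNIV \<Phi>" and b: "\<And>\<theta>. norm (\<Phi> \<theta>) \<le> b"
  shows "hilbert_integral \<mu> \<Phi> \<bullet> u = signed_integral \<mu> (\<lambda>\<theta>. \<Phi> \<theta> \<bullet> u)"
proof -
  have bd: "\<bar>\<Phi> \<theta> \<bullet> u\<bar> \<le> b * norm u" for \<theta> u
    using Cauchy_Schwarz_ineq2[of "\<Phi> \<theta>" u] mult_right_mono[OF b norm_ge_zero] by (rule order_trans)
  have meas: "(\<lambda>\<theta>. \<Phi> \<theta> \<bullet> u) \<in> borel_measurable borel" for u
    by (intro borel_measurable_continuous_onI continuous_intros cont)
  let ?P = "positive_part \<mu>" and ?N = "positive_part (\<lambda>A. - \<mu> A)"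
  have int: "integrable ?P (\<lambda>\<theta>. \<Phi> \<theta> \<bullet> u)" "integrable ?N (\<lambda>\<theta>. \<Phi> \<theta> \<bullet> u)" for u
    using finite_measure_positive_part_integrable[OF _ meas bd] fin by blast+
  have "bounded_linear (\<lambda>u. signed_integral \<mu> (\<lambda>\<theta>. \<Phi> \<theta> \<bullet> u))"
  proof (rule bounded_linear_intro)
    fix u v :: 'h and r :: real
    show "signed_integral \<mu> (\<lambda>\<theta>. \<Phi> \<theta> \<bullet> (u + v)) =
      signed_integral \<mu> (\<lambda>\<theta>. \<Phi> \<theta> \<bullet> u) + signed_integral \<mu> (\<lambda>\<theta>. \<Phi> \<theta> \<bullet> v)"
      unfolding signed_integral_def inner_add_right by (simp add: int)
    show "signed_integral \<mu> (\<lambda>\<theta>. \<Phi> \<theta> \<bullet> (r *\<^sub>R u)) = r *\<^sub>R signed_integral \<mu> (\<lambda>\<theta>. \<Phi> \<theta> \<bullet> u)"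
      unfolding signed_integral_def inner_scaleR_right by (simp add: algebra_simps)
    have ineq: "\<bar>integral\<^sup>L M (\<lambda>\<theta>. \<Phi> \<theta> \<bullet> u)\<bar> \<le> b * norm u * measure M (space M)"
      if "finite_measure M" "integrable M (\<lambda>\<theta>. \<Phi> \<theta> \<bullet> u)" for M
    proof -
      interpret finite_measure M by fact
      have "\<bar>integral\<^sup>L M (\<lambda>\<theta>. \<Phi> \<theta> \<bullet> u)\<bar> \<le> (\<integral>\<theta>. \<bar>\<Phi> \<theta> \<bullet> u\<bar> \<partial>M)"
        using integral_abs_bound by blast
      also have "\<dots> \<le> (\<integral>\<theta>. b * norm u \<partial>M)"
        by (rule integral_mono) (use that bd in auto)
      finally show ?thesis by (simp add: mult_ac)
    qed
    show "norm (signed_integral \<mu> (\<lambda>\<theta>. \<Phi> \<theta> \<bullet> u))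
      \<le> norm u * (b * (measure ?P UNIV + measure ?N UNIV))"
      using ineq[OF fin(1) int(1)] ineq[OF fin(2) int(2)]
      unfolding signed_integral_def by (simp add: algebra_simps abs_le_iff)
  qed
  from riesz_representation[OF this] obtain v
    where v: "\<forall>u. v \<bullet> u = signed_integral \<mu> (\<lambda>\<theta>. \<Phi> \<theta> \<bullet> u)" by blast
  have "hilbert_integral \<mu> \<Phi> = v"
    unfolding hilbert_integral_def
  proof (rule the_equality[where P="\<lambda>v. \<forall>u. v \<bullet> u = signed_integral \<mu> (\<lambda>\<theta>. \<Phi> \<theta> \<bullet> u)", OF v])
    fix w assume "\<forall>u. w \<bullet> u = signed_integral \<mu> (\<lambda>\<theta>. \<Phi> \<theta> \<bullet> u)"
    then have "(w - v) \<bullet> (w - v) = 0" using v by (metis diff_self inner_diff_left)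
    then show "w = v" by simp
  qed
  then show ?thesis using v by simp
qed

section \<open>The entropy\<close>

abbreviation rval :: "(real \<Rightarrow> ereal) \<Rightarrow> real \<Rightarrow> real" where
  "rval \<eta> x \<equiv> real_of_ereal (\<eta> x)"

lemma eta_nonneg: "assumption_A2 \<eta> \<Longrightarrow> 0 \<le> \<eta> x"
  by (simp add: assumption_A2_def)

lemma rval_nonneg: "assumption_A2 \<eta> \<Longrightarrow> 0 \<le> rval \<eta> x"
  by (simp add: eta_nonneg real_of_ereal_pos)

lemma eta_eq_rval: "assumption_A2 \<eta> \<Longrightarrow> x \<in> edom \<eta> \<Longrightarrow> \<eta> x = ereal (rval \<eta> x)"
  using eta_nonneg[of \<eta> x] by (cases "\<eta> x") (auto simp: edom_def)

lemma edom_cases: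
  assumes "assumption_A2 \<eta>"
  obtains "assumption_A2_plus \<eta>" "edom \<eta> = {0..}" "interior (edom \<eta>) = {0<..}"
  | "assumption_A2_pm \<eta>" "edom \<eta> = UNIV" "interior (edom \<eta>) = UNIV"
  using assms unfolding assumption_A2_def assumption_A2_plus_def assumption_A2_pm_def by auto

lemma nonneg_in_edom: "assumption_A2 \<eta> \<Longrightarrow> 0 \<le> x \<Longrightarrow> x \<in> edom \<eta>"
  by (erule edom_cases) auto

lemma convex_edom: "assumption_A2 \<eta> \<Longrightarrow> convex (edom \<eta>)"
  by (erule edom_cases) auto

lemma rval_convex:
  assumes A2: "assumption_A2 \<eta>"
  shows "convex_on (edom \<eta>) (rval \<eta>)"
proof (rule convex_onI[OF _ convex_edom[OF A2]])
  fix t x y :: real assume *: "0 < t" "t < 1" "x \<in> edom \<eta>" "y \<in> edom \<eta>"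
  have z: "(1 - t) * x + t * y \<in> edom \<eta>"
    using convexD[OF convex_edom[OF A2] *(3,4), of "1 - t" t] * by simp
  show "rval \<eta> ((1 - t) *\<^sub>R x + t *\<^sub>R y) \<le> (1 - t) * rval \<eta> x + t * rval \<eta> y"
  proof (cases "x = y")
    case False
    then have "\<eta> ((1 - t) * x + t * y) < ereal (1 - t) * \<eta> x + ereal t * \<eta> y"
      using A2 * unfolding assumption_A2_def by auto
    then show ?thesis
      using eta_eq_rval[OF A2 z] eta_eq_rval[OF A2 *(3)] eta_eq_rval[OF A2 *(4)]
      by (metis (no_types) ereal_less_eq(3) less_imp_le plus_ereal.simps(1) real_scaleR_def times_ereal.simps(1))
  qed (simp add: algebra_simps)
qed

lemma rval_above_tangent:
  assumes A2: "assumption_A2 \<eta>" and b: "b \<in> interior (edom \<eta>)" and x: "x \<in> edom \<eta>"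
  shows "rval \<eta> b + ederiv \<eta> b * (x - b) \<le> rval \<eta> x"
proof -
  have "rval \<eta> differentiable (at b)" using A2 b unfolding assumption_A2_def by blast
  then have "(rval \<eta> has_field_derivative ederiv \<eta> b) (at b)"
    unfolding ederiv_def using DERIV_deriv_iff_real_differentiable by blast
  then have "(rval \<eta> has_field_derivative ederiv \<eta> b) (at b within edom \<eta>)"
    by (rule has_field_derivative_at_within)
  then have "ederiv \<eta> b * (x - b) \<le> rval \<eta> x - rval \<eta> b"
    by (rule convex_on_imp_above_tangent[OF rval_convex[OF A2] convex_connected[OF convex_edom[OF A2]] b x])
  then show ?thesis by simp
qed

lemma ederiv_surj:
  assumes "assumption_A2 \<eta>"
  obtains x where "x \<in> interior (edom \<eta>)" "ederiv \<eta> x = c"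
  using assms unfolding assumption_A2_def by (metis (no_types, lifting) UNIV_I imageE)

text \<open>The two tangent inequalities, at \<open>x\<close> evaluated in \<open>y\<close> and at
  \<open>y\<close> evaluated in \<open>x\<close>, are added.\<close>

lemma ederiv_mono:
  assumes A2: "assumption_A2 \<eta>" and xy: "x \<in> interior (edom \<eta>)" "y \<in> interior (edom \<eta>)"
    and lt: "ederiv \<eta> x < ederiv \<eta> y"
  shows "x \<le> y"
proof (rule ccontr)
  assume "\<not> x \<le> y"
  then have "0 < x - y" by simp
  have "rval \<eta> x + ederiv \<eta> x * (y - x) \<le> rval \<eta> y" "rval \<eta> y + ederiv \<eta> y * (x - y) \<le> rval \<eta> x"
    using rval_above_tangent[OF A2] xy interior_subset by blast+
  then have "(ederiv \<eta> y - ederiv \<eta> x) * (x - y) \<le> 0" by (simp add: algebra_simps)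
  then show False using lt \<open>0 < x - y\<close> by (simp add: mult_le_0_iff)
qed

text \<open>Surjectivity of the derivative provides points of slope \<open>- B - 1\<close> and
  \<open>B + 1\<close>, which trap every point of slope at most \<open>B\<close> in absolute value.
  This turns the bound on the derivative along \<open>f0\<close> into a bound on \<open>f0\<close>
  itself.\<close>

lemma ederiv_bounded_imp_bounded:
  assumes A2: "assumption_A2 \<eta>"
  shows "\<exists>M\<ge>0. \<forall>x\<in>interior (edom \<eta>). \<bar>ederiv \<eta> x\<bar> \<le> B \<longrightarrow> \<bar>x\<bar> \<le> M"
proof -
  obtain a where a: "a \<in> interior (edom \<eta>)" "ederiv \<eta> a = - B - 1" using ederiv_surj[OF A2] .
  obtain b where b: "b \<in> interior (edom \<eta>)" "ederiv \<eta> b = B + 1" using ederiv_surj[OF A2] .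
  have "a \<le> x \<and> x \<le> b" if "x \<in> interior (edom \<eta>)" "\<bar>ederiv \<eta> x\<bar> \<le> B" for x
    using ederiv_mono[OF A2 a(1) that(1)] ederiv_mono[OF A2 that(1) b(1)] a(2) b(2) that(2) by auto
  then show ?thesis by (intro exI[of _ "max \<bar>a\<bar> \<bar>b\<bar>"]) force
qed

text \<open>The term \<open>- \<eta> b\<close> is at most 0, and the linear term is at most
  \<open>B * (\<bar>a\<bar> + M)\<close>. As the bound does not depend on \<open>b\<close>, the
  divergence from \<open>f0\<close> reduces to the entropy and the L1 norm of the
  competitor.\<close>

lemma D_eta_le:
  assumes A2: "assumption_A2 \<eta>" and B: "0 \<le> B"
  shows "\<exists>C\<ge>0. \<forall>a\<in>edom \<eta>. \<forall>b\<in>interior (edom \<eta>). \<bar>ederiv \<eta> b\<bar> \<le> B \<longrightarrow>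
    D_eta \<eta> a b \<le> ereal (rval \<eta> a + B * \<bar>a\<bar> + C)"
proof -
  obtain M where M: "0 \<le> M" "\<And>x. x \<in> interior (edom \<eta>) \<Longrightarrow> \<bar>ederiv \<eta> x\<bar> \<le> B \<Longrightarrow> \<bar>x\<bar> \<le> M"
    using ederiv_bounded_imp_bounded[OF A2, of B] by blast
  have "D_eta \<eta> a b \<le> ereal (rval \<eta> a + B * \<bar>a\<bar> + B * M)"
    if a: "a \<in> edom \<eta>" and b: "b \<in> interior (edom \<eta>)" and bb: "\<bar>ederiv \<eta> b\<bar> \<le> B" for a b
  proof -
    have "- (ederiv \<eta> b * (a - b)) \<le> \<bar>ederiv \<eta> b\<bar> * \<bar>a - b\<bar>"
      by (metis abs_ge_minus_self abs_mult)
    also have "\<dots> \<le> B * (\<bar>a\<bar> + M)" using bb M(2)[OF b bb] B by (intro mult_mono) auto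
    finally have "rval \<eta> a - rval \<eta> b - ederiv \<eta> b * (a - b) \<le> rval \<eta> a + B * \<bar>a\<bar> + B * M"
      using rval_nonneg[OF A2, of b] by (simp add: algebra_simps)
    moreover have "D_eta \<eta> a b = ereal (ra - rb - ederiv \<eta> b * (a - b))"
      if "\<eta> a = ereal ra" "\<eta> b = ereal rb" for ra rb
      using that by (simp add: D_eta_def)
    moreover have "b \<in> edom \<eta>" using b interior_subset by blast
    ultimately show ?thesis
      using eta_eq_rval[OF A2 a] eta_eq_rval[OF A2, of b] by (metis (no_types) ereal_less_eq(3))
  qed
  then show ?thesis using B M(1) by (intro exI[of _ "B * M"]) auto
qed

lemma rval_le_chord:
  assumes A2: "assumption_A2 \<eta>" and S: "0 < S" "\<bar>s\<bar> \<le> S" and s: "s \<in> edom \<eta>"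
  shows "rval \<eta> s \<le> rval \<eta> 0 + \<bar>s\<bar> / S * rval \<eta> S"
proof -
  \<comment> \<open>Either the domain is the half-line and \<open>s\<close> is nonnegative, or
    \<eta> is even.\<close>
  have abs: "rval \<eta> s = rval \<eta> \<bar>s\<bar>"
    using A2 s by (cases rule: edom_cases) (auto simp: assumption_A2_pm_def abs_if)
  define t where "t = \<bar>s\<bar> / S"
  have t: "0 \<le> t" "t \<le> 1" "\<bar>s\<bar> = (1 - t) *\<^sub>R 0 + t *\<^sub>R S" using S by (auto simp: t_def)
  have "rval \<eta> \<bar>s\<bar> \<le> (1 - t) * rval \<eta> 0 + t * rval \<eta> S"
    unfolding t(3) using convex_onD[OF rval_convex[OF A2] t(1,2)] nonneg_in_edom[OF A2] S by force
  also have "\<dots> \<le> rval \<eta> 0 + t * rval \<eta> S"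
    using t rval_nonneg[OF A2, of 0] by (simp add: mult_left_le_one_le)
  finally show ?thesis by (simp add: abs t_def)
qed

text \<open>The tangent of slope 1 at \<open>b\<close> gives
  \<open>x - b \<le> rval \<eta> x\<close>, and \<open>x - b \<ge> x / 2\<close> once
  \<open>x \<ge> 2 * b\<close>. This explicit linear bound keeps
  \<open>\<epsilon> ^ d * rval \<eta> (1 / \<epsilon> ^ d)\<close> above \<open>1 / 2\<close>, so
  additive constants can be charged to it.\<close>

lemma rval_superlinear:
  assumes A2: "assumption_A2 \<eta>"
  shows "\<exists>X>0. \<forall>x\<ge>X. x / 2 \<le> rval \<eta> x"
proof -
  obtain b where b: "b \<in> interior (edom \<eta>)" "ederiv \<eta> b = 1" using ederiv_surj[OF A2] .
  have "x / 2 \<le> rval \<eta> x" if "x \<ge> max 1 (2 * b)" for x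
    using rval_above_tangent[OF A2 b(1) nonneg_in_edom[OF A2], of x] b(2) that
      rval_nonneg[OF A2, of b] by simp
  then show ?thesis by (intro exI[of _ "max 1 (2 * b)"]) auto
qed

lemma rval_doubling:
  assumes A2: "assumption_A2 \<eta>" and c: "0 < c"
  shows "\<exists>K>0. \<exists>X>0. \<forall>x\<ge>X. rval \<eta> (c * x) \<le> K * rval \<eta> x"
proof -
  obtain K where K: "0 < K" "\<forall>\<^sub>F x in at_top. \<eta> (c * x) \<le> ereal K * \<eta> x"
    using A2 c unfolding assumption_A2_def by (blast intro: eventually_mono)
  from K(2) obtain X where X: "\<And>x. x \<ge> X \<Longrightarrow> \<eta> (c * x) \<le> ereal K * \<eta> x"
    unfolding eventually_at_top_linorder by blast
  have "rval \<eta> (c * x) \<le> K * rval \<eta> x" if "x \<ge> max 1 X" for x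
  proof -
    have "c * x \<in> edom \<eta>" "x \<in> edom \<eta>" using nonneg_in_edom[OF A2] c that by auto
    then have "\<eta> (c * x) = ereal (rval \<eta> (c * x))" "\<eta> x = ereal (rval \<eta> x)"
      using eta_eq_rval[OF A2] by blast+
    moreover have "u \<le> K * v" if "\<eta> (c * x) = ereal u" "\<eta> x = ereal v" for u v
      using X[of x] \<open>x \<ge> max 1 X\<close> that by simp
    ultimately show ?thesis by blast
  qed
  then show ?thesis using K(1) by (intro exI[of _ K] conjI exI[of _ "max 1 X"]) auto
qed

text \<open>\<open>C\<close> and \<open>r\<close> are chosen before \<epsilon> and \<open>f\<close>,
  since the smoothed density changes with \<epsilon>. The height enters through the chord slope and
  the mass \<open>m\<close> through the integral of \<open>\<bar>f\<bar>\<close>; using the height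
  for both would lose a factor \<open>\<epsilon> ^ d\<close>.\<close>

lemma D_bar_le:
  fixes \<tau> :: "'m measure" and f0 :: "'m \<Rightarrow> real"
  assumes A2: "assumption_A2 \<eta>" and prob: "emeasure \<tau> (space \<tau>) = 1"
    and dom: "AE \<theta> in \<tau>. f0 \<theta> \<in> interior (edom \<eta>)"
    and bd: "\<exists>B. AE \<theta> in \<tau>. \<bar>ederiv \<eta> (f0 \<theta>)\<bar> \<le> B"
    and d: "0 < (d::nat)" and K: "0 < K" and m: "0 \<le> m"
  shows "\<exists>C>0. \<exists>r>0. \<forall>\<epsilon>\<in>{0<..<r}. \<forall>f. integrable \<tau> f \<longrightarrow> (\<forall>\<theta>. \<bar>f \<theta>\<bar> \<le> K / \<epsilon> ^ d) \<longrightarrow>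
    (\<integral>\<theta>. \<bar>f \<theta>\<bar> \<partial>\<tau>) \<le> m \<longrightarrow> (assumption_A2_plus \<eta> \<longrightarrow> (\<forall>\<theta>. 0 \<le> f \<theta>)) \<longrightarrow>
    D_bar \<eta> \<tau> f f0 \<le> ereal (C * (\<epsilon> ^ d * rval \<eta> (1 / \<epsilon> ^ d)))"
proof -
  interpret finite_measure \<tau> by (rule finite_measureI) (simp add: prob)
  have prob1: "measure \<tau> (space \<tau>) = 1" using prob by (simp add: measure_def)
  obtain B' where "AE \<theta> in \<tau>. \<bar>ederiv \<eta> (f0 \<theta>)\<bar> \<le> B'" using bd by blast
  then have B: "AE \<theta> in \<tau>. \<bar>ederiv \<eta> (f0 \<theta>)\<bar> \<le> max B' 0" by (auto elim: eventually_mono)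
  define B where "B = max B' 0"
  have B0: "0 \<le> B" by (simp add: B_def)
  obtain C0 where C0: "0 \<le> C0" "\<And>a b. a \<in> edom \<eta> \<Longrightarrow> b \<in> interior (edom \<eta>) \<Longrightarrow> \<bar>ederiv \<eta> b\<bar> \<le> B \<Longrightarrow>
    D_eta \<eta> a b \<le> ereal (rval \<eta> a + B * \<bar>a\<bar> + C0)"
    using D_eta_le[OF A2 B0] by blast
  obtain X where X: "0 < X" "\<And>x. x \<ge> X \<Longrightarrow> x / 2 \<le> rval \<eta> x" using rval_superlinear[OF A2] by blast
  obtain K' Y where Y: "0 < K'" "0 < Y" "\<And>x. x \<ge> Y \<Longrightarrow> rval \<eta> (K * x) \<le> K' * rval \<eta> x"
    using rval_doubling[OF A2 K] by blast
  \<comment> \<open>For \<open>\<epsilon> < 1 / Z\<close> one has \<open>\<epsilon> \<le> 1\<close>,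
    hence \<open>1 / \<epsilon> ^ d \<ge> Z\<close>, and both thresholds \<open>X\<close> and
    \<open>Y\<close> are passed.\<close>
  define Z where "Z = max 1 (max X Y)"
  define c1 where "c1 = rval \<eta> 0 + C0 + B * m"
  have c1: "0 \<le> c1" using rval_nonneg[OF A2, of 0] C0(1) B0 m by (simp add: c1_def)
  \<comment> \<open>\<open>2 * c1\<close> absorbs the additive constants through
    \<open>1 / 2 \<le> E\<close>; \<open>m * K' / K\<close> is the mass times the bound on the chord
    slope \<open>Q\<close> relative to \<open>E\<close>; the 1 makes \<open>C\<close>
    positive.\<close>
  define C where "C = 2 * c1 + m * K' / K + 1"
  have "0 \<le> m * K' / K" using m K Y by simp
  then have C: "0 < C" using c1 by (simp add: C_def)
  have main: "D_bar \<eta> \<tau> f f0 \<le> ereal (C * (\<epsilon> ^ d * rval \<eta> (1 / \<epsilon> ^ d)))"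
    if \<epsilon>: "\<epsilon> \<in> {0<..<1 / Z}" and f: "integrable \<tau> f" and fb: "\<And>\<theta>. \<bar>f \<theta>\<bar> \<le> K / \<epsilon> ^ d"
      and fm: "(\<integral>\<theta>. \<bar>f \<theta>\<bar> \<partial>\<tau>) \<le> m"
      and pos: "assumption_A2_plus \<eta> \<longrightarrow> (\<forall>\<theta>. 0 \<le> f \<theta>)" for \<epsilon> f
  proof -
    have e0: "0 < \<epsilon>" "0 < \<epsilon> ^ d" using \<epsilon> by auto
    have Z: "1 \<le> Z" "X \<le> Z" "Y \<le> Z" by (auto simp: Z_def)
    have "1 / Z \<le> 1" using Z by simp
    then have "\<epsilon> \<le> 1" using \<epsilon> by auto
    then have "\<epsilon> ^ d \<le> \<epsilon>" using e0 d power_decreasing[of 1 d \<epsilon>] by simp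
    moreover have "Z \<le> 1 / \<epsilon>" using \<epsilon> Z by (simp add: field_simps)
    ultimately have ge: "Z \<le> 1 / \<epsilon> ^ d"
      by (meson divide_left_mono e0 order_trans zero_le_one mult_pos_pos)
    define E where "E = \<epsilon> ^ d * rval \<eta> (1 / \<epsilon> ^ d)"
    have E: "1 / 2 \<le> E"
    proof -
      have "\<epsilon> ^ d * ((1 / \<epsilon> ^ d) / 2) \<le> E"
        unfolding E_def using X(2)[of "1 / \<epsilon> ^ d"] ge Z e0 by (intro mult_left_mono) auto
      then show ?thesis using e0 by simp
    qed
    define S where "S = K / \<epsilon> ^ d"
    have S: "0 < S" using K e0 by (simp add: S_def)
    define Q where "Q = rval \<eta> S / S"
    have Q: "0 \<le> Q" using S rval_nonneg[OF A2, of S] by (simp add: Q_def)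
    have "rval \<eta> S \<le> K' * rval \<eta> (1 / \<epsilon> ^ d)"
      using Y(3)[of "1 / \<epsilon> ^ d"] ge Z by (simp add: S_def)
    then have "Q \<le> K' * rval \<eta> (1 / \<epsilon> ^ d) / S" unfolding Q_def using S by (intro divide_right_mono) auto
    also have "\<dots> = K' / K * E" using e0 K by (simp add: E_def S_def field_simps)
    finally have Q1: "Q \<le> K' / K * E" .
    have fdom: "f \<theta> \<in> edom \<eta>" for \<theta>
      using A2 pos by (cases rule: edom_cases) auto
    define g where "g \<theta> = rval \<eta> 0 + C0 + (Q + B) * \<bar>f \<theta>\<bar>" for \<theta>
    have g0: "0 \<le> g \<theta>" for \<theta>
      using rval_nonneg[OF A2, of 0] C0(1) B0 Q by (simp add: g_def)
    have gi: "integrable \<tau> g" unfolding g_def using f by auto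
    have "AE \<theta> in \<tau>. e2ennreal (D_eta \<eta> (f \<theta>) (f0 \<theta>)) \<le> ennreal (g \<theta>)"
      using dom B
    proof eventually_elim
      case (elim \<theta>)
      have "D_eta \<eta> (f \<theta>) (f0 \<theta>) \<le> ereal (rval \<eta> (f \<theta>) + B * \<bar>f \<theta>\<bar> + C0)"
        using C0(2)[OF fdom] elim unfolding B_def by blast
      also have "\<dots> \<le> ereal (g \<theta>)"
        using rval_le_chord[OF A2 S _ fdom, of \<theta>] fb[of \<theta>] unfolding g_def Q_def S_def
        by (simp add: algebra_simps)
      finally show ?case by (metis e2ennreal_mono e2ennreal_ereal)
    qed
    then have "(\<integral>\<^sup>+ \<theta>. e2ennreal (D_eta \<eta> (f \<theta>) (f0 \<theta>)) \<partial>\<tau>) \<le> (\<integral>\<^sup>+ \<theta>. ennreal (g \<theta>) \<partial>\<tau>)"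
      by (rule nn_integral_mono_AE)
    also have "\<dots> = ennreal (integral\<^sup>L \<tau> g)"
      by (rule nn_integral_eq_integral[OF gi]) (simp add: g0)
    finally have "D_bar \<eta> \<tau> f f0 \<le> enn2ereal (ennreal (integral\<^sup>L \<tau> g))"
      unfolding D_bar_def by (simp add: less_eq_ennreal.rep_eq)
    also have "\<dots> = ereal (integral\<^sup>L \<tau> g)"
      by (rule enn2ereal_ennreal) (simp add: g0 integral_nonneg)
    also have "integral\<^sup>L \<tau> g = rval \<eta> 0 + C0 + (Q + B) * (\<integral>\<theta>. \<bar>f \<theta>\<bar> \<partial>\<tau>)"
      unfolding g_def using f by (simp add: prob1)
    also have "ereal \<dots> \<le> ereal (C * E)"
    proof -
      have "(Q + B) * (\<integral>\<theta>. \<bar>f \<theta>\<bar> \<partial>\<tau>) \<le> (K' / K * E + B) * m"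
        using Q1 Q B0 m fm by (intro mult_mono) (auto intro: order_trans)
      moreover have "c1 * 1 \<le> c1 * (2 * E)" using E c1 by (intro mult_left_mono) auto
      ultimately show ?thesis using E by (simp add: C_def c1_def algebra_simps)
    qed
    finally show ?thesis unfolding E_def .
  qed
  have "0 < 1 / Z" by (simp add: Z_def)
  show ?thesis
    by (rule exI[of _ C], rule conjI[OF C], rule exI[of _ "1 / Z"], rule conjI[OF \<open>0 < 1 / Z\<close>])
      (use main in blast)
qed

section \<open>Smoothing of signed measures\<close>

text \<open>\<open>b\<close> bounds the kernel, and \<open>\<delta>\<close> the error of the smoothing of \<open>\<Phi>\<close> at the points of \<open>U\<close>.\<close>

definition smoothing_kernel :: "'m::topological_space measure \<Rightarrow> ('m \<Rightarrow> 'h::real_inner) \<Rightarrow> 'm set \<Rightarrow>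
    real \<Rightarrow> real \<Rightarrow> ('m \<Rightarrow> 'm \<Rightarrow> real) \<Rightarrow> bool" where
  "smoothing_kernel \<tau> \<Phi> U b \<delta> k \<longleftrightarrow>
     case_prod k \<in> borel_measurable (borel \<Otimes>\<^sub>M borel) \<and>
     (\<forall>\<theta> \<theta>'. 0 \<le> k \<theta> \<theta>' \<and> k \<theta> \<theta>' \<le> b) \<and>
     (\<forall>\<theta>'\<in>U. (\<integral>\<theta>. k \<theta> \<theta>' \<partial>\<tau>) = 1 \<and>
        (\<forall>u. \<bar>(\<integral>\<theta>. k \<theta> \<theta>' * (\<Phi> \<theta> \<bullet> u) \<partial>\<tau>) - \<Phi> \<theta>' \<bullet> u\<bar> \<le> \<delta> * norm u))"

text \<open>Fubini brings the \<tau>-integral inside, where for each \<theta>' the kernel has mass 1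
  and reproduces \<Phi> up to \<delta>. Integrating these two facts against \<open>M\<close> gives
  the total mass and the error.\<close>

lemma smoothing_finite_measure:
  fixes \<tau> M :: "'m::topological_space measure" and \<Phi> :: "'m \<Rightarrow> 'h::real_inner"
  assumes \<tau>: "finite_measure \<tau>" "sets \<tau> = sets borel" and M: "finite_measure M" "sets M = sets borel"
    and cont: "continuous_on UNIV \<Phi>" and bd: "\<And>\<theta>. norm (\<Phi> \<theta>) \<le> c"
    and k: "smoothing_kernel \<tau> \<Phi> UNIV b \<delta> k"
  defines "g \<equiv> \<lambda>\<theta>. \<integral>\<theta>'. k \<theta> \<theta>' \<partial>M"
  shows "integrable \<tau> g" "0 \<le> g \<theta>" "g \<theta> \<le> b * measure M UNIV"
    "(\<integral>\<theta>. g \<theta> \<partial>\<tau>) = measure M UNIV"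
    "\<bar>(\<integral>\<theta>. g \<theta> * (\<Phi> \<theta> \<bullet> u) \<partial>\<tau>) - (\<integral>\<theta>. \<Phi> \<theta> \<bullet> u \<partial>M)\<bar> \<le> \<delta> * norm u * measure M UNIV"
proof -
  interpret T: finite_measure \<tau> by fact
  interpret M: finite_measure M by fact
  interpret P: pair_sigma_finite M \<tau> ..
  interpret PF: finite_measure "M \<Otimes>\<^sub>M \<tau>"
    by (rule finite_measure_pair_measure) (fact \<tau> M)+
  have sp: "space \<tau> = UNIV" "space M = UNIV"
    using sets_eq_imp_space_eq[OF \<tau>(2)] sets_eq_imp_space_eq[OF M(2)] by simp_all
  have k0: "0 \<le> k \<theta> \<theta>'" "k \<theta> \<theta>' \<le> b" for \<theta> \<theta>' using k by (auto simp: smoothing_kernel_def)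
  have b0: "0 \<le> b" using k0[of undefined undefined] by linarith
  have km [measurable]: "case_prod k \<in> borel_measurable (\<tau> \<Otimes>\<^sub>M M)"
    using k measurable_cong_sets[OF sets_pair_measure_cong[OF \<tau>(2) M(2)] refl]
    unfolding smoothing_kernel_def by blast
  have [measurable]: "(\<lambda>\<theta>. \<Phi> \<theta> \<bullet> u) \<in> borel_measurable \<tau>" "(\<lambda>\<theta>. \<Phi> \<theta> \<bullet> u) \<in> borel_measurable M" for u
  proof -
    have "(\<lambda>\<theta>. \<Phi> \<theta> \<bullet> u) \<in> borel_measurable borel"
      by (intro borel_measurable_continuous_onI continuous_intros cont)
    then show "(\<lambda>\<theta>. \<Phi> \<theta> \<bullet> u) \<in> borel_measurable \<tau>" "(\<lambda>\<theta>. \<Phi> \<theta> \<bullet> u) \<in> borel_measurable M"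
      using measurable_cong_sets[OF \<tau>(2) refl] measurable_cong_sets[OF M(2) refl] by blast+
  qed
  have \<Phi>b: "\<bar>\<Phi> \<theta> \<bullet> u\<bar> \<le> c * norm u" for \<theta> u
    using Cauchy_Schwarz_ineq2[of "\<Phi> \<theta>" u] mult_right_mono[OF bd norm_ge_zero] by (rule order_trans)
  have gm [measurable]: "g \<in> borel_measurable \<tau>"
    unfolding g_def by measurable
  have ki: "integrable M (k \<theta>)" for \<theta>
  proof (rule M.integrable_const_bound[of _ b])
    show "k \<theta> \<in> borel_measurable M"
      using measurable_compose[OF measurable_Pair1'[of \<theta> \<tau> M] km] sp by simp
  qed (use k0 in auto)
  show g0: "0 \<le> g \<theta>" for \<theta> unfolding g_def by (simp add: k0)
  have "g \<theta> \<le> (\<integral>\<theta>'. b \<partial>M)" for \<theta>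
    unfolding g_def by (rule integral_mono) (use ki k0 in auto)
  then show gb: "g \<theta> \<le> b * measure M UNIV" for \<theta> by (simp add: sp mult.commute)
  show "integrable \<tau> g"
    by (rule T.integrable_const_bound[of _ "b * measure M UNIV"]) (use g0 gb in auto)
  \<comment> \<open>A bounded test function covers both uses: the constant 1 for the mass, and
    \<open>\<lambda>\<theta>. \<Phi> \<theta> \<bullet> u\<close> for the error.\<close>
  have fub: "(\<integral>\<theta>. g \<theta> * \<phi> \<theta> \<partial>\<tau>) = (\<integral>\<theta>'. (\<integral>\<theta>. k \<theta> \<theta>' * \<phi> \<theta> \<partial>\<tau>) \<partial>M)"
    and fubi: "integrable M (\<lambda>\<theta>'. \<integral>\<theta>. k \<theta> \<theta>' * \<phi> \<theta> \<partial>\<tau>)"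
    if [measurable]: "\<phi> \<in> borel_measurable \<tau>" and \<phi>: "\<And>\<theta>. \<bar>\<phi> \<theta>\<bar> \<le> a" for \<phi> :: "'m \<Rightarrow> real" and a
  proof -
    have a: "norm (k \<theta> \<theta>' * \<phi> \<theta>) \<le> b * a" for \<theta> \<theta>'
      unfolding real_norm_def abs_mult using k0[of \<theta> \<theta>'] \<phi>[of \<theta>] b0 by (intro mult_mono) auto
    have int: "integrable (M \<Otimes>\<^sub>M \<tau>) (\<lambda>(\<theta>', \<theta>). k \<theta> \<theta>' * \<phi> \<theta>)"
      by (rule PF.integrable_const_bound[of _ "b * a"]) (use a in auto)
    have "(\<integral>\<theta>. (\<integral>\<theta>'. k \<theta> \<theta>' * \<phi> \<theta> \<partial>M) \<partial>\<tau>) = (\<integral>\<theta>'. (\<integral>\<theta>. k \<theta> \<theta>' * \<phi> \<theta> \<partial>\<tau>) \<partial>M)"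
      by (rule P.Fubini_integral[OF int])
    then show "(\<integral>\<theta>. g \<theta> * \<phi> \<theta> \<partial>\<tau>) = (\<integral>\<theta>'. (\<integral>\<theta>. k \<theta> \<theta>' * \<phi> \<theta> \<partial>\<tau>) \<partial>M)"
      unfolding g_def by simp
    show "integrable M (\<lambda>\<theta>'. \<integral>\<theta>. k \<theta> \<theta>' * \<phi> \<theta> \<partial>\<tau>)"
      using P.integrable_fst'[OF int] by simp
  qed
  have k1: "(\<integral>\<theta>. k \<theta> \<theta>' \<partial>\<tau>) = 1" for \<theta>' using k by (auto simp: smoothing_kernel_def)
  show "(\<integral>\<theta>. g \<theta> \<partial>\<tau>) = measure M UNIV"
    using fub[of "\<lambda>_. 1" 1] by (simp add: k1 sp)
  have \<Phi>i: "integrable M (\<lambda>\<theta>. \<Phi> \<theta> \<bullet> u)"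
    by (rule M.integrable_const_bound[of _ "c * norm u"]) (use \<Phi>b in auto)
  have I: "integrable M (\<lambda>\<theta>'. \<integral>\<theta>. k \<theta> \<theta>' * (\<Phi> \<theta> \<bullet> u) \<partial>\<tau>)"
    by (rule fubi[OF _ \<Phi>b]) measurable
  have "\<bar>(\<integral>\<theta>. g \<theta> * (\<Phi> \<theta> \<bullet> u) \<partial>\<tau>) - (\<integral>\<theta>. \<Phi> \<theta> \<bullet> u \<partial>M)\<bar>
    = \<bar>\<integral>\<theta>'. (\<integral>\<theta>. k \<theta> \<theta>' * (\<Phi> \<theta> \<bullet> u) \<partial>\<tau>) - \<Phi> \<theta>' \<bullet> u \<partial>M\<bar>"
    using fub[of "\<lambda>\<theta>. \<Phi> \<theta> \<bullet> u", OF _ \<Phi>b] I \<Phi>i by simp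
  also have "\<dots> \<le> (\<integral>\<theta>'. \<bar>(\<integral>\<theta>. k \<theta> \<theta>' * (\<Phi> \<theta> \<bullet> u) \<partial>\<tau>) - \<Phi> \<theta>' \<bullet> u\<bar> \<partial>M)"
    by (rule integral_abs_bound)
  also have "\<dots> \<le> (\<integral>\<theta>'. \<delta> * norm u \<partial>M)"
    by (rule integral_mono) (use I \<Phi>i k in \<open>auto simp: smoothing_kernel_def\<close>)
  finally show "\<bar>(\<integral>\<theta>. g \<theta> * (\<Phi> \<theta> \<bullet> u) \<partial>\<tau>) - (\<integral>\<theta>. \<Phi> \<theta> \<bullet> u \<partial>M)\<bar> \<le> \<delta> * norm u * measure M UNIV"
    by (simp add: sp mult_ac)
qed

text \<open>The total variation norm through the Jordan parts: a real number, where
  \<open>total_variation\<close> is an extended supremum over partitions.\<close>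

definition variation_mass :: "('m::topological_space set \<Rightarrow> real) \<Rightarrow> real" where
  "variation_mass \<mu> = measure (positive_part \<mu>) UNIV + measure (positive_part (\<lambda>A. - \<mu> A)) UNIV"

lemma variation_mass_nonneg: "0 \<le> variation_mass \<mu>"
  by (simp add: variation_mass_def)

text \<open>One kernel smooths both Jordan parts, and the results are subtracted. The smoothed parts
  \<open>g\<close> and \<open>h\<close> may overlap, so they need not be the Jordan parts of
  \<open>f\<close>; from \<open>\<bar>f\<bar> \<le> g + h\<close> the variation is bounded above,
  while the total mass is kept exactly.\<close>

lemma smoothing_signed_measure:
  fixes \<tau> :: "'m::topological_space measure" and \<Phi> :: "'m \<Rightarrow> 'h::{real_inner,complete_space}"
  assumes \<tau>: "finite_measure \<tau>" "sets \<tau> = sets borel" and \<mu>: "signed_borel_measure \<mu>"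
    and cont: "continuous_on UNIV \<Phi>" and bd: "\<And>\<theta>. norm (\<Phi> \<theta>) \<le> c"
    and k: "smoothing_kernel \<tau> \<Phi> UNIV b \<delta> k" and \<delta>: "0 \<le> \<delta>"
  obtains f where "integrable \<tau> f" "\<And>\<theta>. \<bar>f \<theta>\<bar> \<le> b * variation_mass \<mu>"
    "(\<integral>\<theta>. \<bar>f \<theta>\<bar> \<partial>\<tau>) \<le> variation_mass \<mu>" "(\<integral>\<theta>. f \<theta> \<partial>\<tau>) = \<mu> UNIV"
    "nonneg_on_borel \<mu> \<Longrightarrow> (\<forall>\<theta>. 0 \<le> f \<theta>)"
    "norm (hilbert_integral (density_measure \<tau> f) \<Phi> - hilbert_integral \<mu> \<Phi>) \<le> \<delta> * variation_mass \<mu>"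
proof -
  let ?P = "positive_part \<mu>" and ?N = "positive_part (\<lambda>A. - \<mu> A)"
  have finP: "finite_measure ?P" and finN: "finite_measure ?N"
    using finite_measure_positive_part[OF \<mu>] finite_measure_positive_part[OF signed_borel_measure_uminus[OF \<mu>]] .
  define g h where "g \<theta> = (\<integral>\<theta>'. k \<theta> \<theta>' \<partial>?P)" and "h \<theta> = (\<integral>\<theta>'. k \<theta> \<theta>' \<partial>?N)" for \<theta>
  note G = smoothing_finite_measure[OF \<tau> finP sets_positive_part cont bd k, folded g_def]
  note H = smoothing_finite_measure[OF \<tau> finN sets_positive_part cont bd k, folded h_def]
  define f where "f \<theta> = g \<theta> - h \<theta>" for \<theta>
  have fi: "integrable \<tau> f" unfolding f_def using G(1) H(1) by simp
  have fab: "\<bar>f \<theta>\<bar> \<le> g \<theta> + h \<theta>" for \<theta> using G(2)[of \<theta>] H(2)[of \<theta>] by (simp add: f_def)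
  have meas: "(\<lambda>\<theta>. \<Phi> \<theta> \<bullet> u) \<in> borel_measurable borel" for u
    by (intro borel_measurable_continuous_onI continuous_intros cont)
  have meas' [measurable]: "(\<lambda>\<theta>. \<Phi> \<theta> \<bullet> u) \<in> borel_measurable \<tau>" for u
    using meas measurable_cong_sets[OF \<tau>(2) refl] by blast
  have \<Phi>b: "\<bar>\<Phi> \<theta> \<bullet> u\<bar> \<le> c * norm u" for \<theta> u
    using Cauchy_Schwarz_ineq2[of "\<Phi> \<theta>" u] mult_right_mono[OF bd norm_ge_zero] by (rule order_trans)
  have gi: "integrable \<tau> (\<lambda>\<theta>. g \<theta> * (\<Phi> \<theta> \<bullet> u))" if "integrable \<tau> g" for g :: "'m \<Rightarrow> real" and u
  proof (rule Bochner_Integration.integrable_bound[where f="\<lambda>\<theta>. (c * norm u) * g \<theta>"])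
    show "integrable \<tau> (\<lambda>\<theta>. (c * norm u) * g \<theta>)" using that by simp
    show "(\<lambda>\<theta>. g \<theta> * (\<Phi> \<theta> \<bullet> u)) \<in> borel_measurable \<tau>"
      using borel_measurable_integrable[OF that] by measurable
    have "\<bar>g \<theta>\<bar> * \<bar>\<Phi> \<theta> \<bullet> u\<bar> \<le> \<bar>g \<theta>\<bar> * \<bar>c * norm u\<bar>" for \<theta>
      using \<Phi>b[of \<theta> u] by (intro mult_left_mono) auto
    then show "AE \<theta> in \<tau>. norm (g \<theta> * (\<Phi> \<theta> \<bullet> u)) \<le> norm ((c * norm u) * g \<theta>)"
      by (simp add: abs_mult mult.commute)
  qed
  let ?w = "hilbert_integral (density_measure \<tau> f) \<Phi> - hilbert_integral \<mu> \<Phi>"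
  have w: "\<bar>?w \<bullet> u\<bar> \<le> \<delta> * norm u * variation_mass \<mu>" for u
  proof -
    have "hilbert_integral (density_measure \<tau> f) \<Phi> \<bullet> u = (\<integral>\<theta>. f \<theta> * (\<Phi> \<theta> \<bullet> u) \<partial>\<tau>)"
      using hilbert_integral_inner[OF finite_measure_positive_part_density[OF \<tau>(2) fi] cont bd]
        signed_integral_density[OF \<tau>(2) fi meas \<Phi>b] by simp
    also have "\<dots> = (\<integral>\<theta>. g \<theta> * (\<Phi> \<theta> \<bullet> u) \<partial>\<tau>) - (\<integral>\<theta>. h \<theta> * (\<Phi> \<theta> \<bullet> u) \<partial>\<tau>)"
      unfolding f_def using gi[OF G(1)] gi[OF H(1)] by (simp add: left_diff_distrib)
    finally have 1: "hilbert_integral (density_measure \<tau> f) \<Phi> \<bullet> u = \<dots>" .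
    have "hilbert_integral \<mu> \<Phi> \<bullet> u = (\<integral>\<theta>. \<Phi> \<theta> \<bullet> u \<partial>?P) - (\<integral>\<theta>. \<Phi> \<theta> \<bullet> u \<partial>?N)"
      using hilbert_integral_inner[OF finP finN cont bd] by (simp add: signed_integral_def)
    then show ?thesis
      using 1 G(5)[of u] H(5)[of u] unfolding inner_diff_left variation_mass_def
      by (simp add: algebra_simps abs_le_iff)
  qed
  show ?thesis
  proof (rule that[of f])
    show "\<bar>f \<theta>\<bar> \<le> b * variation_mass \<mu>" for \<theta>
      using fab[of \<theta>] G(3)[of \<theta>] H(3)[of \<theta>] by (simp add: variation_mass_def algebra_simps)
    have "(\<integral>\<theta>. \<bar>f \<theta>\<bar> \<partial>\<tau>) \<le> (\<integral>\<theta>. g \<theta> + h \<theta> \<partial>\<tau>)"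
      by (rule integral_mono) (use fi fab G(1) H(1) in auto)
    then show "(\<integral>\<theta>. \<bar>f \<theta>\<bar> \<partial>\<tau>) \<le> variation_mass \<mu>"
      using G(1,4) H(1,4) by (simp add: variation_mass_def)
    show "(\<integral>\<theta>. f \<theta> \<partial>\<tau>) = \<mu> UNIV"
      unfolding f_def using G(1,4) H(1,4) jordan_decomposition[OF \<mu>, of UNIV] by simp
    \<comment> \<open>\<open>h\<close> is at most \<open>b\<close> times the mass of the negative
      part, which is 0 here.\<close>
    show "\<forall>\<theta>. 0 \<le> f \<theta>" if "nonneg_on_borel \<mu>"
      using G(2) H(3) nonneg_negative_part_zero[OF \<mu> that] by (auto simp: f_def intro: order_trans)
    \<comment> \<open>The weak estimate is tested with the error itself; dividing by its norm gives
      the norm estimate.\<close>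
    have "(norm ?w)\<^sup>2 \<le> \<delta> * variation_mass \<mu> * norm ?w"
      using w[of ?w] by (simp add: power2_norm_eq_inner algebra_simps)
    then have *: "norm ?w * norm ?w \<le> (\<delta> * variation_mass \<mu>) * norm ?w" by (simp add: power2_eq_square)
    show "norm ?w \<le> \<delta> * variation_mass \<mu>"
    proof (cases "?w = 0")
      case False
      then show ?thesis using * by (simp add: mult_le_cancel_right)
    qed (use \<delta> in \<open>simp add: variation_mass_nonneg\<close>)
  qed (fact fi)
qed

section \<open>Regularizers under smoothing\<close>

lemma total_variation_density_le:
  fixes \<tau> :: "'m::topological_space measure"
  assumes st: "sets \<tau> = sets borel" and f: "integrable \<tau> f"
  shows "total_variation (density_measure \<tau> f) \<le> ereal (\<integral>\<theta>. \<bar>f \<theta>\<bar> \<partial>\<tau>)"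
  unfolding total_variation_def
proof (rule SUP_least)
  fix P :: "'m set set"
  assume "P \<in> {P. finite P \<and> disjoint P \<and> P \<subseteq> sets borel \<and> \<Union> P = UNIV}"
  then have P: "finite P" "disjoint P" "P \<subseteq> sets \<tau>" "\<Union> P = UNIV" using st by auto
  have i: "integrable \<tau> (\<lambda>x. indicator A x * g x)"
    if "integrable \<tau> g" "A \<in> P" for g :: "'m \<Rightarrow> real" and A
    using integrable_mult_indicator[OF _ that(1), of A] P(3) that(2) by auto
  have "(\<Sum>A\<in>P. \<bar>density_measure \<tau> f A\<bar>) \<le> (\<Sum>A\<in>P. \<integral>x. indicator A x * \<bar>f x\<bar> \<partial>\<tau>)"
  proof (rule sum_mono)
    fix A assume "A \<in> P"
    have "\<bar>density_measure \<tau> f A\<bar> \<le> (\<integral>x. \<bar>indicator A x * f x\<bar> \<partial>\<tau>)"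
      unfolding density_measure_def set_lebesgue_integral_def by (simp add: integral_abs_bound)
    then show "\<bar>density_measure \<tau> f A\<bar> \<le> (\<integral>x. indicator A x * \<bar>f x\<bar> \<partial>\<tau>)"
      by (simp add: abs_mult)
  qed
  also have "\<dots> = (\<integral>x. (\<Sum>A\<in>P. indicator A x * \<bar>f x\<bar>) \<partial>\<tau>)"
    by (rule Bochner_Integration.integral_sum[symmetric]) (use i f in auto)
  also have "\<dots> = (\<integral>x. \<bar>f x\<bar> \<partial>\<tau>)"
  proof (rule Bochner_Integration.integral_cong)
    fix x
    have "disjoint_family_on (\<lambda>A. A) P" using P(2) by (auto simp: disjoint_family_on_def disjoint_def)
    then have "(indicator (\<Union>A\<in>P. A) x :: real) = (\<Sum>A\<in>P. indicator A x)"
      by (rule indicator_UN_disjoint[OF P(1)])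
    then have "(\<Sum>A\<in>P. indicator A x) = (1::real)" using P(4) by simp
    then show "(\<Sum>A\<in>P. indicator A x * \<bar>f x\<bar>) = \<bar>f x\<bar>" by (simp add: sum_distrib_right[symmetric])
  qed simp
  finally show "ereal (\<Sum>A\<in>P. \<bar>density_measure \<tau> f A\<bar>) \<le> ereal (\<integral>\<theta>. \<bar>f \<theta>\<bar> \<partial>\<tau>)" by simp
qed

lemma total_variation_nonneg: "0 \<le> total_variation \<mu>"
proof -
  have "ereal (\<Sum>A\<in>{UNIV}. \<bar>\<mu> A\<bar>) \<le> total_variation \<mu>"
    unfolding total_variation_def by (rule SUP_upper) auto
  then show ?thesis by (auto intro: order_trans[rotated])
qed

lemma elementary_regularizer_nonneg: "h \<in> elementary_regularizers \<Longrightarrow> 0 \<le> h \<mu>"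
  unfolding elementary_regularizers_def convex_indicator_def
  by (auto simp: total_variation_nonneg)

text \<open>A regularizer of the list sees a measure only through its sign, its total mass and its
  total variation, exactly the quantities that smoothing controls, and it is monotone in the
  last.\<close>

lemma elementary_regularizer_mono:
  fixes \<mu> \<nu> :: "'m::topological_space set \<Rightarrow> real"
  assumes h: "h \<in> elementary_regularizers"
    and tv: "total_variation \<nu> \<le> total_variation \<mu>" and m: "\<nu> UNIV = \<mu> UNIV"
    and nn: "nonneg_on_borel \<mu> \<Longrightarrow> nonneg_on_borel \<nu>"
  shows "h \<nu> \<le> h \<mu>"
proof -
  have *: "ereal l * total_variation \<nu> \<le> ereal l * total_variation \<mu>" if "0 \<le> l" for l
    using tv that by (intro ereal_mult_left_mono) auto
  then have **: "ereal l * total_variation \<nu> \<le> 1" if "0 \<le> l" "ereal l * total_variation \<mu> \<le> 1" for l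
    using that by (blast intro: order_trans)
  from h consider "h = convex_indicator (\<lambda>\<mu>. nonneg_on_borel \<mu> \<and> \<mu> UNIV = 1)"
    | "h = convex_indicator nonneg_on_borel"
    | l where "0 \<le> l" "h = (\<lambda>\<mu>. ereal l * total_variation \<mu>)"
    | l where "0 \<le> l" "h = convex_indicator (\<lambda>\<mu>. ereal l * total_variation \<mu> \<le> 1)"
    unfolding elementary_regularizers_def by blast
  then show ?thesis
    using nn m * ** by cases (auto simp: convex_indicator_def)
qed

lemma H_bar_mono:
  fixes \<mu> \<nu> :: "'m::topological_space set \<Rightarrow> real"
  assumes "set hs \<subseteq> elementary_regularizers"
    and "total_variation \<nu> \<le> total_variation \<mu>" "\<nu> UNIV = \<mu> UNIV"
    "nonneg_on_borel \<mu> \<Longrightarrow> nonneg_on_borel \<nu>"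
  shows "H_bar hs \<nu> \<le> H_bar hs \<mu>"
  using assms(1) unfolding H_bar_def
  by (induction hs) (auto intro!: add_mono elementary_regularizer_mono assms)

lemma H_bar_nonneg: "set hs \<subseteq> elementary_regularizers \<Longrightarrow> 0 \<le> H_bar hs \<mu>"
  unfolding H_bar_def by (induction hs) (auto intro: elementary_regularizer_nonneg add_nonneg_nonneg)

text \<open>The variation is compared along the chain \<open>total_variation\<close> of the density,
  integral of \<open>\<bar>f\<bar>\<close>, \<open>variation_mass \<mu>\<close>,
  \<open>total_variation \<mu>\<close>.\<close>

lemma H_bar_density_le:
  fixes \<tau> :: "'m::topological_space measure"
  assumes st: "sets \<tau> = sets borel" and \<mu>: "signed_borel_measure \<mu>"
    and hs: "set hs \<subseteq> elementary_regularizers" and f: "integrable \<tau> f"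
    and tv: "(\<integral>\<theta>. \<bar>f \<theta>\<bar> \<partial>\<tau>) \<le> variation_mass \<mu>" and m: "(\<integral>\<theta>. f \<theta> \<partial>\<tau>) = \<mu> UNIV"
    and nn: "nonneg_on_borel \<mu> \<Longrightarrow> (\<forall>\<theta>. 0 \<le> f \<theta>)"
  shows "H_bar hs (density_measure \<tau> f) \<le> H_bar hs \<mu>"
proof (rule H_bar_mono[OF hs])
  have "total_variation (density_measure \<tau> f) \<le> ereal (variation_mass \<mu>)"
    using total_variation_density_le[OF st f] tv by (auto intro: order_trans)
  then show "total_variation (density_measure \<tau> f) \<le> total_variation \<mu>"
    using measure_variation_le_total_variation[OF \<mu>] unfolding variation_mass_def
    by (rule order_trans)
  have "space \<tau> = UNIV" using sets_eq_imp_space_eq[OF st] by simp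
  then show "density_measure \<tau> f UNIV = \<mu> UNIV"
    using m by (simp add: density_measure_def set_lebesgue_integral_def)
  show "nonneg_on_borel (density_measure \<tau> f)" if "nonneg_on_borel \<mu>"
    using nn[OF that] by (auto simp: nonneg_on_borel_def density_measure_def set_lebesgue_integral_def)
qed

section \<open>From smoothing kernels to the rate\<close>

text \<open>Descent estimate. The gradient is compared at \<open>v\<close> and at one intermediate
  point of the mean value theorem, hence the constant \<open>L\<close> where integration along the
  segment would give \<open>L / 2\<close>.\<close>

lemma smooth_upper_bound:
  fixes R :: "'h::real_inner \<Rightarrow> real"
  assumes R: "\<And>x. GDERIV R x :> gradR x" and L: "L-lipschitz_on UNIV gradR"
  shows "R (v + w) - R v \<le> gradR v \<bullet> w + L * (norm w)\<^sup>2"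
proof -
  have "DERIV (\<lambda>t. R (v + t *\<^sub>R w)) t :> w \<bullet> gradR (v + t *\<^sub>R w)" for t
  proof -
    have "(R has_derivative (\<lambda>h. h \<bullet> gradR (v + t *\<^sub>R w))) (at (v + t *\<^sub>R w))"
      using R[of "v + t *\<^sub>R w"] by (simp add: gderiv_def)
    then have "((\<lambda>t. R (v + t *\<^sub>R w)) has_derivative (\<lambda>s. (s *\<^sub>R w) \<bullet> gradR (v + t *\<^sub>R w))) (at t)"
      by (rule has_derivative_compose[rotated]) (auto intro!: derivative_eq_intros)
    then show ?thesis by (simp add: has_field_derivative_def mult_commute_abs)
  qed
  then obtain z where z: "0 < z" "z < (1::real)"
    "R (v + 1 *\<^sub>R w) - R (v + 0 *\<^sub>R w) = (1 - 0) * (w \<bullet> gradR (v + z *\<^sub>R w))"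
    using MVT2[of 0 1 "\<lambda>t. R (v + t *\<^sub>R w)" "\<lambda>t. w \<bullet> gradR (v + t *\<^sub>R w)"] by auto
  have L0: "0 \<le> L" using L by (rule lipschitz_on_nonneg)
  have "(gradR (v + z *\<^sub>R w) - gradR v) \<bullet> w \<le> norm (gradR (v + z *\<^sub>R w) - gradR v) * norm w"
    by (rule norm_cauchy_schwarz)
  also have "\<dots> \<le> (L * norm (z *\<^sub>R w)) * norm w"
    using lipschitz_onD[OF L, of "v + z *\<^sub>R w" v] by (intro mult_right_mono) (auto simp: dist_norm)
  also have "\<dots> \<le> L * (1 * norm w) * norm w"
    using z L0 by (intro mult_right_mono mult_left_mono) (auto simp: mult_right_mono mult_left_le_one_le)
  finally show ?thesis using z(3) by (simp add: inner_diff_left inner_commute power2_eq_square algebra_simps)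
qed

text \<open>A bound for small \<open>\<epsilon>\<close> suffices: for \<open>\<epsilon> \<ge> r / 2\<close> the right-hand side is at least
  \<open>(r / 2) ^ q\<close>, which dominates the bound obtained at \<open>r / 2\<close>.\<close>

lemma rate_boundI:
  assumes A2: "assumption_A2 \<eta>" and C: "0 < C" and r: "0 < r"
    and b: "\<And>\<epsilon> \<alpha>. \<epsilon> \<in> {0<..<r} \<Longrightarrow> \<alpha> \<in> {0<..1} \<Longrightarrow>
      \<psi> \<alpha> \<le> ereal (C * \<epsilon> ^ q + \<alpha> * (C * (\<epsilon> ^ d * rval \<eta> (1 / \<epsilon> ^ d))))"
  shows "rate_bound \<eta> d \<psi> q"
proof -
  define e where "e = r / 2"
  have e: "0 < e" "e < r" using r by (auto simp: e_def)
  define C3 where "C3 = C * e ^ q + C * (e ^ d * rval \<eta> (1 / e ^ d))"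
  have C3: "0 < C3" unfolding C3_def
    using e C rval_nonneg[OF A2] by (intro add_pos_nonneg mult_nonneg_nonneg) auto
  \<comment> \<open>\<open>C\<close> serves the radii below \<open>e\<close>, and
    \<open>C3 / e ^ q\<close> the others; \<open>C3\<close> is the bound at \<open>e\<close> with
    \<alpha> raised to 1.\<close>
  define K where "K = max C (C3 / e ^ q)"
  have K: "0 < K" using C by (simp add: K_def)
  have main: "\<psi> \<alpha> \<le> ereal K * (ereal (\<epsilon> ^ q) + ereal (\<alpha> * \<epsilon> ^ d) * \<eta> (1 / \<epsilon> ^ d))"
    if \<alpha>: "\<alpha> \<in> {0<..1}" and \<epsilon>: "0 < \<epsilon>" for \<alpha> \<epsilon>
  proof -
    define E where "E = \<epsilon> ^ d * rval \<eta> (1 / \<epsilon> ^ d)"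
    have E: "0 \<le> E" using \<epsilon> rval_nonneg[OF A2] by (simp add: E_def)
    have "\<psi> \<alpha> \<le> ereal (K * (\<epsilon> ^ q + \<alpha> * E))"
    proof (cases "\<epsilon> < e")
      case True
      have "\<psi> \<alpha> \<le> ereal (C * \<epsilon> ^ q + \<alpha> * (C * E))"
        unfolding E_def using b[of \<epsilon> \<alpha>] True \<epsilon> e \<alpha> by auto
      also have "C * \<epsilon> ^ q + \<alpha> * (C * E) = C * (\<epsilon> ^ q + \<alpha> * E)" by (simp add: algebra_simps)
      also have "ereal \<dots> \<le> ereal (K * (\<epsilon> ^ q + \<alpha> * E))"
        using \<epsilon> \<alpha> E by (simp add: K_def mult_right_mono)
      finally show ?thesis .
    next
      case False
      have "\<psi> \<alpha> \<le> ereal (C * e ^ q + \<alpha> * (C * (e ^ d * rval \<eta> (1 / e ^ d))))"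
        using b[of e \<alpha>] e \<alpha> by auto
      also have "\<dots> \<le> ereal C3"
        using \<alpha> C e rval_nonneg[OF A2] unfolding C3_def
        by (auto intro!: mult_left_le_one_le)
      also have "C3 \<le> C3 / e ^ q * \<epsilon> ^ q"
      proof -
        have "C3 / e ^ q * e ^ q \<le> C3 / e ^ q * \<epsilon> ^ q"
          using False e C3 by (intro mult_left_mono power_mono) auto
        then show ?thesis using e by simp
      qed
      also have "\<dots> \<le> K * (\<epsilon> ^ q + \<alpha> * E)"
        using \<epsilon> \<alpha> E C3 K e by (intro mult_mono) (auto simp: K_def)
      finally show ?thesis by simp
    qed
    have fin: "\<eta> (1 / \<epsilon> ^ d) = ereal (rval \<eta> (1 / \<epsilon> ^ d))"
      using \<epsilon> by (intro eta_eq_rval[OF A2] nonneg_in_edom[OF A2]) simp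
    have conv: "ereal K * (ereal (\<epsilon> ^ q) + ereal (\<alpha> * \<epsilon> ^ d) * x) = ereal (K * (\<epsilon> ^ q + \<alpha> * (\<epsilon> ^ d * y)))"
      if "x = ereal y" for x y using that by (simp add: algebra_simps)
    show ?thesis unfolding conv[OF fin] using \<open>\<psi> \<alpha> \<le> ereal (K * (\<epsilon> ^ q + \<alpha> * E))\<close> by (simp add: E_def)
  qed
  have "\<psi> \<alpha> \<le> ereal K * (INF \<epsilon>\<in>{0<..}. ereal (\<epsilon> ^ q) + ereal (\<alpha> * \<epsilon> ^ d) * \<eta> (1 / \<epsilon> ^ d))"
    if \<alpha>: "\<alpha> \<in> {0<..1}" for \<alpha>
  proof -
    have "\<psi> \<alpha> / ereal K \<le> (INF \<epsilon>\<in>{0<..}. ereal (\<epsilon> ^ q) + ereal (\<alpha> * \<epsilon> ^ d) * \<eta> (1 / \<epsilon> ^ d))"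
      by (rule INF_greatest) (use main[OF \<alpha>] K in \<open>simp add: ereal_divide_le_pos\<close>)
    then show ?thesis using K by (simp add: ereal_divide_le_pos)
  qed
  then show ?thesis unfolding rate_bound_def using K by (intro exI[of _ K] exI[of _ 1] conjI ballI) auto
qed


lemma rate_from_smoothing_kernels:
  fixes \<tau> :: "'m::topological_space measure"
    and \<Phi> :: "'m \<Rightarrow> 'h::{real_inner,complete_space}"
  assumes prob: "emeasure \<tau> UNIV = 1" and st: "sets \<tau> = sets borel"
    and compact: "compact (UNIV :: 'm set)"
    and A1: "assumption_A1 R gradR \<Phi> hs" and A2: "assumption_A2 \<eta>"
    and f0_dom: "AE \<theta> in \<tau>. f0 \<theta> \<in> interior (edom \<eta>)"
    and f0_bounded: "\<exists>B. AE \<theta> in \<tau>. \<bar>ederiv \<eta> (f0 \<theta>)\<bar> \<le> B"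
    and \<mu>: "signed_borel_measure \<mu>"
    and min: "F_bar R \<Phi> hs \<mu> = inf_F R \<Phi> hs \<tau>"
    and nonneg: "assumption_A2_plus \<eta> \<Longrightarrow> nonneg_on_borel \<mu>"
    and d: "0 < d" and K: "0 < K" and r: "0 < r"
    and kernels: "\<And>\<epsilon>. \<epsilon> \<in> {0<..<r} \<Longrightarrow> \<exists>k. smoothing_kernel \<tau> \<Phi> UNIV (K / \<epsilon> ^ d) (K * \<epsilon> ^ p) k"
  shows "rate_bound \<eta> d (psi R \<Phi> hs \<tau> \<eta> f0) p"
    and "(\<And>\<theta>. G_bar_deriv gradR \<Phi> \<mu> \<theta> = 0) \<Longrightarrow> rate_bound \<eta> d (psi R \<Phi> hs \<tau> \<eta> f0) (2 * p)"
proof -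
  have sp: "space \<tau> = UNIV" using sets_eq_imp_space_eq[OF st] by simp
  have fin: "finite_measure \<tau>" by (rule finite_measureI) (simp add: sp prob)
  have cont: "continuous_on UNIV \<Phi>" and hs: "set hs \<subseteq> elementary_regularizers"
    and R: "\<And>x. GDERIV R x :> gradR x"
    using A1 by (auto simp: assumption_A1_def)
  obtain L where L: "L-lipschitz_on UNIV gradR" using A1 by (auto simp: assumption_A1_def)
  have L0: "0 \<le> L" using L by (rule lipschitz_on_nonneg)
  have "bounded (range \<Phi>)"
    by (rule compact_imp_bounded[OF compact_continuous_image[OF cont compact]])
  then obtain c where c: "\<And>\<theta>. norm (\<Phi> \<theta>) \<le> c" by (auto simp: bounded_iff)
  \<comment> \<open>Stated for an arbitrary signed measure because it is applied twice: to a measure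
    where \<open>H_bar\<close> is finite, and to \<open>\<mu>\<close>.\<close>
  have smooth: "\<exists>f. integrable \<tau> f \<and> (\<forall>\<theta>. \<bar>f \<theta>\<bar> \<le> K / \<epsilon> ^ d * variation_mass \<nu>) \<and>
    (\<integral>\<theta>. \<bar>f \<theta>\<bar> \<partial>\<tau>) \<le> variation_mass \<nu> \<and> (nonneg_on_borel \<nu> \<longrightarrow> (\<forall>\<theta>. 0 \<le> f \<theta>)) \<and>
    norm (hilbert_integral (density_measure \<tau> f) \<Phi> - hilbert_integral \<nu> \<Phi>) \<le> K * \<epsilon> ^ p * variation_mass \<nu> \<and>
    H_bar hs (density_measure \<tau> f) \<le> H_bar hs \<nu>"
    if \<nu>: "signed_borel_measure \<nu>" and \<epsilon>: "\<epsilon> \<in> {0<..<r}" for \<nu> \<epsilon>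
  proof -
    obtain k where k: "smoothing_kernel \<tau> \<Phi> UNIV (K / \<epsilon> ^ d) (K * \<epsilon> ^ p) k" using kernels[OF \<epsilon>] by blast
    have "0 \<le> K * \<epsilon> ^ p" using K \<epsilon> by simp
    from smoothing_signed_measure[OF fin st \<nu> cont c k this] obtain f
      where f: "integrable \<tau> f" "\<And>\<theta>. \<bar>f \<theta>\<bar> \<le> K / \<epsilon> ^ d * variation_mass \<nu>"
        "(\<integral>\<theta>. \<bar>f \<theta>\<bar> \<partial>\<tau>) \<le> variation_mass \<nu>" "(\<integral>\<theta>. f \<theta> \<partial>\<tau>) = \<nu> UNIV"
        "nonneg_on_borel \<nu> \<Longrightarrow> (\<forall>\<theta>. 0 \<le> f \<theta>)"
        "norm (hilbert_integral (density_measure \<tau> f) \<Phi> - hilbert_integral \<nu> \<Phi>) \<le> K * \<epsilon> ^ p * variation_mass \<nu>"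
      by blast
    then show ?thesis using H_bar_density_le[OF st \<nu> hs f(1,3,4,5)] by blast
  qed
  \<comment> \<open>The measure with finite \<open>H_bar\<close> supplied by (A1) may have no
    density; its smoothing has one, with \<open>H_bar\<close> no larger. Hence \<open>inf_F\<close>
    is below \<infinity>, and by minimality so is \<open>H_bar hs \<mu>\<close>.\<close>
  have "inf_F R \<Phi> hs \<tau> < \<infinity>"
  proof -
    obtain \<nu> where \<nu>: "signed_borel_measure \<nu>" "H_bar hs \<nu> \<noteq> \<infinity>" using A1 by (auto simp: assumption_A1_def)
    obtain f where f: "integrable \<tau> f" "H_bar hs (density_measure \<tau> f) \<le> H_bar hs \<nu>"
      using smooth[OF \<nu>(1), of "r / 2"] r by auto
    have "inf_F R \<Phi> hs \<tau> \<le> F_density R \<Phi> hs \<tau> f"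
      unfolding inf_F_def by (rule INF_lower) (use f in simp)
    also have "\<dots> < \<infinity>" using f(2) \<nu>(2) by (auto simp: F_density_def F_bar_def)
    finally show ?thesis .
  qed
  then have "H_bar hs \<mu> \<noteq> \<infinity>" unfolding min[symmetric] F_bar_def by auto
  then obtain h where h: "H_bar hs \<mu> = ereal h" using H_bar_nonneg[OF hs, of \<mu>] by (cases "H_bar hs \<mu>") auto
  let ?v = "hilbert_integral \<mu> \<Phi>"
  have infF: "inf_F R \<Phi> hs \<tau> = ereal (R ?v + h)" using min h by (simp add: F_bar_def)
  \<comment> \<open>The added 1 keeps \<open>K * V\<close> positive when the variation of
    \<open>\<mu>\<close> is 0.\<close>
  define V where "V = variation_mass \<mu> + 1"
  have V: "0 < V" "variation_mass \<mu> \<le> V" using variation_mass_nonneg[of \<mu>] by (simp_all add: V_def)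
  have "0 < K * V" "0 \<le> V" using K V by auto
  have "emeasure \<tau> (space \<tau>) = 1" using prob sp by simp
  from D_bar_le[OF A2 this f0_dom f0_bounded d \<open>0 < K * V\<close> \<open>0 \<le> V\<close>]
  obtain C where "0 < C" and "\<exists>r'>0. \<forall>\<epsilon>\<in>{0<..<r'}. \<forall>f. integrable \<tau> f \<longrightarrow> (\<forall>\<theta>. \<bar>f \<theta>\<bar> \<le> K * V / \<epsilon> ^ d) \<longrightarrow>
    (\<integral>\<theta>. \<bar>f \<theta>\<bar> \<partial>\<tau>) \<le> V \<longrightarrow> (assumption_A2_plus \<eta> \<longrightarrow> (\<forall>\<theta>. 0 \<le> f \<theta>)) \<longrightarrow>
    D_bar \<eta> \<tau> f f0 \<le> ereal (C * (\<epsilon> ^ d * rval \<eta> (1 / \<epsilon> ^ d)))" by blast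
  then obtain r' where C: "0 < C" "0 < r'"
    "\<And>\<epsilon> f. \<epsilon> \<in> {0<..<r'} \<Longrightarrow> integrable \<tau> f \<Longrightarrow> (\<And>\<theta>. \<bar>f \<theta>\<bar> \<le> (K * V) / \<epsilon> ^ d) \<Longrightarrow>
      (\<integral>\<theta>. \<bar>f \<theta>\<bar> \<partial>\<tau>) \<le> V \<Longrightarrow> (assumption_A2_plus \<eta> \<Longrightarrow> (\<forall>\<theta>. 0 \<le> f \<theta>)) \<Longrightarrow>
      D_bar \<eta> \<tau> f f0 \<le> ereal (C * (\<epsilon> ^ d * rval \<eta> (1 / \<epsilon> ^ d)))"
    by blast
  \<comment> \<open>The cap at 1 lets the quadratic remainder \<open>\<epsilon> ^ (2 * p)\<close> be
    absorbed into \<open>\<epsilon> ^ p\<close>.\<close>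
  define \<rho> where "\<rho> = min 1 (min r r')"
  have \<rho>: "0 < \<rho>" using r C(2) by (simp add: \<rho>_def)
  \<comment> \<open>The displacement \<open>w\<close> of the integral of \<Phi> stays visible,
    because the two rates differ only in how the first-order term
    \<open>gradR ?v \<bullet> w\<close> is treated.\<close>
  have main: "\<exists>w. norm w \<le> K * V * \<epsilon> ^ p \<and>
      psi R \<Phi> hs \<tau> \<eta> f0 \<alpha> \<le> ereal (gradR ?v \<bullet> w + L * (norm w)\<^sup>2 + \<alpha> * (C * (\<epsilon> ^ d * rval \<eta> (1 / \<epsilon> ^ d)))) \<and>
      ((\<forall>\<theta>. G_bar_deriv gradR \<Phi> \<mu> \<theta> = 0) \<longrightarrow> gradR ?v \<bullet> w = 0)"
    if \<epsilon>: "\<epsilon> \<in> {0<..<\<rho>}" and \<alpha>: "\<alpha> \<in> {0<..1}" for \<epsilon> \<alpha>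
  proof -
    have e: "\<epsilon> \<in> {0<..<r}" "\<epsilon> \<in> {0<..<r'}" "0 < \<epsilon>" using \<epsilon> by (auto simp: \<rho>_def)
    obtain f where f: "integrable \<tau> f" "\<And>\<theta>. \<bar>f \<theta>\<bar> \<le> K / \<epsilon> ^ d * variation_mass \<mu>"
      "(\<integral>\<theta>. \<bar>f \<theta>\<bar> \<partial>\<tau>) \<le> variation_mass \<mu>" "nonneg_on_borel \<mu> \<Longrightarrow> (\<forall>\<theta>. 0 \<le> f \<theta>)"
      "norm (hilbert_integral (density_measure \<tau> f) \<Phi> - ?v) \<le> K * \<epsilon> ^ p * variation_mass \<mu>"
      "H_bar hs (density_measure \<tau> f) \<le> H_bar hs \<mu>"
      using smooth[OF \<mu> e(1)] by blast
    define w where "w = hilbert_integral (density_measure \<tau> f) \<Phi> - ?v"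
    have "K * \<epsilon> ^ p * variation_mass \<mu> \<le> K * \<epsilon> ^ p * V"
      using V(2) K e by (intro mult_left_mono) auto
    then have w: "norm w \<le> K * V * \<epsilon> ^ p"
      using f(5) unfolding w_def by (simp add: ac_simps)
    have "\<bar>f \<theta>\<bar> \<le> (K * V) / \<epsilon> ^ d" for \<theta>
    proof -
      have "K / \<epsilon> ^ d * variation_mass \<mu> \<le> K / \<epsilon> ^ d * V" using V(2) K e by (intro mult_left_mono) auto
      then show ?thesis using f(2)[of \<theta>] by simp
    qed
    then have D: "D_bar \<eta> \<tau> f f0 \<le> ereal (C * (\<epsilon> ^ d * rval \<eta> (1 / \<epsilon> ^ d)))"
      using f(1,3,4) V(2) nonneg by (intro C(3) e) auto
    obtain h' where h': "H_bar hs (density_measure \<tau> f) = ereal h'" "h' \<le> h"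
      using f(6) h H_bar_nonneg[OF hs, of "density_measure \<tau> f"]
      by (cases "H_bar hs (density_measure \<tau> f)") auto
    have "R (?v + w) - R ?v \<le> gradR ?v \<bullet> w + L * (norm w)\<^sup>2"
      by (rule smooth_upper_bound[OF R L])
    then have F: "F_density R \<Phi> hs \<tau> f - inf_F R \<Phi> hs \<tau> \<le> ereal (gradR ?v \<bullet> w + L * (norm w)\<^sup>2)"
      unfolding infF F_density_def F_bar_def h'(1) w_def using h'(2) by simp
    have "psi R \<Phi> hs \<tau> \<eta> f0 \<alpha> \<le> F_density R \<Phi> hs \<tau> f - inf_F R \<Phi> hs \<tau> + ereal \<alpha> * D_bar \<eta> \<tau> f f0"
      unfolding psi_def by (rule INF_lower) (use f(1) in simp)
    also have "\<dots> \<le> ereal (gradR ?v \<bullet> w + L * (norm w)\<^sup>2) + ereal \<alpha> * ereal (C * (\<epsilon> ^ d * rval \<eta> (1 / \<epsilon> ^ d)))"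
      using \<alpha> by (intro add_mono F ereal_mult_left_mono D) auto
    finally have psi: "psi R \<Phi> hs \<tau> \<eta> f0 \<alpha> \<le> ereal (gradR ?v \<bullet> w + L * (norm w)\<^sup>2 + \<alpha> * (C * (\<epsilon> ^ d * rval \<eta> (1 / \<epsilon> ^ d))))"
      by simp
    \<comment> \<open>A vanishing differential means that every \<open>\<Phi> \<theta>\<close> is
      orthogonal to \<open>gradR ?v\<close>. Integrals of \<Phi> are then orthogonal to it as well,
      and \<open>w\<close> is a difference of two of them.\<close>
    have zero: "gradR ?v \<bullet> w = 0" if "\<forall>\<theta>. G_bar_deriv gradR \<Phi> \<mu> \<theta> = 0"
    proof -
      have z: "\<Phi> \<theta> \<bullet> gradR ?v = 0" for \<theta>
        using that by (simp add: G_bar_deriv_def inner_commute)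
      note fm = finite_measure_positive_part_density[OF st f(1)]
        finite_measure_positive_part[OF \<mu>] finite_measure_positive_part[OF signed_borel_measure_uminus[OF \<mu>]]
      show ?thesis
        using hilbert_integral_inner[OF fm(1,2) cont c, of "gradR ?v"] hilbert_integral_inner[OF fm(3,4) cont c, of "gradR ?v"]
        by (simp add: w_def inner_diff_right inner_commute[of "gradR ?v"] z signed_integral_def)
    qed
    show ?thesis using w psi zero by blast
  qed
  have pow: "(norm w)\<^sup>2 \<le> (K * V)\<^sup>2 * \<epsilon> ^ (2 * p)" if "norm w \<le> K * V * \<epsilon> ^ p" for w :: 'h and \<epsilon>
    using power_mono[OF that norm_ge_zero, of 2] by (simp add: power_mult_distrib power_mult[symmetric] mult.commute)
  define C1 where "C1 = norm (gradR ?v) * (K * V) + L * (K * V)\<^sup>2 + C"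
  have C1: "0 < C1" "C \<le> C1" "L * (K * V)\<^sup>2 \<le> C1" "norm (gradR ?v) * (K * V) + L * (K * V)\<^sup>2 \<le> C1"
    using C(1) L0 \<open>0 < K * V\<close> by (auto simp: C1_def intro!: add_nonneg_pos add_nonneg_nonneg)
  have Dle: "\<alpha> * (C * (\<epsilon> ^ d * rval \<eta> (1 / \<epsilon> ^ d))) \<le> \<alpha> * (C1 * (\<epsilon> ^ d * rval \<eta> (1 / \<epsilon> ^ d)))"
    if "\<epsilon> \<in> {0<..<\<rho>}" "\<alpha> \<in> {0<..1}" for \<epsilon> \<alpha>
    using that C1(2) rval_nonneg[OF A2] by (intro mult_left_mono mult_right_mono mult_nonneg_nonneg) auto
  show "rate_bound \<eta> d (psi R \<Phi> hs \<tau> \<eta> f0) p"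
  proof (rule rate_boundI[OF A2 C1(1) \<rho>])
    fix \<epsilon> \<alpha> assume *: "\<epsilon> \<in> {0<..<\<rho>}" "\<alpha> \<in> {0<..(1::real)}"
    then have e: "0 < \<epsilon>" "\<epsilon> \<le> 1" by (auto simp: \<rho>_def)
    obtain w where w: "norm w \<le> K * V * \<epsilon> ^ p" "psi R \<Phi> hs \<tau> \<eta> f0 \<alpha> \<le>
      ereal (gradR ?v \<bullet> w + L * (norm w)\<^sup>2 + \<alpha> * (C * (\<epsilon> ^ d * rval \<eta> (1 / \<epsilon> ^ d))))"
      using main[OF *] by blast
    have "gradR ?v \<bullet> w \<le> norm (gradR ?v) * (K * V * \<epsilon> ^ p)"
      using norm_cauchy_schwarz[of "gradR ?v" w] mult_left_mono[OF w(1) norm_ge_zero] by (rule order_trans)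
    moreover have "L * (norm w)\<^sup>2 \<le> L * ((K * V)\<^sup>2 * \<epsilon> ^ p)"
    proof (rule mult_left_mono[OF _ L0])
      have "\<epsilon> ^ (2 * p) \<le> \<epsilon> ^ p" using e by (intro power_decreasing) auto
      then show "(norm w)\<^sup>2 \<le> (K * V)\<^sup>2 * \<epsilon> ^ p"
        using pow[OF w(1)] by (meson mult_left_mono order_trans zero_le_power2)
    qed
    moreover have "(norm (gradR ?v) * (K * V) + L * (K * V)\<^sup>2) * \<epsilon> ^ p \<le> C1 * \<epsilon> ^ p"
      using C1(4) e by (intro mult_right_mono) auto
    ultimately have "gradR ?v \<bullet> w + L * (norm w)\<^sup>2 \<le> C1 * \<epsilon> ^ p" by (simp add: algebra_simps)
    then have "gradR ?v \<bullet> w + L * (norm w)\<^sup>2 + \<alpha> * (C * (\<epsilon> ^ d * rval \<eta> (1 / \<epsilon> ^ d)))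
      \<le> C1 * \<epsilon> ^ p + \<alpha> * (C1 * (\<epsilon> ^ d * rval \<eta> (1 / \<epsilon> ^ d)))"
      using Dle[OF *] by (rule add_mono)
    then show "psi R \<Phi> hs \<tau> \<eta> f0 \<alpha> \<le> ereal (C1 * \<epsilon> ^ p + \<alpha> * (C1 * (\<epsilon> ^ d * rval \<eta> (1 / \<epsilon> ^ d))))"
      using w(2) by (meson ereal_less_eq(3) order_trans)
  qed
  show "rate_bound \<eta> d (psi R \<Phi> hs \<tau> \<eta> f0) (2 * p)" if G: "\<And>\<theta>. G_bar_deriv gradR \<Phi> \<mu> \<theta> = 0"
  proof (rule rate_boundI[OF A2 C1(1) \<rho>])
    fix \<epsilon> \<alpha> assume *: "\<epsilon> \<in> {0<..<\<rho>}" "\<alpha> \<in> {0<..(1::real)}"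
    then have e: "0 < \<epsilon>" by auto
    obtain w where w0: "norm w \<le> K * V * \<epsilon> ^ p" "psi R \<Phi> hs \<tau> \<eta> f0 \<alpha> \<le>
      ereal (gradR ?v \<bullet> w + L * (norm w)\<^sup>2 + \<alpha> * (C * (\<epsilon> ^ d * rval \<eta> (1 / \<epsilon> ^ d))))"
      "gradR ?v \<bullet> w = 0"
      using main[OF *] G by blast
    note w = w0(1) w0(2)[unfolded w0(3)]
    have "L * (norm w)\<^sup>2 \<le> L * ((K * V)\<^sup>2 * \<epsilon> ^ (2 * p))"
      using pow[OF w(1)] L0 by (rule mult_left_mono)
    also have "\<dots> \<le> C1 * \<epsilon> ^ (2 * p)"
      using mult_right_mono[OF C1(3), of "\<epsilon> ^ (2 * p)"] e by (simp add: mult.assoc)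
    finally have "0 + L * (norm w)\<^sup>2 + \<alpha> * (C * (\<epsilon> ^ d * rval \<eta> (1 / \<epsilon> ^ d)))
      \<le> C1 * \<epsilon> ^ (2 * p) + \<alpha> * (C1 * (\<epsilon> ^ d * rval \<eta> (1 / \<epsilon> ^ d)))"
      using Dle[OF *] by simp
    then show "psi R \<Phi> hs \<tau> \<eta> f0 \<alpha> \<le> ereal (C1 * \<epsilon> ^ (2 * p) + \<alpha> * (C1 * (\<epsilon> ^ d * rval \<eta> (1 / \<epsilon> ^ d))))"
      using w(2) by (meson ereal_less_eq(3) order_trans)
  qed
qed

section \<open>Kernels in charts\<close>

text \<open>The segment from the identity matrix to the Gram matrix consists of positive definite, hence
  nonsingular, matrices, so the determinant does not change sign.\<close>

lemma det_pos_of_positive_definite: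
  fixes g :: "real ^ 'n::finite \<Rightarrow> real ^ 'n \<Rightarrow> real"
  assumes bil: "bilinear g" and pos: "\<And>u. u \<noteq> 0 \<Longrightarrow> 0 < g u u"
  shows "0 < det (\<chi> i j. g (axis i 1) (axis j 1))"
proof (rule ccontr)
  let ?A = "\<chi> i j. g (axis i 1) (axis j 1)"
  assume neg: "\<not> 0 < det ?A"
  have lin: "linear (g u)" "linear (\<lambda>v. g v u)" for u using bil by (auto simp: bilinear_def)
  have Ax: "(?A *v x) $ i = g (axis i 1) x" for x i
  proof -
    have "g (axis i 1) x = g (axis i 1) (\<Sum>j\<in>UNIV. x $ j *s axis j 1)"
      by (simp add: basis_expansion)
    also have "\<dots> = (\<Sum>j\<in>UNIV. x $ j * g (axis i 1) (axis j 1))"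
      by (simp add: linear_sum[OF lin(1)] linear_cmul[OF lin(1)] scalar_mult_eq_scaleR)
    finally show ?thesis by (simp add: matrix_vector_mult_def mult.commute)
  qed
  have xAx: "x \<bullet> (?A *v x) = g x x" for x
  proof -
    have "g x x = g (\<Sum>j\<in>UNIV. x $ j *s axis j 1) x"
      by (simp add: basis_expansion)
    also have "\<dots> = (\<Sum>j\<in>UNIV. x $ j * g (axis j 1) x)"
      by (simp add: linear_sum[OF lin(2)] linear_cmul[OF lin(2)] scalar_mult_eq_scaleR)
    finally show ?thesis by (simp add: inner_vec_def Ax)
  qed
  define M where "M t = (1 - t) *\<^sub>R mat 1 + t *\<^sub>R ?A" for t :: real
  have nz: "det (M t) \<noteq> 0" if t: "0 \<le> t" "t \<le> 1" for t
  proof -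
    have "x = 0" if "M t *v x = 0" for x
    proof (rule ccontr)
      assume x: "x \<noteq> 0"
      have "x \<bullet> (M t *v x) = (1 - t) * (x \<bullet> x) + t * g x x"
        unfolding M_def matrix_vector_mult_add_rdistrib
        by (simp add: inner_add_right xAx scaleR_matrix_vector_assoc[symmetric])
      also have "\<dots> > 0"
      proof (cases "t = 0")
        case False
        then show ?thesis using t pos[OF x] by (intro add_nonneg_pos) auto
      qed (use x in simp)
      finally show False using that by simp
    qed
    then show ?thesis
      using invertible_det_nz invertible_left_inverse matrix_left_invertible_ker by blast
  qed
  have "continuous_on {0..1} (\<lambda>t. det (M t))"
    unfolding M_def det_def by (simp, intro continuous_intros)
  then have "\<exists>t\<ge>0. t \<le> 1 \<and> det (M t) = 0"
    using neg by (intro IVT2') (auto simp: M_def det_I)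
  then show False using nz by blast
qed

lemma riemannian_atlas_chart:
  assumes "riemannian_atlas \<A>" "c \<in> \<A>"
  shows "open (chart_dom c)" "open (chart_image c)"
    "homeomorphism (chart_dom c) (chart_image c) (chart_map c) (chart_inv c)"
    "\<And>x. x \<in> chart_image c \<Longrightarrow> bilinear (chart_metric c x)"
    "\<And>x u. x \<in> chart_image c \<Longrightarrow> u \<noteq> 0 \<Longrightarrow> 0 < chart_metric c x u u"
    "\<And>u v. continuous_on (chart_image c) (\<lambda>x. chart_metric c x u v)"
proof -
  have ok: "metric_chart_ok c" using assms by (auto simp: riemannian_atlas_def)
  then show "open (chart_dom c)" "open (chart_image c)"
    "homeomorphism (chart_dom c) (chart_image c) (chart_map c) (chart_inv c)"
    "\<And>x. x \<in> chart_image c \<Longrightarrow> bilinear (chart_metric c x)"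
    "\<And>x u. x \<in> chart_image c \<Longrightarrow> u \<noteq> 0 \<Longrightarrow> 0 < chart_metric c x u u"
    by (auto simp: metric_chart_ok_def)
  have "Ck_on 0 (\<lambda>x. chart_metric c x u v) (chart_image c)" for u v
    using ok unfolding metric_chart_ok_def smooth_on_def by blast
  then show "\<And>u v. continuous_on (chart_image c) (\<lambda>x. chart_metric c x u v)" by simp
qed

lemma volume_density_pos:
  assumes "riemannian_atlas \<A>" "c \<in> \<A>" "x \<in> chart_image c"
  shows "0 < volume_density c x"
  unfolding volume_density_def
  using det_pos_of_positive_definite[OF riemannian_atlas_chart(4)[OF assms]]
    riemannian_atlas_chart(5)[OF assms] by simp

lemma continuous_on_volume_density:
  assumes "riemannian_atlas \<A>" "c \<in> \<A>"
  shows "continuous_on (chart_image c) (volume_density c)"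
  unfolding volume_density_def det_def
  by (simp, intro continuous_intros riemannian_atlas_chart(6)[OF assms])

text \<open>The quadratic form is bounded by the sum of the absolute values of its Gram entries,
  which is continuous and so bounded on \<open>K\<close>. The bound is written as a square because
  \<open>curve_speed\<close> takes the root.\<close>

lemma metric_bound_compact:
  assumes atlas: "riemannian_atlas \<A>" "c \<in> \<A>" and K: "compact K" "K \<subseteq> chart_image c"
  shows "\<exists>G\<ge>0. \<forall>x\<in>K. \<forall>u. chart_metric c x u u \<le> (G * norm u)\<^sup>2"
proof -
  define s where "s x = (\<Sum>i\<in>UNIV. \<Sum>j\<in>UNIV. \<bar>chart_metric c x (axis j 1) (axis i 1)\<bar>)" for x
  have s0: "0 \<le> s x" for x by (simp add: s_def sum_nonneg)
  have "continuous_on K s"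
    unfolding s_def
    by (intro continuous_intros continuous_on_subset[OF riemannian_atlas_chart(6)[OF atlas] K(2)])
  then have "bounded (s ` K)" by (intro compact_imp_bounded compact_continuous_image K(1))
  then obtain b where "\<forall>y\<in>s ` K. norm y \<le> b" unfolding bounded_iff by blast
  then have b: "s x \<le> b" if "x \<in> K" for x using that by (auto simp: abs_le_iff)
  have "chart_metric c x u u \<le> (sqrt \<bar>b\<bar> * norm u)\<^sup>2" if x: "x \<in> K" for x u
  proof -
    have lin: "linear (chart_metric c x u)" "linear (\<lambda>v. chart_metric c x v u)" for u
      using riemannian_atlas_chart(4)[OF atlas] x K(2) by (auto simp: bilinear_def)
    have "chart_metric c x u u = chart_metric c x (\<Sum>i\<in>UNIV. u $ i *s axis i 1) (\<Sum>i\<in>UNIV. u $ i *s axis i 1)"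
      by (simp add: basis_expansion)
    also have "\<dots> = (\<Sum>i\<in>UNIV. \<Sum>j\<in>UNIV. u $ i * (u $ j * chart_metric c x (axis j 1) (axis i 1)))"
      by (simp add: linear_sum[OF lin(1)] linear_cmul[OF lin(1)] linear_sum[OF lin(2)] linear_cmul[OF lin(2)]
          scalar_mult_eq_scaleR sum_distrib_left del: basis_expansion)
    also have "\<dots> \<le> (\<Sum>i\<in>UNIV. \<Sum>j\<in>UNIV. (norm u)\<^sup>2 * \<bar>chart_metric c x (axis j 1) (axis i 1)\<bar>)"
    proof (intro sum_mono)
      fix i j :: 'b
      have "u $ i * (u $ j * chart_metric c x (axis j 1) (axis i 1))
        \<le> \<bar>u $ i\<bar> * \<bar>u $ j\<bar> * \<bar>chart_metric c x (axis j 1) (axis i 1)\<bar>"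
        by (metis abs_ge_self abs_mult mult.assoc)
      also have "\<dots> \<le> norm u * norm u * \<bar>chart_metric c x (axis j 1) (axis i 1)\<bar>"
        by (intro mult_right_mono mult_mono component_le_norm_cart) auto
      finally show "u $ i * (u $ j * chart_metric c x (axis j 1) (axis i 1))
        \<le> (norm u)\<^sup>2 * \<bar>chart_metric c x (axis j 1) (axis i 1)\<bar>" by (simp add: power2_eq_square)
    qed
    also have "\<dots> = (norm u)\<^sup>2 * s x" by (simp add: s_def sum_distrib_left)
    also have "\<dots> \<le> (norm u)\<^sup>2 * \<bar>b\<bar>" using b[OF x] by (intro mult_left_mono) auto
    finally show ?thesis by (simp add: power_mult_distrib mult.commute)
  qed
  then show ?thesis by (intro exI[of _ "sqrt \<bar>b\<bar>"]) auto
qed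

lemma lborel_integral_reflect:
  fixes f :: "'a::euclidean_space \<Rightarrow> real"
  assumes f: "f \<in> borel_measurable borel"
  shows "(\<integral>x. f x \<partial>lborel) = (\<integral>x. f (t - x) \<partial>lborel)"
proof -
  have "lborel = density (distr lborel borel (\<lambda>x. t + (-1) *\<^sub>R x)) (\<lambda>_::'a. ennreal (\<bar>-1\<bar> ^ DIM('a)))"
    using lborel_affine[of "-1" t] by simp
  also have "\<dots> = distr lborel borel (\<lambda>x. t - x)" by (simp add: density_1)
  finally have "(\<integral>x. f x \<partial>lborel) = (\<integral>x. f x \<partial>distr lborel borel (\<lambda>x. t - x))" by simp
  also have "\<dots> = (\<integral>x. f (t - x) \<partial>lborel)" by (rule integral_distr) (use f in auto)
  finally show ?thesis .
qed

text \<open>The point reflection through the centre preserves the ball and Lebesgue measure and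
  negates the integrand. This is what removes the first-order Taylor term.\<close>

lemma integral_odd_ball:
  fixes l :: "'a::euclidean_space \<Rightarrow> real"
  assumes l: "bounded_linear l"
  shows "(\<integral>y. indicator (ball x r) y * l (y - x) \<partial>lborel) = 0"
proof -
  interpret bounded_linear l by fact
  define f where "f y = indicator (ball x r) y * l (y - x)" for y
  have "f \<in> borel_measurable borel" unfolding f_def
    by (intro borel_measurable_times borel_measurable_indicator borel_measurable_continuous_onI
        continuous_intros continuous_on) auto
  from lborel_integral_reflect[OF this, of "2 *\<^sub>R x"]
  have "(\<integral>y. f y \<partial>lborel) = (\<integral>y. f (2 *\<^sub>R x - y) \<partial>lborel)" .
  also have "(\<lambda>y. f (2 *\<^sub>R x - y)) = (\<lambda>y. - f y)"
  proof
    fix y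
    have "l (2 *\<^sub>R x - y - x) = l (- (y - x))" by (rule arg_cong[where f=l]) (simp add: scaleR_2)
    then have "l (2 *\<^sub>R x - y - x) = - l (y - x)" by (simp only: linear_neg[OF bounded_linear.linear[OF l]])
    moreover have "dist x (2 *\<^sub>R x - y) = dist x y" by (simp add: dist_norm scaleR_2 norm_minus_commute)
    ultimately show "f (2 *\<^sub>R x - y) = - f y" unfolding f_def indicator_def mem_ball by simp
  qed
  finally show ?thesis unfolding f_def by simp
qed

section \<open>Gluing local kernels\<close>

lemma smoothing_kernel_mono:
  assumes "smoothing_kernel \<tau> \<Phi> U b \<delta> k" "b \<le> b'" "\<delta> \<le> \<delta>'"
  shows "smoothing_kernel \<tau> \<Phi> U b' \<delta>' k"
proof -
  have "\<delta> * norm u \<le> \<delta>' * norm u" for u :: 'b using assms(3) by (rule mult_right_mono) simp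
  then show ?thesis using assms unfolding smoothing_kernel_def by (meson order_trans)
qed

text \<open>The choice depends on \<theta>' alone, so for fixed \<theta>' the glued kernel is one of
  the two given ones, and mass and error carry over unchanged. Repeated gluing is the measurable
  choice of a chart.\<close>

lemma smoothing_kernel_Un:
  fixes \<tau> :: "'m::topological_space measure"
  assumes k1: "smoothing_kernel \<tau> \<Phi> U b \<delta> k1" and k2: "smoothing_kernel \<tau> \<Phi> W b \<delta> k2"
    and U: "U \<in> sets borel"
  shows "smoothing_kernel \<tau> \<Phi> (U \<union> W) b \<delta> (\<lambda>\<theta> \<theta>'. if \<theta>' \<in> U then k1 \<theta> \<theta>' else k2 \<theta> \<theta>')"
  unfolding smoothing_kernel_def
proof (intro conjI)
  have "(\<lambda>x::'m \<times> 'm. if snd x \<in> U then case_prod k1 x else case_prod k2 x) \<in> borel_measurable (borel \<Otimes>\<^sub>M borel)"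
  proof (rule measurable_If)
    show "{x \<in> space (borel \<Otimes>\<^sub>M borel). snd x \<in> U} \<in> sets (borel \<Otimes>\<^sub>M (borel :: 'm measure))"
      using U by measurable
  qed (use k1 k2 in \<open>auto simp: smoothing_kernel_def\<close>)
  then show "(\<lambda>(\<theta>, \<theta>'). if \<theta>' \<in> U then k1 \<theta> \<theta>' else k2 \<theta> \<theta>') \<in> borel_measurable (borel \<Otimes>\<^sub>M borel)"
    unfolding case_prod_unfold .
  let ?k = "\<lambda>\<theta> \<theta>'. if \<theta>' \<in> U then k1 \<theta> \<theta>' else k2 \<theta> \<theta>'"
  show "\<forall>\<theta> \<theta>'. 0 \<le> ?k \<theta> \<theta>' \<and> ?k \<theta> \<theta>' \<le> b"
    using k1 k2 by (auto simp: smoothing_kernel_def)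
  show "\<forall>\<theta>'\<in>U \<union> W. (\<integral>\<theta>. ?k \<theta> \<theta>' \<partial>\<tau>) = 1 \<and>
    (\<forall>u. \<bar>(\<integral>\<theta>. ?k \<theta> \<theta>' * (\<Phi> \<theta> \<bullet> u) \<partial>\<tau>) - \<Phi> \<theta>' \<bullet> u\<bar> \<le> \<delta> * norm u)"
  proof
    fix \<theta>' assume "\<theta>' \<in> U \<union> W"
    then show "(\<integral>\<theta>. ?k \<theta> \<theta>' \<partial>\<tau>) = 1 \<and>
      (\<forall>u. \<bar>(\<integral>\<theta>. ?k \<theta> \<theta>' * (\<Phi> \<theta> \<bullet> u) \<partial>\<tau>) - \<Phi> \<theta>' \<bullet> u\<bar> \<le> \<delta> * norm u)"
      using k1 k2 by (cases "\<theta>' \<in> U") (simp_all add: smoothing_kernel_def)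
  qed
qed

text \<open>One constant governs both the height and the error, so a finite union costs only a
  maximum of constants and a minimum of radii.\<close>

definition smoothable :: "'m::topological_space measure \<Rightarrow> ('m \<Rightarrow> 'h::real_inner) \<Rightarrow> nat \<Rightarrow> nat \<Rightarrow> 'm set \<Rightarrow> bool" where
  "smoothable \<tau> \<Phi> d p U \<longleftrightarrow>
     (\<exists>K>0. \<exists>r>0. \<forall>\<epsilon>\<in>{0<..<r}. \<exists>k. smoothing_kernel \<tau> \<Phi> U (K / \<epsilon> ^ d) (K * \<epsilon> ^ p) k)"

lemma smoothable_Un:
  assumes "smoothable \<tau> \<Phi> d p U" "smoothable \<tau> \<Phi> d p W" "U \<in> sets borel"
  shows "smoothable \<tau> \<Phi> d p (U \<union> W)"
proof -
  obtain K1 r1 where 1: "0 < K1" "0 < r1"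
    "\<And>\<epsilon>. \<epsilon> \<in> {0<..<r1} \<Longrightarrow> \<exists>k. smoothing_kernel \<tau> \<Phi> U (K1 / \<epsilon> ^ d) (K1 * \<epsilon> ^ p) k"
    using assms(1) unfolding smoothable_def by blast
  obtain K2 r2 where 2: "0 < K2" "0 < r2"
    "\<And>\<epsilon>. \<epsilon> \<in> {0<..<r2} \<Longrightarrow> \<exists>k. smoothing_kernel \<tau> \<Phi> W (K2 / \<epsilon> ^ d) (K2 * \<epsilon> ^ p) k"
    using assms(2) unfolding smoothable_def by blast
  define K where "K = max K1 K2"
  have "\<exists>k. smoothing_kernel \<tau> \<Phi> (U \<union> W) (K / \<epsilon> ^ d) (K * \<epsilon> ^ p) k"
    if \<epsilon>: "\<epsilon> \<in> {0<..<min r1 r2}" for \<epsilon>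
  proof -
    have le: "K1 / \<epsilon> ^ d \<le> K / \<epsilon> ^ d" "K2 / \<epsilon> ^ d \<le> K / \<epsilon> ^ d"
      "K1 * \<epsilon> ^ p \<le> K * \<epsilon> ^ p" "K2 * \<epsilon> ^ p \<le> K * \<epsilon> ^ p"
      using \<epsilon> by (auto simp: K_def intro!: divide_right_mono mult_right_mono)
    obtain k1 where "smoothing_kernel \<tau> \<Phi> U (K1 / \<epsilon> ^ d) (K1 * \<epsilon> ^ p) k1" using 1(3)[of \<epsilon>] \<epsilon> by auto
    moreover obtain k2 where "smoothing_kernel \<tau> \<Phi> W (K2 / \<epsilon> ^ d) (K2 * \<epsilon> ^ p) k2" using 2(3)[of \<epsilon>] \<epsilon> by auto
    ultimately show ?thesis
      using smoothing_kernel_Un[OF smoothing_kernel_mono smoothing_kernel_mono assms(3)] le by blast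
  qed
  moreover have "0 < K" "0 < min r1 r2" using 1 2 by (auto simp: K_def)
  ultimately show ?thesis unfolding smoothable_def by blast
qed

lemma smoothable_empty: "smoothable \<tau> \<Phi> d p {}"
  unfolding smoothable_def smoothing_kernel_def
  by (intro exI[of _ 1] conjI ballI exI[of _ "\<lambda>_ _. 0"]) auto

lemma smoothable_compact:
  fixes \<tau> :: "'m::topological_space measure"
  assumes compact: "compact (UNIV :: 'm set)"
    and loc: "\<And>x. \<exists>U. open U \<and> x \<in> U \<and> smoothable \<tau> \<Phi> d p U"
  shows "smoothable \<tau> \<Phi> d p UNIV"
proof -
  let ?C = "{U. open U \<and> smoothable \<tau> \<Phi> d p U}"
  have cover: "UNIV \<subseteq> \<Union>?C" using loc by auto
  obtain D where D: "D \<subseteq> ?C" "finite D" "UNIV \<subseteq> \<Union>D"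
    by (rule compactE[OF compact cover]) blast+
  have "smoothable \<tau> \<Phi> d p (\<Union>D)"
    using D(2,1) by (induction D) (auto intro!: smoothable_Un smoothable_empty)
  then show ?thesis using D(3) by (simp add: top.extremum_unique)
qed

lemma chart_map_measurable:
  fixes c :: "('m::topological_space, 'n::finite) metric_chart"
  assumes "open (chart_dom c)" "homeomorphism (chart_dom c) (chart_image c) (chart_map c) (chart_inv c)"
  shows "(\<lambda>\<theta>. if \<theta> \<in> chart_dom c then chart_map c \<theta> else z) \<in> borel_measurable borel"
  using assms by (intro borel_measurable_continuous_on_if) (auto simp: homeomorphism_def)

text \<open>The law on Borel sets says that the chart map sends \<tau>, restricted to the chart
  domain, to the measure with Lebesgue density \<rho>, extended by 0 outside the chart image. The
  formula is then a change of variables.\<close>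

lemma integral_in_chart:
  fixes c :: "('m::topological_space, 'n::finite) metric_chart" and \<tau> :: "'m measure"
  assumes st: "sets \<tau> = sets borel"
    and op: "open (chart_dom c)" "open (chart_image c)"
    and hom: "homeomorphism (chart_dom c) (chart_image c) (chart_map c) (chart_inv c)"
    and \<rho>: "continuous_on (chart_image c) \<rho>" "\<And>x. x \<in> chart_image c \<Longrightarrow> 0 < \<rho> x"
    and law: "\<And>B. B \<in> sets borel \<Longrightarrow> B \<subseteq> chart_dom c \<Longrightarrow>
      emeasure \<tau> B = (\<integral>\<^sup>+ x\<in>chart_map c ` B. ennreal (\<rho> x) \<partial>lborel)"
    and h: "h \<in> borel_measurable borel"
  shows "(\<integral>\<theta>. indicator (chart_dom c) \<theta> * h (chart_map c \<theta>) \<partial>\<tau>) =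
    (\<integral>x. indicator (chart_image c) x * \<rho> x * (h x::real) \<partial>lborel)"
proof -
  have sp: "space \<tau> = UNIV" using sets_eq_imp_space_eq[OF st] by simp
  have dom: "chart_dom c \<in> sets \<tau>" using op st by auto
  let ?\<tau> = "restrict_space \<tau> (chart_dom c)"
  have X: "chart_map c \<in> borel_measurable ?\<tau>"
  proof -
    have "continuous_on (chart_dom c) (chart_map c)" using hom by (simp add: homeomorphism_def)
    from borel_measurable_continuous_on_restrict[OF this]
    show ?thesis using measurable_cong_sets[OF sets_restrict_space_cong[OF st] refl] by blast
  qed
  define \<rho>' where "\<rho>' x = indicator (chart_image c) x * \<rho> x" for x
  have \<rho>'m: "\<rho>' \<in> borel_measurable borel"
    using borel_measurable_continuous_on_indicator[OF _ \<rho>(1)] op unfolding \<rho>'_def by auto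
  have \<rho>'0: "0 \<le> \<rho>' x" for x using \<rho>(2)[of x] by (auto simp: \<rho>'_def indicator_def)
  have eq: "distr ?\<tau> borel (chart_map c) = density lborel (\<lambda>x. ennreal (\<rho>' x))"
  proof (rule measure_eqI)
    fix A assume "A \<in> sets (distr ?\<tau> borel (chart_map c))"
    then have A: "A \<in> sets borel" by simp
    define B where "B = chart_map c -` A \<inter> space ?\<tau>"
    have Bsub: "B \<subseteq> chart_dom c" by (auto simp: B_def space_restrict_space sp)
    have "B \<in> sets ?\<tau>" unfolding B_def using X A by (rule measurable_sets)
    then have B: "B \<in> sets borel"
      using dom st by (auto simp: sets_restrict_space)
    have im: "chart_map c ` B = A \<inter> chart_image c"
      using hom by (auto simp: B_def space_restrict_space sp chart_image_def)
    have "emeasure (distr ?\<tau> borel (chart_map c)) A = emeasure ?\<tau> B"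
      unfolding B_def by (rule emeasure_distr[OF X A])
    also have "\<dots> = emeasure \<tau> B"
      using dom sp Bsub by (intro emeasure_restrict_space) auto
    also have "\<dots> = (\<integral>\<^sup>+ x. ennreal (\<rho> x) * indicator (A \<inter> chart_image c) x \<partial>lborel)"
      using law[OF B Bsub] by (simp add: im)
    also have "\<dots> = (\<integral>\<^sup>+ x. ennreal (\<rho>' x) * indicator A x \<partial>lborel)"
      by (rule nn_integral_cong) (auto simp: \<rho>'_def indicator_def)
    also have "\<dots> = emeasure (density lborel (\<lambda>x. ennreal (\<rho>' x))) A"
      by (rule emeasure_density[symmetric]) (use \<rho>'m A in auto)
    finally show "emeasure (distr ?\<tau> borel (chart_map c)) A = emeasure (density lborel (\<lambda>x. ennreal (\<rho>' x))) A" .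
  qed simp
  have "(\<integral>\<theta>. indicator (chart_dom c) \<theta> * h (chart_map c \<theta>) \<partial>\<tau>) = (\<integral>\<theta>. h (chart_map c \<theta>) \<partial>?\<tau>)"
    using dom sp by (subst integral_restrict_space) auto
  also have "\<dots> = integral\<^sup>L (distr ?\<tau> borel (chart_map c)) h"
    by (rule integral_distr[symmetric, OF X h])
  also have "\<dots> = (\<integral>x. \<rho>' x *\<^sub>R h x \<partial>lborel)"
    unfolding eq by (rule integral_density) (use h \<rho>'m \<rho>'0 in auto)
  finally show ?thesis by (simp add: \<rho>'_def)
qed

text \<open>\<open>F\<close> splits into the constant \<open>F x\<close>, a linear term of average
  0, and a remainder bounded by \<open>b\<close>. Since \<open>l\<close> is arbitrary, the same
  estimate serves both orders.\<close>

lemma ball_average_taylor: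
  fixes F :: "'a::euclidean_space \<Rightarrow> real"
  assumes \<epsilon>: "0 < \<epsilon>" and cont: "continuous_on (cball x \<epsilon>) F" and l: "bounded_linear l"
    and bound: "\<And>y. y \<in> ball x \<epsilon> \<Longrightarrow> \<bar>F y - F x - l (y - x)\<bar> \<le> b"
  shows "\<bar>(\<integral>y. indicator (ball x \<epsilon>) y * F y \<partial>lborel) / measure lborel (ball x \<epsilon>) - F x\<bar> \<le> b"
proof -
  let ?B = "ball x \<epsilon>" and ?v = "measure lborel (ball x \<epsilon>)"
  have v: "0 < ?v" using content_ball_pos[OF \<epsilon>] by simp
  have int: "integrable lborel (\<lambda>y. indicator ?B y * f y)" if "continuous_on (cball x \<epsilon>) f" for f :: "'a \<Rightarrow> real"
  proof -
    have "integrable lborel (\<lambda>y. indicator (cball x \<epsilon>) y *\<^sub>R f y)"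
      by (rule borel_integrable_compact[OF compact_cball that])
    then have "integrable lborel (\<lambda>y. indicator ?B y *\<^sub>R (indicator (cball x \<epsilon>) y *\<^sub>R f y))"
      by (rule integrable_mult_indicator[rotated]) auto
    moreover have "(\<lambda>y. indicator ?B y *\<^sub>R (indicator (cball x \<epsilon>) y *\<^sub>R f y)) = (\<lambda>y. indicator ?B y * f y)"
      by (auto simp: indicator_def fun_eq_iff)
    ultimately show ?thesis by argo
  qed
  have cl: "continuous_on (cball x \<epsilon>) (\<lambda>y. l (y - x))"
    by (intro bounded_linear.continuous_on[OF l] continuous_intros)
  define e where "e y = F y - F x - l (y - x)" for y
  have ce: "continuous_on (cball x \<epsilon>) e" unfolding e_def by (intro continuous_intros cont cl)
  have one: "(\<integral>y. indicator ?B y * c \<partial>lborel) = c * ?v" for c :: real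
    by simp
  have "(\<integral>y. indicator ?B y * F y \<partial>lborel)
    = (\<integral>y. indicator ?B y * e y + indicator ?B y * F x + indicator ?B y * l (y - x) \<partial>lborel)"
    by (rule Bochner_Integration.integral_cong) (auto simp: e_def algebra_simps)
  also have "\<dots> = (\<integral>y. indicator ?B y * e y \<partial>lborel) + (\<integral>y. indicator ?B y * F x \<partial>lborel)
      + (\<integral>y. indicator ?B y * l (y - x) \<partial>lborel)"
    using int[OF ce] int[OF cl] int[of "\<lambda>_. F x"] by simp
  also have "\<dots> = (\<integral>y. indicator ?B y * e y \<partial>lborel) + F x * ?v"
    unfolding one integral_odd_ball[OF l] by simp
  finally have 1: "(\<integral>y. indicator ?B y * F y \<partial>lborel) = (\<integral>y. indicator ?B y * e y \<partial>lborel) + F x * ?v" .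
  have "\<bar>\<integral>y. indicator ?B y * e y \<partial>lborel\<bar> \<le> (\<integral>y. \<bar>indicator ?B y * e y\<bar> \<partial>lborel)"
    by (rule integral_abs_bound)
  also have "\<dots> \<le> (\<integral>y. indicator ?B y * b \<partial>lborel)"
  proof (rule integral_mono)
    show "integrable lborel (\<lambda>y. \<bar>indicator ?B y * e y\<bar>)" using int[OF ce] by simp
    show "integrable lborel (\<lambda>y. indicator ?B y * b)" by (rule int) simp
    show "\<bar>indicator ?B y * e y\<bar> \<le> indicator ?B y * b" for y
      using bound[of y] by (auto simp: indicator_def e_def)
  qed
  also have "\<dots> = b * ?v" by (rule one)
  finally have "\<bar>(\<integral>y. indicator ?B y * e y \<partial>lborel) / ?v\<bar> \<le> b" using v by (simp add: field_simps)
  then show ?thesis unfolding 1 using v by (simp add: add_divide_distrib)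
qed

text \<open>\<open>l = 0\<close> is used for \<open>p = 1\<close>, and the derivative for \<open>p = 2\<close>.\<close>

definition taylor_in_chart :: "('m, 'n::finite) metric_chart \<Rightarrow> ('m \<Rightarrow> 'h::real_normed_vector) \<Rightarrow> nat \<Rightarrow> real ^ 'n \<Rightarrow> real \<Rightarrow> real \<Rightarrow> bool" where
  "taylor_in_chart c \<Phi> p x0 r L \<longleftrightarrow>
    (\<forall>x\<in>ball x0 r. \<exists>l. bounded_linear l \<and>
      (\<forall>y\<in>ball x r. norm (\<Phi> (chart_inv c y) - \<Phi> (chart_inv c x) - l (y - x)) \<le> L * norm (y - x) ^ p))"

lemma smoothable_in_chart:
  fixes c :: "('m::topological_space, 'n::finite) metric_chart" and \<tau> :: "'m measure"
    and \<Phi> :: "'m \<Rightarrow> 'h::real_inner"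
  assumes st: "sets \<tau> = sets borel"
    and op: "open (chart_dom c)" "open (chart_image c)"
    and hom: "homeomorphism (chart_dom c) (chart_image c) (chart_map c) (chart_inv c)"
    and \<rho>: "continuous_on (chart_image c) \<rho>" "\<And>x. x \<in> chart_image c \<Longrightarrow> 0 < \<rho> x"
    and law: "\<And>B. B \<in> sets borel \<Longrightarrow> B \<subseteq> chart_dom c \<Longrightarrow>
      emeasure \<tau> B = (\<integral>\<^sup>+ x\<in>chart_map c ` B. ennreal (\<rho> x) \<partial>lborel)"
    and cont: "continuous_on UNIV \<Phi>"
    and r: "0 < r" "cball x0 (2 * r) \<subseteq> chart_image c" and L: "0 \<le> L"
    and taylor: "taylor_in_chart c \<Phi> p x0 r L"
  shows "smoothable \<tau> \<Phi> CARD('n) p {\<theta>\<in>chart_dom c. chart_map c \<theta> \<in> ball x0 r}"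
proof -
  let ?D = "chart_dom c" and ?X = "chart_map c" and ?I = "chart_inv c" and ?d = "CARD('n)"
  define U where "U = {\<theta>\<in>?D. ?X \<theta> \<in> ball x0 r}"
  have contI: "continuous_on (chart_image c) ?I" and contX: "continuous_on ?D ?X"
    and IX: "\<And>\<theta>. \<theta> \<in> ?D \<Longrightarrow> ?I (?X \<theta>) = \<theta>" and imX: "\<And>\<theta>. \<theta> \<in> ?D \<Longrightarrow> ?X \<theta> \<in> chart_image c"
    using hom by (auto simp: homeomorphism_def)
  have openU: "open U"
    using continuous_open_preimage[OF contX op(1), of "ball x0 r"] by (simp add: U_def vimage_def Int_def)
  \<comment> \<open>\<rho> may approach 0 near the edge of the chart image; its minimum on a compact
    ball keeps the height of the kernel of order \<open>1 / \<epsilon> ^ d\<close>.\<close>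
  have "\<exists>a>0. \<forall>x\<in>cball x0 (2 * r). a \<le> \<rho> x"
  proof -
    have "\<exists>x\<in>cball x0 (2 * r). \<forall>y\<in>cball x0 (2 * r). \<rho> x \<le> \<rho> y"
      using r by (intro continuous_attains_inf continuous_on_subset[OF \<rho>(1)]) auto
    then show ?thesis using \<rho>(2) r(2) by blast
  qed
  then obtain a where a: "0 < a" "\<And>x. x \<in> cball x0 (2 * r) \<Longrightarrow> a \<le> \<rho> x" by blast
  define v where "v = unit_ball_vol (real ?d)"
  have v: "0 < v" by (simp add: v_def)
  \<comment> \<open>\<open>1 / (v * a)\<close> bounds the height, \<open>L\<close> the Taylor error,
    and the 1 makes \<open>K\<close> positive.\<close>
  define K where "K = 1 / (v * a) + L + 1"
  have K: "0 < K" "1 / (v * a) \<le> K" "L \<le> K"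
    using v a(1) L by (auto simp: K_def intro!: add_nonneg_pos add_nonneg_nonneg)
  \<comment> \<open>Extended by a dummy value to be measurable on the whole manifold; the indicators
    in \<open>k\<close> suppress the points outside the domain.\<close>
  define X' where "X' \<theta> = (if \<theta> \<in> ?D then ?X \<theta> else x0)" for \<theta>
  have X'm [measurable]: "X' \<in> borel_measurable borel"
    unfolding X'_def by (rule chart_map_measurable[OF op(1) hom])
  define \<rho>' where "\<rho>' x = indicator (chart_image c) x * \<rho> x" for x
  have \<rho>'m [measurable]: "\<rho>' \<in> borel_measurable borel"
    using borel_measurable_continuous_on_indicator[OF _ \<rho>(1)] op unfolding \<rho>'_def by auto
  have Dm [measurable]: "?D \<in> sets borel" and Um [measurable]: "U \<in> sets borel" using op openU by auto
  have "\<exists>k. smoothing_kernel \<tau> \<Phi> U (K / \<epsilon> ^ ?d) (K * \<epsilon> ^ p) k" if \<epsilon>: "\<epsilon> \<in> {0<..<r}" for \<epsilon>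
  proof -
    have e: "0 < \<epsilon>" "\<epsilon> < r" using \<epsilon> by auto
    define q where "q = v * \<epsilon> ^ ?d"
    have q: "0 < q" using v e by (simp add: q_def)
    have ballq: "measure lborel (ball x \<epsilon>) = q" for x :: "real ^ 'n"
      using content_ball[of \<epsilon> x] e by (simp add: q_def v_def)
    \<comment> \<open>The factor \<open>1 / (q * \<rho>')\<close> cancels the density of \<tau> in
      the chart and divides by the Lebesgue measure \<open>q\<close> of the ball.\<close>
    define k where "k \<theta> \<theta>' = indicator ?D \<theta> * indicator U \<theta>' *
      (if dist (X' \<theta>) (X' \<theta>') < \<epsilon> then 1 / (q * \<rho>' (X' \<theta>)) else 0)" for \<theta> \<theta>'
    \<comment> \<open>Centres lie within \<open>r\<close> of \<open>x0\<close> and \<epsilon> is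
      below \<open>r\<close>: this is why a ball of radius \<open>2 * r\<close> is kept inside the
      chart.\<close>
    have sub: "y \<in> cball x0 (2 * r)" if "x \<in> ball x0 r" "y \<in> cball x \<epsilon>" for x y
      using that e dist_triangle[of x0 y x] by (simp add: dist_commute)
    have int: "(\<integral>\<theta>. k \<theta> \<theta>' * \<phi> \<theta> \<partial>\<tau>) = (\<integral>y. indicator (ball (?X \<theta>') \<epsilon>) y * \<phi> (?I y) \<partial>lborel) / q"
      if \<theta>': "\<theta>' \<in> U" and \<phi>: "continuous_on UNIV \<phi>" for \<theta>' and \<phi> :: "'m \<Rightarrow> real"
    proof -
      let ?x = "?X \<theta>'"
      have x: "\<theta>' \<in> ?D" "?x \<in> ball x0 r" "X' \<theta>' = ?x" using \<theta>' by (auto simp: U_def X'_def)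
      define h where "h y = indicator (ball ?x \<epsilon>) y * (1 / (q * \<rho>' y)) * (indicator (chart_image c) y * \<phi> (?I y))" for y
      have "continuous_on (chart_image c) (\<lambda>y. \<phi> (?I y))"
        by (rule continuous_on_compose2[OF \<phi> contI]) auto
      from borel_measurable_continuous_on_indicator[OF _ this] op(2)
      have [measurable]: "(\<lambda>y. indicator (chart_image c) y * \<phi> (?I y)) \<in> borel_measurable borel" by auto
      have [measurable]: "ball ?x \<epsilon> \<in> sets borel" by simp
      have h: "h \<in> borel_measurable borel" unfolding h_def by measurable
      have "(\<integral>\<theta>. k \<theta> \<theta>' * \<phi> \<theta> \<partial>\<tau>) = (\<integral>\<theta>. indicator ?D \<theta> * h (?X \<theta>) \<partial>\<tau>)"
        by (rule Bochner_Integration.integral_cong)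
          (use x \<theta>' in \<open>auto simp: k_def h_def X'_def IX imX indicator_def dist_commute\<close>)
      also have "\<dots> = (\<integral>y. indicator (chart_image c) y * \<rho> y * h y \<partial>lborel)"
        by (rule integral_in_chart[OF st op hom \<rho> law h])
      also have "\<dots> = (\<integral>y. indicator (ball ?x \<epsilon>) y * \<phi> (?I y) / q \<partial>lborel)"
      proof (rule Bochner_Integration.integral_cong)
        fix y
        show "indicator (chart_image c) y * \<rho> y * h y = indicator (ball ?x \<epsilon>) y * \<phi> (?I y) / q"
        proof (cases "y \<in> ball ?x \<epsilon>")
          case True
          then have "y \<in> chart_image c" using sub[OF x(2), of y] r(2) by auto
          then show ?thesis using \<rho>(2)[of y] by (simp add: h_def \<rho>'_def)
        qed (simp add: h_def)
      qed simp
      finally show ?thesis by simp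
    qed
    have "smoothing_kernel \<tau> \<Phi> U (K / \<epsilon> ^ ?d) (K * \<epsilon> ^ p) k"
      unfolding smoothing_kernel_def
    proof (intro conjI allI ballI)
      show "case_prod k \<in> borel_measurable (borel \<Otimes>\<^sub>M borel)"
        unfolding k_def by measurable
    next
      fix \<theta> \<theta>'
      show "0 \<le> k \<theta> \<theta>'"
        using \<rho>(2) q by (auto simp: k_def \<rho>'_def indicator_def intro!: divide_nonneg_nonneg less_imp_le)
      show "k \<theta> \<theta>' \<le> K / \<epsilon> ^ ?d"
      proof (cases "\<theta> \<in> ?D \<and> \<theta>' \<in> U \<and> dist (X' \<theta>) (X' \<theta>') < \<epsilon>")
        case True
        then have "X' \<theta> \<in> cball x0 (2 * r)"
          using sub[of "X' \<theta>'" "X' \<theta>"] by (auto simp: X'_def U_def dist_commute)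
        then have "a \<le> \<rho>' (X' \<theta>)" using a(2) r(2) by (auto simp: \<rho>'_def)
        then have "1 / (q * \<rho>' (X' \<theta>)) \<le> 1 / (q * a)"
          using a(1) q by (intro divide_left_mono mult_left_mono mult_pos_pos) auto
        also have "\<dots> = (1 / (v * a)) / \<epsilon> ^ ?d" by (simp add: q_def)
        also have "\<dots> \<le> K / \<epsilon> ^ ?d" using K(2) e by (intro divide_right_mono) auto
        finally show ?thesis using True by (simp add: k_def)
      next
        case False
        then have "k \<theta> \<theta>' = 0" by (auto simp: k_def)
        then show ?thesis using K(1) e by simp
      qed
    next
      fix \<theta>' assume \<theta>': "\<theta>' \<in> U"
      then have x: "\<theta>' \<in> ?D" "?X \<theta>' \<in> ball x0 r" by (auto simp: U_def)
      show "(\<integral>\<theta>. k \<theta> \<theta>' \<partial>\<tau>) = 1"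
        using int[OF \<theta>', of "\<lambda>_. 1"] q by (simp add: ballq)
      fix u
      obtain l where l: "bounded_linear l" "\<And>y. y \<in> ball (?X \<theta>') r \<Longrightarrow>
          norm (\<Phi> (?I y) - \<Phi> (?I (?X \<theta>')) - l (y - ?X \<theta>')) \<le> L * norm (y - ?X \<theta>') ^ p"
        using taylor x(2) unfolding taylor_in_chart_def by blast
      have "\<bar>(\<integral>y. indicator (ball (?X \<theta>') \<epsilon>) y * (\<Phi> (?I y) \<bullet> u) \<partial>lborel) / measure lborel (ball (?X \<theta>') \<epsilon>)
          - \<Phi> (?I (?X \<theta>')) \<bullet> u\<bar> \<le> K * \<epsilon> ^ p * norm u"
      proof (rule ball_average_taylor[OF e(1), where l="\<lambda>y. l y \<bullet> u"])
        have "cball (?X \<theta>') \<epsilon> \<subseteq> chart_image c" using sub[OF x(2)] r(2) by blast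
        then have "continuous_on (cball (?X \<theta>') \<epsilon>) ?I" by (rule continuous_on_subset[OF contI])
        then show "continuous_on (cball (?X \<theta>') \<epsilon>) (\<lambda>y. \<Phi> (?I y) \<bullet> u)"
          by (intro continuous_intros continuous_on_compose2[OF cont]) auto
        show "bounded_linear (\<lambda>y. l y \<bullet> u)"
          using bounded_linear_compose[OF bounded_linear_inner_left l(1)] by simp
        fix y assume y: "y \<in> ball (?X \<theta>') \<epsilon>"
        have "\<bar>\<Phi> (?I y) \<bullet> u - \<Phi> (?I (?X \<theta>')) \<bullet> u - l (y - ?X \<theta>') \<bullet> u\<bar>
          \<le> norm (\<Phi> (?I y) - \<Phi> (?I (?X \<theta>')) - l (y - ?X \<theta>')) * norm u"
          unfolding inner_diff_left[symmetric] by (rule Cauchy_Schwarz_ineq2)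
        also have "\<dots> \<le> (L * norm (y - ?X \<theta>') ^ p) * norm u"
          using l(2)[of y] y e by (intro mult_right_mono) auto
        also have "\<dots> \<le> (K * \<epsilon> ^ p) * norm u"
          using K L y e by (intro mult_right_mono mult_mono power_mono) (auto simp: dist_norm norm_minus_commute)
        finally show "\<bar>\<Phi> (?I y) \<bullet> u - \<Phi> (?I (?X \<theta>')) \<bullet> u - l (y - ?X \<theta>') \<bullet> u\<bar> \<le> K * \<epsilon> ^ p * norm u" .
      qed
      moreover have "continuous_on UNIV (\<lambda>\<theta>. \<Phi> \<theta> \<bullet> u)" by (intro continuous_intros cont)
      ultimately show "\<bar>(\<integral>\<theta>. k \<theta> \<theta>' * (\<Phi> \<theta> \<bullet> u) \<partial>\<tau>) - \<Phi> \<theta>' \<bullet> u\<bar> \<le> K * \<epsilon> ^ p * norm u"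
        using int[OF \<theta>', of "\<lambda>\<theta>. \<Phi> \<theta> \<bullet> u"] by (simp add: ballq IX[OF x(1)])
    qed
    then show ?thesis by blast
  qed
  then show ?thesis unfolding smoothable_def U_def[symmetric] using K(1) r(1) by blast
qed

section \<open>Riemannian volume and Taylor expansions in charts\<close>

lemma chart_ball_image:
  assumes "B \<subseteq> chart_image c"
  shows "chart_map c ` {\<theta>\<in>chart_dom c. chart_map c \<theta> \<in> B} = B"
  using assms by (auto simp: chart_image_def)

lemma open_chart_ball:
  fixes c :: "('m::topological_space, 'n::finite) metric_chart"
  assumes op: "open (chart_dom c)"
    and hom: "homeomorphism (chart_dom c) (chart_image c) (chart_map c) (chart_inv c)" and B: "open B"
  shows "open {\<theta>\<in>chart_dom c. chart_map c \<theta> \<in> B}"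
proof -
  have "continuous_on (chart_dom c) (chart_map c)" using hom by (simp add: homeomorphism_def)
  from continuous_open_preimage[OF this op B] show ?thesis by (simp add: vimage_def Int_def)
qed

lemma chart_ball_volume:
  fixes \<A> :: "('m::topological_space, 'n::finite) metric_chart set"
  assumes atlas: "riemannian_atlas \<A>" "c \<in> \<A>" and vol: "riemannian_volume \<A> vol"
    and r: "0 < r" "cball x0 r \<subseteq> chart_image c"
  defines "U \<equiv> {\<theta>\<in>chart_dom c. chart_map c \<theta> \<in> ball x0 r}"
  shows "0 < emeasure vol U" "emeasure vol U < \<infinity>"
proof -
  note ch = riemannian_atlas_chart[OF atlas]
  have sub: "ball x0 r \<subseteq> chart_image c" using r by auto
  have U: "U \<in> sets borel" "U \<subseteq> chart_dom c"
    using open_chart_ball[OF ch(1,3), of "ball x0 r"] by (auto simp: U_def)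
  have im: "chart_map c ` U = ball x0 r" unfolding U_def by (rule chart_ball_image[OF sub])
  have cont: "continuous_on (cball x0 r) (volume_density c)"
    by (rule continuous_on_subset[OF continuous_on_volume_density[OF atlas] r(2)])
  have ne: "cball x0 r \<noteq> {}" using r by simp
  obtain a where a: "a \<in> cball x0 r" "\<forall>y\<in>cball x0 r. volume_density c a \<le> volume_density c y"
    using continuous_attains_inf[OF compact_cball ne cont] by blast
  obtain b where b: "b \<in> cball x0 r" "\<forall>y\<in>cball x0 r. volume_density c y \<le> volume_density c b"
    using continuous_attains_sup[OF compact_cball ne cont] by blast
  have e: "emeasure vol U = (\<integral>\<^sup>+ x\<in>ball x0 r. ennreal (volume_density c x) \<partial>lborel)"
    using vol atlas(2) U im unfolding riemannian_volume_def by metis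
  have v: "0 < measure lborel (ball x0 r)" using content_ball_pos[OF r(1)] by simp
  have ev: "emeasure lborel (ball x0 r) = ennreal (measure lborel (ball x0 r))"
    by (intro emeasure_eq_ennreal_measure) (use emeasure_lborel_ball_finite in \<open>auto simp: less_top[symmetric]\<close>)
  have "0 < ennreal (volume_density c a) * emeasure lborel (ball x0 r)"
    unfolding ev using v volume_density_pos[OF atlas, of a] a(1) r(2) by (auto simp: ennreal_zero_less_mult_iff)
  also have "\<dots> = (\<integral>\<^sup>+ x\<in>ball x0 r. ennreal (volume_density c a) \<partial>lborel)"
    by (rule nn_integral_cmult_indicator[symmetric]) simp
  also have "\<dots> \<le> emeasure vol U"
    unfolding e using a(2) by (intro nn_integral_mono) (auto simp: indicator_def intro!: ennreal_leI)
  finally show "0 < emeasure vol U" .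
  have "emeasure vol U \<le> (\<integral>\<^sup>+ x\<in>ball x0 r. ennreal (volume_density c b) \<partial>lborel)"
    unfolding e using b(2) by (intro nn_integral_mono) (auto simp: indicator_def intro!: ennreal_leI)
  also have "\<dots> = ennreal (volume_density c b) * emeasure lborel (ball x0 r)"
    by (rule nn_integral_cmult_indicator) simp
  also have "\<dots> < \<infinity>" unfolding ev by (simp add: ennreal_mult_less_top)
  finally show "emeasure vol U < \<infinity>" .
qed

lemma atlas_point:
  assumes "riemannian_atlas \<A>"
  obtains c where "c \<in> \<A>" "\<theta> \<in> chart_dom c" "chart_map c \<theta> \<in> chart_image c"
  using assms unfolding riemannian_atlas_def chart_image_def by blast

text \<open>\<open>uniform_measure\<close> is a probability measure only if the total volume is
  neither 0 nor infinite. Chart balls have both properties, and finitely many of them cover the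
  manifold.\<close>

lemma riemannian_volume_pos_finite:
  fixes \<A> :: "('m::topological_space, 'n::finite) metric_chart set"
  assumes compact: "compact (UNIV :: 'm set)"
    and atlas: "riemannian_atlas \<A>" and vol: "riemannian_volume \<A> vol"
  shows "0 < emeasure vol UNIV" "emeasure vol UNIV < \<infinity>"
proof -
  have sv: "sets vol = sets borel" using vol by (simp add: riemannian_volume_def)
  have loc: "\<exists>U. open U \<and> \<theta> \<in> U \<and> 0 < emeasure vol U \<and> emeasure vol U < \<infinity>" for \<theta>
  proof -
    obtain c where c: "c \<in> \<A>" "\<theta> \<in> chart_dom c" "chart_map c \<theta> \<in> chart_image c"
      using atlas_point[OF atlas] .
    note ch = riemannian_atlas_chart[OF atlas c(1)]
    obtain r where r: "0 < r" "cball (chart_map c \<theta>) r \<subseteq> chart_image c"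
      using ch(2) c(3) open_contains_cball by blast
    let ?U = "{\<theta>'\<in>chart_dom c. chart_map c \<theta>' \<in> ball (chart_map c \<theta>) r}"
    have "open ?U" by (rule open_chart_ball[OF ch(1,3)]) simp
    moreover have "\<theta> \<in> ?U" using c r by simp
    ultimately show ?thesis using chart_ball_volume[OF atlas c(1) vol r] by blast
  qed
  obtain U where "open U" "0 < emeasure vol U" using loc by blast
  then show "0 < emeasure vol UNIV"
    using emeasure_mono[of U UNIV vol] sv by (auto intro: less_le_trans)
  let ?C = "{U. open U \<and> emeasure vol U < \<infinity>}"
  have cover: "UNIV \<subseteq> \<Union>?C" using loc by auto
  obtain D where D: "D \<subseteq> ?C" "finite D" "UNIV \<subseteq> \<Union>D"
    by (rule compactE[OF compact cover]) blast+
  have "emeasure vol (\<Union>U\<in>D. U) \<le> (\<Sum>U\<in>D. emeasure vol U)"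
    by (rule emeasure_subadditive_finite[OF D(2)]) (use D(1) sv in auto)
  also have "\<dots> < \<infinity>" using D(1,2) by (auto simp: less_top)
  finally show "emeasure vol UNIV < \<infinity>" using D(3) by (simp add: top.extremum_unique)
qed

text \<open>The mean value inequality on the segment from \<open>x\<close> to \<open>y\<close>,
  linearised at \<open>x\<close>: there the derivative deviates from \<open>D x\<close> by at most
  \<open>L * norm (y - x)\<close>.\<close>

lemma lipschitz_derivative_taylor:
  fixes \<Phi> :: "'m::topological_space \<Rightarrow> 'h::real_normed_vector"
    and \<A> :: "('m, 'n::finite) metric_chart set"
  assumes lip: "lipschitz_derivative \<A> \<Phi>" and c: "c \<in> \<A>"
    and x0: "x0 \<in> chart_image c" and op: "open (chart_image c)"
  shows "\<exists>r>0. cball x0 (2 * r) \<subseteq> chart_image c \<and> (\<exists>L\<ge>0. taylor_in_chart c \<Phi> 2 x0 r L)"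
proof -
  obtain D where D: "\<forall>x\<in>chart_image c. ((\<Phi> \<circ> chart_inv c) has_derivative blinfun_apply (D x)) (at x)"
    "\<forall>x\<in>chart_image c. \<exists>r>0. \<exists>L. L-lipschitz_on (ball x r \<inter> chart_image c) D"
    using lip c unfolding lipschitz_derivative_def by blast
  obtain r1 L where r1: "0 < r1" "L-lipschitz_on (ball x0 r1 \<inter> chart_image c) D" using D(2) x0 by blast
  obtain r2 where r2: "0 < r2" "cball x0 r2 \<subseteq> chart_image c" using op x0 open_contains_cball by blast
  \<comment> \<open>Halving keeps \<open>ball x r\<close> inside \<open>ball x0 (2 * r)\<close> for
    every \<open>x\<close> in \<open>ball x0 r\<close>, hence the whole segment in the region where
    \<open>D\<close> is Lipschitz.\<close>
  define r where "r = min r1 r2 / 2"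
  have r: "0 < r" "cball x0 (2 * r) \<subseteq> chart_image c" "2 * r \<le> r1" "2 * r \<le> r2" using r1 r2 by (auto simp: r_def)
  have L: "0 \<le> L" using r1(2) by (rule lipschitz_on_nonneg)
  have "taylor_in_chart c \<Phi> 2 x0 r L"
    unfolding taylor_in_chart_def
  proof (intro ballI)
    fix x assume x: "x \<in> ball x0 r"
    have "norm (\<Phi> (chart_inv c y) - \<Phi> (chart_inv c x) - D x (y - x)) \<le> L * norm (y - x) ^ 2"
      if y: "y \<in> ball x r" for y
    proof -
      let ?S = "closed_segment x y"
      have "y \<in> ball x0 (2 * r)" "x \<in> ball x0 (2 * r)"
        using x y dist_triangle[of x0 y x] r(1) by auto
      then have "?S \<subseteq> ball x0 (2 * r)" by (intro closed_segment_subset convex_ball)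
      moreover have "ball x0 (2 * r) \<subseteq> ball x0 r1 \<inter> chart_image c" using r by auto
      ultimately have S: "?S \<subseteq> ball x0 r1 \<inter> chart_image c" by blast
      have "norm ((\<Phi> \<circ> chart_inv c) y - (\<Phi> \<circ> chart_inv c) x - D x (y - x)) \<le> norm (y - x) * (L * norm (y - x))"
      proof (rule differentiable_bound_linearization[where S="?S"])
        show "x + t *\<^sub>R (y - x) \<in> ?S" if "t \<in> {0..1}" for t
          using that unfolding closed_segment_def by (auto intro!: exI[of _ t] simp: algebra_simps)
        show "((\<Phi> \<circ> chart_inv c) has_derivative D z) (at z within ?S)" if "z \<in> ?S" for z
          using D(1) S that by (auto intro: has_derivative_at_withinI)
        show "x \<in> ?S" by simp
        fix z assume z: "z \<in> ?S"
        have "onorm (\<lambda>h. D z h - D x h) = norm (D z - D x)"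
          by (simp add: norm_blinfun.rep_eq blinfun.bilinear_simps(1)[symmetric] minus_blinfun.rep_eq)
        also have "\<dots> \<le> L * norm (z - x)"
          using lipschitz_onD[OF r1(2) subsetD[OF S z] subsetD[OF S ends_in_segment(1)]] by (simp add: dist_norm)
        also have "norm (z - x) \<le> norm (y - x)"
          using segment_bound(1)[OF z] by (simp add: norm_minus_commute)
        finally show "onorm (blinfun_apply (D z) - blinfun_apply (D x)) \<le> L * norm (y - x)"
          using L by (simp add: mult_left_mono fun_diff_def)
      qed
      then show ?thesis by (simp add: power2_eq_square algebra_simps)
    qed
    then show "\<exists>l. bounded_linear l \<and>
      (\<forall>y\<in>ball x r. norm (\<Phi> (chart_inv c y) - \<Phi> (chart_inv c x) - l (y - x)) \<le> L * norm (y - x) ^ 2)"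
      by (intro exI[of _ "blinfun_apply (D x)"]) (auto intro: blinfun.bounded_linear_right)
  qed
  then show ?thesis using r L by blast
qed

section \<open>Geodesic distance against coordinate distance\<close>

lemma smooth_onD:
  assumes "smooth_on f S" "x \<in> S"
  shows "(f has_derivative frechet_derivative f (at x)) (at x)"
    and "continuous_on S (\<lambda>x. frechet_derivative f (at x) v)"
proof -
  have "Ck_on 1 f S" using assms(1) unfolding smooth_on_def by blast
  then show "(f has_derivative frechet_derivative f (at x)) (at x)"
    "continuous_on S (\<lambda>x. frechet_derivative f (at x) v)"
    using assms(2) frechet_derivative_works[of f "at x"] by auto
qed

text \<open>The coordinate segment, carried to the manifold, is a competitor of length at most
  \<open>G * norm (y - x)\<close>. The work lies in the other charts: regularity is demanded in
  every chart that the curve meets, and its speed is read in an unspecified one.\<close>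

lemma geodesic_dist_segment:
  fixes \<A> :: "('m::topological_space, 'n::finite) metric_chart set"
  assumes atlas: "riemannian_atlas \<A>" "c \<in> \<A>" and sub: "ball x0 s \<subseteq> chart_image c"
    and xy: "x \<in> ball x0 s" "y \<in> ball x0 s"
    and G: "0 \<le> G" "\<And>z u. z \<in> ball x0 s \<Longrightarrow> chart_metric c z u u \<le> (G * norm u)\<^sup>2"
  shows "geodesic_dist \<A> (chart_inv c x) (chart_inv c y) \<le> ennreal (G * norm (y - x))"
proof -
  note ch = riemannian_atlas_chart[OF atlas]
  define w where "w = y - x"
  define \<sigma> where "\<sigma> t = x + t *\<^sub>R w" for t :: real
  define \<gamma> where "\<gamma> t = chart_inv c (\<sigma> t)" for t
  have \<sigma>s: "\<sigma> t \<in> ball x0 s" if "t \<in> {0..1}" for t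
  proof -
    have "(1 - t) *\<^sub>R x + t *\<^sub>R y \<in> ball x0 s" using convexD[OF convex_ball xy, of "1 - t" t] that by auto
    then show ?thesis by (simp add: \<sigma>_def w_def algebra_simps)
  qed
  have \<sigma>im: "\<sigma> t \<in> chart_image c" if "t \<in> {0..1}" for t using \<sigma>s[OF that] sub by blast
  have cont\<sigma>: "continuous_on S \<sigma>" for S unfolding \<sigma>_def by (intro continuous_intros)
  have d\<sigma>: "(\<sigma> has_vector_derivative w) (at t)" for t
    unfolding \<sigma>_def by (auto intro!: derivative_eq_intros)
  have Xinv: "chart_map c (chart_inv c z) = z" "chart_inv c z \<in> chart_dom c" if "z \<in> chart_image c" for z
    using ch(3) that by (auto simp: homeomorphism_def)
  define W where "W c' = chart_map c ` (chart_dom c \<inter> chart_dom c')" for c' :: "('m, 'n) metric_chart"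
  define T where "T c' = chart_map c' \<circ> chart_inv c" for c' :: "('m, 'n) metric_chart"
  have W: "z \<in> W c' \<longleftrightarrow> z \<in> chart_image c \<and> chart_inv c z \<in> chart_dom c'" for z c'
  proof
    assume "z \<in> W c'"
    then obtain \<theta> where "\<theta> \<in> chart_dom c" "\<theta> \<in> chart_dom c'" "z = chart_map c \<theta>"
      unfolding W_def by blast
    moreover have "chart_inv c (chart_map c \<theta>) = \<theta>" "chart_map c \<theta> \<in> chart_image c"
      using ch(3) \<open>\<theta> \<in> chart_dom c\<close> by (auto simp: homeomorphism_def)
    ultimately show "z \<in> chart_image c \<and> chart_inv c z \<in> chart_dom c'" by simp
  next
    assume "z \<in> chart_image c \<and> chart_inv c z \<in> chart_dom c'"
    then show "z \<in> W c'"
      unfolding W_def using Xinv[of z] by (intro image_eqI[of _ _ "chart_inv c z"]) auto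
  qed
  have openW: "open (W c')" if "c' \<in> \<A>" for c'
  proof -
    have "continuous_on (chart_image c) (chart_inv c)" using ch(3) by (simp add: homeomorphism_def)
    from continuous_open_preimage[OF this ch(2), of "chart_dom c'"] riemannian_atlas_chart(1)[OF atlas(1) that]
    have "open (chart_image c \<inter> chart_inv c -` chart_dom c')" by blast
    moreover have "W c' = chart_image c \<inter> chart_inv c -` chart_dom c'" using W by auto
    ultimately show ?thesis by simp
  qed
  have comp: "smooth_on (T c') (W c')"
    "\<And>z u v. z \<in> W c' \<Longrightarrow> chart_metric c z u v = chart_metric c' (T c' z)
       (frechet_derivative (T c') (at z) u) (frechet_derivative (T c') (at z) v)"
    if "c' \<in> \<A>" for c'
    using atlas that unfolding riemannian_atlas_def charts_compatible_def Let_def W_def T_def by blast+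
  \<comment> \<open>\<sigma> is defined on the whole line and \<open>O' c'\<close> is open there, so
    the two-sided derivatives exist even at the endpoints 0 and 1.\<close>
  define O' where "O' c' = \<sigma> -` W c'" for c' :: "('m, 'n) metric_chart"
  have openO: "open (O' c')" if "c' \<in> \<A>" for c'
    unfolding O'_def using continuous_open_vimage openW[OF that] cont\<sigma>[of UNIV] by (simp add: continuous_on_open_vimage)
  have dT: "((chart_map c' \<circ> \<gamma>) has_vector_derivative frechet_derivative (T c') (at (\<sigma> t)) w) (at t)"
    if c': "c' \<in> \<A>" and t: "t \<in> O' c'" for c' t
  proof -
    have "((T c' \<circ> \<sigma>) has_derivative frechet_derivative (T c') (at (\<sigma> t)) \<circ> (\<lambda>h. h *\<^sub>R w)) (at t)"
      using smooth_onD(1)[OF comp(1)[OF c'], of "\<sigma> t"] t d\<sigma>[of t]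
      by (intro diff_chain_at) (auto simp: O'_def has_vector_derivative_def)
    moreover have "frechet_derivative (T c') (at (\<sigma> t)) (h *\<^sub>R w) = h *\<^sub>R frechet_derivative (T c') (at (\<sigma> t)) w" for h
      using smooth_onD(1)[OF comp(1)[OF c'], of "\<sigma> t"] t
      by (auto simp: O'_def dest!: has_derivative_linear intro: linear_cmul)
    moreover have "T c' \<circ> \<sigma> = chart_map c' \<circ> \<gamma>" by (auto simp: T_def \<gamma>_def)
    ultimately show ?thesis by (simp add: has_vector_derivative_def o_def)
  qed
  have tO: "t \<in> O' c'" if "t \<in> {0..1}" "\<gamma> t \<in> chart_dom c'" for t c'
    using that \<sigma>im[of t] W[of "\<sigma> t" c'] by (auto simp: O'_def \<gamma>_def)
  have pw: "pw_C1_curve \<A> \<gamma>"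
    unfolding pw_C1_curve_def
  proof (intro conjI ballI impI)
    have "continuous_on (chart_image c) (chart_inv c)" using ch(3) by (simp add: homeomorphism_def)
    then show "continuous_on {0..1} \<gamma>"
      unfolding \<gamma>_def by (rule continuous_on_compose2[OF _ cont\<sigma>]) (use \<sigma>im in auto)
    fix t c' assume t: "t \<in> {0..1}" and c': "c' \<in> \<A>" and d: "\<gamma> t \<in> chart_dom c'"
    have "t \<in> O' c'" using tO t d by blast
    then obtain \<delta> where \<delta>: "0 < \<delta>" "cball t \<delta> \<subseteq> O' c'" using openO[OF c'] open_contains_cball by blast
    let ?J = "{t - \<delta>..t + \<delta>} \<inter> {0..1}"
    have J: "?J \<subseteq> O' c'" using \<delta>(2) by (auto simp: cball_eq_atLeastAtMost)
    have "\<gamma> ` ?J \<subseteq> chart_dom c'" using J W by (auto simp: O'_def \<gamma>_def)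
    moreover have "(chart_map c' \<circ> \<gamma>) C1_differentiable_on ?J"
      unfolding C1_differentiable_on_def
    proof (intro exI[of _ "\<lambda>t. frechet_derivative (T c') (at (\<sigma> t)) w"] conjI ballI)
      show "((chart_map c' \<circ> \<gamma>) has_vector_derivative frechet_derivative (T c') (at (\<sigma> u)) w) (at u)"
        if "u \<in> ?J" for u using dT[OF c'] that J by blast
      have "\<sigma> t \<in> W c'" using \<open>t \<in> O' c'\<close> by (simp add: O'_def)
      from smooth_onD(2)[OF comp(1)[OF c'] this, of w]
      show "continuous_on ?J (\<lambda>t. frechet_derivative (T c') (at (\<sigma> t)) w)"
        by (rule continuous_on_compose2[OF _ cont\<sigma>]) (use J in \<open>auto simp: O'_def\<close>)
    qed
    ultimately show "\<exists>\<delta>>0. \<gamma> ` ({t - \<delta>..t + \<delta>} \<inter> {0..1}) \<subseteq> chart_dom c' \<and>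
      (chart_map c' \<circ> \<gamma>) piecewise_C1_differentiable_on ({t - \<delta>..t + \<delta>} \<inter> {0..1})"
      using \<delta>(1) C1_differentiable_imp_piecewise by blast
  qed
  \<comment> \<open>The chart picked by \<open>SOME\<close> may differ from \<open>c\<close>;
    compatibility makes the transition map an isometry of the metric tensors, so the speed equals
    the one in \<open>c\<close>.\<close>
  have speed: "curve_speed \<A> \<gamma> t \<le> G * norm w" if t: "t \<in> {0..1}" for t
  proof -
    define c' where "c' = (SOME c. c \<in> \<A> \<and> \<gamma> t \<in> chart_dom c)"
    have "c \<in> \<A> \<and> \<gamma> t \<in> chart_dom c" using atlas(2) Xinv(2)[OF \<sigma>im[OF t]] by (simp add: \<gamma>_def)
    then have c': "c' \<in> \<A>" "\<gamma> t \<in> chart_dom c'" unfolding c'_def by (metis (mono_tags, lifting) someI)+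
    have O: "t \<in> O' c'" using tO[OF t c'(2)] .
    let ?v = "vector_derivative (chart_map c' \<circ> \<gamma>) (at t)"
    have v: "?v = frechet_derivative (T c') (at (\<sigma> t)) w"
      by (rule vector_derivative_at[OF dT[OF c'(1) O]])
    have "chart_metric c' (chart_map c' (\<gamma> t)) ?v ?v = chart_metric c (\<sigma> t) w w"
      unfolding v using comp(2)[OF c'(1), of "\<sigma> t" w w] O by (simp add: O'_def T_def \<gamma>_def)
    also have "\<dots> \<le> (G * norm w)\<^sup>2" by (rule G(2)[OF \<sigma>s[OF t]])
    finally have "sqrt (chart_metric c' (chart_map c' (\<gamma> t)) ?v ?v) \<le> G * norm w"
      using G(1) by (intro real_le_lsqrt) auto
    then show ?thesis unfolding curve_speed_def Let_def c'_def[symmetric] .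
  qed
  have ends: "\<gamma> 0 = chart_inv c x" "\<gamma> 1 = chart_inv c y" by (simp_all add: \<gamma>_def \<sigma>_def w_def)
  have "geodesic_dist \<A> (chart_inv c x) (chart_inv c y) \<le> curve_length \<A> \<gamma>"
    unfolding geodesic_dist_def by (rule INF_lower) (use pw ends in simp)
  also have "\<dots> \<le> (\<integral>\<^sup>+ t\<in>{0..1::real}. ennreal (G * norm w) \<partial>lborel)"
    unfolding curve_length_def
    using speed by (intro nn_integral_mono) (auto simp: indicator_def intro!: ennreal_leI)
  also have "\<dots> = ennreal (G * norm w)"
    by (subst nn_integral_cmult_indicator) auto
  finally show ?thesis unfolding w_def .
qed

text \<open>Both points lie in one coordinate ball on which the metric is bounded by
  \<open>G\<close>; there the coordinate distance controls the geodesic one, and the constant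
  becomes \<open>L * G\<close>.\<close>

lemma lipschitz_geodesic_taylor:
  fixes \<Phi> :: "'m::topological_space \<Rightarrow> 'h::real_normed_vector"
    and \<A> :: "('m, 'n::finite) metric_chart set"
  assumes lip: "lipschitz_geodesic \<A> \<Phi>" and atlas: "riemannian_atlas \<A>" "c \<in> \<A>"
    and x0: "x0 \<in> chart_image c"
  shows "\<exists>r>0. cball x0 (2 * r) \<subseteq> chart_image c \<and> (\<exists>L\<ge>0. taylor_in_chart c \<Phi> 1 x0 r L)"
proof -
  obtain L where L: "0 \<le> L" "\<And>x y. ennreal (norm (\<Phi> x - \<Phi> y)) \<le> ennreal L * geodesic_dist \<A> x y"
    using lip unfolding lipschitz_geodesic_def by blast
  obtain r2 where r2: "0 < r2" "cball x0 r2 \<subseteq> chart_image c"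
    using riemannian_atlas_chart(2)[OF atlas] x0 open_contains_cball by blast
  obtain G where G: "0 \<le> G" "\<And>z u. z \<in> cball x0 r2 \<Longrightarrow> chart_metric c z u u \<le> (G * norm u)\<^sup>2"
    using metric_bound_compact[OF atlas compact_cball r2(2)] by blast
  define r where "r = r2 / 2"
  have r: "0 < r" "2 * r = r2" using r2 by (auto simp: r_def)
  have "taylor_in_chart c \<Phi> 1 x0 r (L * G)"
    unfolding taylor_in_chart_def
  proof (intro ballI exI[of _ "\<lambda>_. 0"] conjI bounded_linear_zero)
    fix x y assume x: "x \<in> ball x0 r" and y: "y \<in> ball x r"
    have xy: "x \<in> ball x0 r2" "y \<in> ball x0 r2"
      using x y dist_triangle[of x0 y x] r by auto
    have "geodesic_dist \<A> (chart_inv c y) (chart_inv c x) \<le> ennreal (G * norm (x - y))"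
      by (rule geodesic_dist_segment[OF atlas _ xy(2,1) G(1)]) (use r2 G(2) in auto)
    then have "ennreal (norm (\<Phi> (chart_inv c y) - \<Phi> (chart_inv c x))) \<le> ennreal L * ennreal (G * norm (x - y))"
      using L(2) by (meson mult_left_mono order_trans zero_le)
    also have "\<dots> = ennreal (L * (G * norm (x - y)))" using L G by (simp add: ennreal_mult)
    finally show "norm (\<Phi> (chart_inv c y) - \<Phi> (chart_inv c x) - 0) \<le> L * G * norm (y - x) ^ 1"
      using L G by (simp add: ennreal_le_iff norm_minus_commute mult.assoc)
  qed
  then show ?thesis using r r2 L(1) G(1) by (metis mult_nonneg_nonneg)
qed

lemma smoothable_of_taylor:
  fixes \<A> :: "('m::topological_space, 'n::finite) metric_chart set"
    and \<Phi> :: "'m \<Rightarrow> 'h::real_inner"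
  assumes compact: "compact (UNIV :: 'm set)"
    and atlas: "riemannian_atlas \<A>" and vol: "riemannian_volume \<A> vol"
    and tau: "\<tau> = uniform_measure vol UNIV" and cont: "continuous_on UNIV \<Phi>"
    and taylor: "\<And>c x0. c \<in> \<A> \<Longrightarrow> x0 \<in> chart_image c \<Longrightarrow>
      \<exists>r>0. cball x0 (2 * r) \<subseteq> chart_image c \<and> (\<exists>L\<ge>0. taylor_in_chart c \<Phi> p x0 r L)"
  shows "smoothable \<tau> \<Phi> CARD('n) p UNIV"
proof (rule smoothable_compact[OF compact])
  fix \<theta> :: 'm
  have sv: "sets vol = sets borel" using vol by (simp add: riemannian_volume_def)
  have st: "sets \<tau> = sets borel" using sv by (simp add: tau)
  obtain Z where Z: "0 < Z" "emeasure vol UNIV = ennreal Z"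
    using riemannian_volume_pos_finite[OF compact atlas vol]
    by (cases "emeasure vol UNIV") auto
  obtain c where c: "c \<in> \<A>" "\<theta> \<in> chart_dom c" "chart_map c \<theta> \<in> chart_image c"
    using atlas_point[OF atlas] .
  note ch = riemannian_atlas_chart[OF atlas c(1)]
  obtain r L where r: "0 < r" "cball (chart_map c \<theta>) (2 * r) \<subseteq> chart_image c"
    and L: "0 \<le> L" "taylor_in_chart c \<Phi> p (chart_map c \<theta>) r L"
    using taylor[OF c(1,3)] by blast
  let ?U = "{\<theta>'\<in>chart_dom c. chart_map c \<theta>' \<in> ball (chart_map c \<theta>) r}"
  have "smoothable \<tau> \<Phi> CARD('n) p ?U"
  proof (rule smoothable_in_chart[OF st ch(1-3) _ _ _ cont r L])
    show "continuous_on (chart_image c) (\<lambda>x. volume_density c x / Z)"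
      using Z by (intro continuous_intros continuous_on_volume_density[OF atlas c(1)]) auto
    show "0 < volume_density c x / Z" if "x \<in> chart_image c" for x
      using volume_density_pos[OF atlas c(1) that] Z by simp
    fix B :: "'m set" assume B: "B \<in> sets borel" "B \<subseteq> chart_dom c"
    \<comment> \<open>An image under the chart is a preimage under its inverse, hence Borel; the
      integrand below contains its indicator.\<close>
    have im: "chart_map c ` B \<in> sets borel"
    proof -
      have "chart_map c ` B = (\<lambda>x. if x \<in> chart_image c then chart_inv c x else \<theta>) -` B \<inter> chart_image c"
        using ch(3) B(2) by (force simp: homeomorphism_def)
      moreover have "(\<lambda>x. if x \<in> chart_image c then chart_inv c x else \<theta>) \<in> borel_measurable borel"
        using ch(2,3) by (intro borel_measurable_continuous_on_if) (auto simp: homeomorphism_def)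
      ultimately show ?thesis using B(1) ch(2) measurable_sets[of _ borel borel B] by (auto intro!: sets.Int)
    qed
    have contd: "continuous_on (chart_image c) (volume_density c)"
      by (rule continuous_on_volume_density[OF atlas c(1)])
    have "chart_map c ` B \<subseteq> chart_image c" using B(2) by (auto simp: chart_image_def)
    have "emeasure \<tau> B = emeasure vol B / ennreal Z"
      unfolding tau using B sv Z by (subst emeasure_uniform_measure) auto
    also have "emeasure vol B = (\<integral>\<^sup>+ x\<in>chart_map c ` B. ennreal (volume_density c x) \<partial>lborel)"
      using vol c(1) B unfolding riemannian_volume_def by blast
    also have "\<dots> / ennreal Z = (\<integral>\<^sup>+ x. ennreal (volume_density c x) * indicator (chart_map c ` B) x / ennreal Z \<partial>lborel)"
    proof (rule nn_integral_divide[symmetric])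
      \<comment> \<open>\<open>volume_density c\<close> is known to be continuous on the chart image
        alone, so it is cut off there before measurability is claimed.\<close>
      have "(\<lambda>x. indicator (chart_image c) x *\<^sub>R volume_density c x) \<in> borel_measurable borel"
        using borel_measurable_continuous_on_indicator[OF _ contd] ch(2) by auto
      then have "(\<lambda>x. ennreal (indicator (chart_image c) x *\<^sub>R volume_density c x) * indicator (chart_map c ` B) x) \<in> borel_measurable lborel"
        using im by measurable
      moreover have "(\<lambda>x. ennreal (indicator (chart_image c) x *\<^sub>R volume_density c x) * indicator (chart_map c ` B) x)
        = (\<lambda>x. ennreal (volume_density c x) * indicator (chart_map c ` B) x)"
        using \<open>chart_map c ` B \<subseteq> chart_image c\<close> by (auto simp: fun_eq_iff indicator_def)
      ultimately show "(\<lambda>x. ennreal (volume_density c x) * indicator (chart_map c ` B) x) \<in> borel_measurable lborel"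
        by simp
    qed
    also have "\<dots> = (\<integral>\<^sup>+ x\<in>chart_map c ` B. ennreal (volume_density c x / Z) \<partial>lborel)"
    proof (rule nn_integral_cong)
      fix x
      show "ennreal (volume_density c x) * indicator (chart_map c ` B) x / ennreal Z
        = ennreal (volume_density c x / Z) * indicator (chart_map c ` B) x"
      proof (cases "x \<in> chart_map c ` B")
        case True
        then have "0 \<le> volume_density c x"
          using \<open>chart_map c ` B \<subseteq> chart_image c\<close> volume_density_pos[OF atlas c(1), of x] by auto
        then show ?thesis using True Z by (simp add: divide_ennreal)
      qed simp
    qed
    finally show "emeasure \<tau> B = (\<integral>\<^sup>+ x\<in>chart_map c ` B. ennreal (volume_density c x / Z) \<partial>lborel)" .
  qed
  moreover have "open ?U" by (rule open_chart_ball[OF ch(1,3)]) simp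
  moreover have "\<theta> \<in> ?U" using c r by simp
  ultimately show "\<exists>U. open U \<and> \<theta> \<in> U \<and> smoothable \<tau> \<Phi> CARD('n) p U" by blast
qed

theorem theorem4p1:
  fixes \<A> :: "('m::{second_countable_topology,t2_space}, 'n::finite) metric_chart set"
    and vol \<tau> :: "'m measure"
    and \<Phi> :: "'m \<Rightarrow> 'h::{real_inner,complete_space}"
    and R :: "'h \<Rightarrow> real" and gradR :: "'h \<Rightarrow> 'h"
    and hs :: "(('m set \<Rightarrow> real) \<Rightarrow> ereal) list"
    and \<eta> :: "real \<Rightarrow> ereal" and f0 :: "'m \<Rightarrow> real"
    and \<mu>s :: "'m set \<Rightarrow> real"
  assumes compact: "compact (UNIV :: 'm set)"
    and atlas: "riemannian_atlas \<A>"
    and vol: "riemannian_volume \<A> vol"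
    and tau: "\<tau> = uniform_measure vol UNIV"
    and A1: "assumption_A1 R gradR \<Phi> hs"
    and A2: "assumption_A2 \<eta>"
    and f0_meas: "f0 \<in> borel_measurable \<tau>"
    and f0_dom: "AE \<theta> in \<tau>. f0 \<theta> \<in> interior (edom \<eta>)"
    and f0_bounded: "\<exists>B. AE \<theta> in \<tau>. \<bar>ederiv \<eta> (f0 \<theta>)\<bar> \<le> B"
    and mu_signed: "signed_borel_measure \<mu>s"
    and mu_min: "F_bar R \<Phi> hs \<mu>s = inf_F R \<Phi> hs \<tau>"
    and mu_nonneg: "assumption_A2_plus \<eta> \<Longrightarrow> nonneg_on_borel \<mu>s"
  shows "(lipschitz_geodesic \<A> \<Phi> \<longrightarrow>
            rate_bound \<eta> CARD('n) (psi R \<Phi> hs \<tau> \<eta> f0) 1) \<and>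
         ((lipschitz_geodesic \<A> \<Phi> \<and> (\<forall>\<theta>. G_bar_deriv gradR \<Phi> \<mu>s \<theta> = 0))
            \<or> lipschitz_derivative \<A> \<Phi> \<longrightarrow>
            rate_bound \<eta> CARD('n) (psi R \<Phi> hs \<tau> \<eta> f0) 2) \<and>
         (lipschitz_derivative \<A> \<Phi> \<and> (\<forall>\<theta>. G_bar_deriv gradR \<Phi> \<mu>s \<theta> = 0) \<longrightarrow>
            rate_bound \<eta> CARD('n) (psi R \<Phi> hs \<tau> \<eta> f0) 4)"
proof -
  have sv: "sets vol = sets borel" using vol by (simp add: riemannian_volume_def)
  have st: "sets \<tau> = sets borel" using sv by (simp add: tau)
  have Z: "0 < emeasure vol UNIV" "emeasure vol UNIV < \<infinity>"
    using riemannian_volume_pos_finite[OF compact atlas vol] .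
  have prob: "emeasure \<tau> UNIV = 1"
    unfolding tau using Z sv by (subst emeasure_uniform_measure) (auto intro!: ennreal_divide_self)
  have cont: "continuous_on UNIV \<Phi>" using A1 by (simp add: assumption_A1_def)
  \<comment> \<open>Exponent 2 arises twice: from \<open>p = 2\<close> directly, and as
    \<open>2 * 1\<close> when the differential vanishes.\<close>
  have rate: "rate_bound \<eta> CARD('n) (psi R \<Phi> hs \<tau> \<eta> f0) p \<and>
      ((\<forall>\<theta>. G_bar_deriv gradR \<Phi> \<mu>s \<theta> = 0) \<longrightarrow> rate_bound \<eta> CARD('n) (psi R \<Phi> hs \<tau> \<eta> f0) (2 * p))"
    if taylor: "\<And>c x0. c \<in> \<A> \<Longrightarrow> x0 \<in> chart_image c \<Longrightarrow>
      \<exists>r>0. cball x0 (2 * r) \<subseteq> chart_image c \<and> (\<exists>L\<ge>0. taylor_in_chart c \<Phi> p x0 r L)" for p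
  proof -
    obtain K r where "0 < K" "0 < r"
      "\<And>\<epsilon>. \<epsilon> \<in> {0<..<r} \<Longrightarrow> \<exists>k. smoothing_kernel \<tau> \<Phi> UNIV (K / \<epsilon> ^ CARD('n)) (K * \<epsilon> ^ p) k"
      using smoothable_of_taylor[OF compact atlas vol tau cont taylor] unfolding smoothable_def by blast
    note * = rate_from_smoothing_kernels[OF prob st compact A1 A2 f0_dom f0_bounded mu_signed mu_min mu_nonneg _ this]
    show ?thesis using * by simp
  qed
  have geo: "lipschitz_geodesic \<A> \<Phi> \<Longrightarrow> rate_bound \<eta> CARD('n) (psi R \<Phi> hs \<tau> \<eta> f0) 1 \<and>
      ((\<forall>\<theta>. G_bar_deriv gradR \<Phi> \<mu>s \<theta> = 0) \<longrightarrow> rate_bound \<eta> CARD('n) (psi R \<Phi> hs \<tau> \<eta> f0) (2 * 1))"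
    by (rule rate) (rule lipschitz_geodesic_taylor[OF _ atlas])
  have der: "lipschitz_derivative \<A> \<Phi> \<Longrightarrow> rate_bound \<eta> CARD('n) (psi R \<Phi> hs \<tau> \<eta> f0) 2 \<and>
      ((\<forall>\<theta>. G_bar_deriv gradR \<Phi> \<mu>s \<theta> = 0) \<longrightarrow> rate_bound \<eta> CARD('n) (psi R \<Phi> hs \<tau> \<eta> f0) (2 * 2))"
    by (rule rate) (rule lipschitz_derivative_taylor[OF _ _ _ riemannian_atlas_chart(2)[OF atlas]])
  show ?thesis using geo der by auto
qed

end
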